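(* A consistent, conservative, adjoint consistent, and energy stable version of the CDG scheme with no mesh dependent stabilization parameter, i.e. $\mu=0$, has the SAT coefficients $$T^{(1)}_{\gamma k}=T^{(1)}_{\gamma v}=\tfrac12B_\gamma\Big[\tfrac{\beta_{\gamma k}-\beta_{\gamma v}+1}{\alpha_{\gamma k}}\Upsilon_{\gamma\gamma k}+\tfrac{\beta_{\gamma v}-\beta_{\gamma k}+1}{\alpha_{\gamma v}}\Upsilon_{\gamma\gamma v}\Big]B_\gamma,\quad T^{(4)}_{\gamma k}=T^{(4)}_{\gamma v}=0,\quad T^{(D)}_\gamma=\tfrac1{\alpha_{\gamma k}}B_\gamma\Upsilon_{\gamma\gamma k}B_\gamma,$$ $$T^{(2)}_{\gamma k}=\tfrac{\beta_{\gamma v}-\beta_{\gamma k}-1}2B_\gamma,\quad T^{(2)}_{\gamma v}=\tfrac{\beta_{\gamma k}-\beta_{\gamma v}-1}2B_\gamma,\quad T^{(3)}_{\gamma k}=\tfrac{\beta_{\gamma v}-\beta_{\gamma k}+1}2B_\gamma,\quad T^{(3)}_{\gamma v}=\tfrac{\beta_{\gamma k}-\beta_{\gamma v}+1}2B_\gamma,$$ $$T^{(5)}_{\gamma\epsilon k}=T^{(6)}_{\gamma\epsilon k}=0,\qquad T^{(6)}_{\gamma\delta v}=T^{(5)}_{\gamma\delta v}=0;$$ that is, the SBP-SAT discretization with these coefficients has the stated properties.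
   Context: **Problem.** $\Omega\subset\mathbb R^2$ is compact with piecewise smooth boundary $\Gamma^D\cup\Gamma^N$ ($\Gamma^D\ne\emptyset$), $\lambda$ a symmetric positive definite (SPD) $2\times2$ tensor field. $\partial_t\mathcal U-\nabla\cdot(\lambda\nabla\mathcal U)=\mathcal F$ in $\Omega$, $\mathcal U=\mathcal U_D$ on $\Gamma^D$, $(\lambda\nabla\mathcal U)\cdot n=\mathcal U_N$ on $\Gamma^N$. Adjoint of the steady problem for $\mathcal I(\mathcal U)=\int_\Omega\mathcal G\mathcal U-\int_{\Gamma^D}\psi_D(\lambda\nabla\mathcal U)\cdot n+\int_{\Gamma^N}\psi_N\mathcal U$: $-\nabla\cdot(\lambda\nabla\psi)=\mathcal G$, $\psi=\psi_D$ on $\Gamma^D$, $(\lambda\nabla\psi)\cdot n=\psi_N$ on $\Gamma^N$. **Mesh.** Non-overlapping (possibly curved) triangles $\Omega_k$ of diameter $h$, images of the reference triangle under bijective polynomial maps of degree at most $p+1$ with exact metric terms. $\Gamma_k$: facets of $\Omega_k$; $\Gamma_k^I$: the interior ones. For an interior facet $\gamma$ of $\Omega_k$, $\Omega_v$ is the neighbour across $\gamma$. ($\epsilon$ and $\delta$ denote the other interior facets of $\Omega_k$ and $\Omega_v$; $T^{(5)},T^{(6)}$ are coefficients of terms coupling through those facets and are absent here.) **Operators.** On $\Omega_k$ ($n_p$ volume nodes, $n_f$ nodes per facet, Legendre–Gauss facet quadrature of degree $2p+1$): $H_k$ diagonal SPD norm (quadrature) matrix; $B_\gamma$ diagonal matrix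 of positive facet quadrature weights (common to both sides); $N_{x\gamma k},N_{y\gamma k}$ diagonal matrices of outward unit normal components at facet nodes; $R_{\gamma k}\in\mathbb R^{n_f\times n_p}$ extrapolation to facet nodes, exact for degree $\le p$ polynomials on the reference element; $D_{xk},D_{yk}$ degree-$p$ SBP first-derivative matrices (order $p$ accurate at nodes, $D_{xk}\mathbf 1=D_{yk}\mathbf 1=0$) with $H_kD_{xk}+(H_kD_{xk})^T=\sum_{\gamma\subset\Gamma_k}R_{\gamma k}^TB_\gamma N_{x\gamma k}R_{\gamma k}$, similarly $y$. $\Lambda_k$: $2\times2$ block matrix with diagonal blocks holding $\lambda$ at the volume nodes. $N_{\gamma k}=\begin{bmatrix}N_{x\gamma k}\\ N_{y\gamma k}\end{bmatrix}$, $\bar R_{\gamma k}=\mathrm{diag}(R_{\gamma k},R_{\gamma k})$, $\bar H_k=\mathrm{diag}(H_k,H_k)$, $D^{(2)}_k=[D_{xk}\; D_{yk}]\Lambda_k\begin{bmatrix}D_{xk}\\ D_{yk}\end{bmatrix}$, $D_{\gamma k}=N_{\gamma k}^T\bar R_{\gamma k}\Lambda_k\begin{bmatrix}D_{xk}\\ D_{yk}\end{bmatrix}$, $\Upsilon_{\gamma\gamma k}=N_{\gamma k}^T\bar R_{\gamma k}\bar H_k^{-1}\Lambda_k\bar R_{\gamma k}^TN_{\gamma k}$. Facet weights $\alpha_{\gamma k}>0$ with $\sum_{\gamma\subset\Gamma_k}\alpha_{\gamma k}=1$. **Discretization** (with $T^{(5)}=T^{(6)}=0$). $\frac{du_{h,k}}{dt}=D^{(2)}_ku_{h,k}+f_k-H_k^{-1}s_k^I-H_k^{-1}s_k^B$,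 with $$s_k^I=\sum_{\gamma\subset\Gamma_k^I}[R_{\gamma k}^T\; D_{\gamma k}^T]\begin{bmatrix}T^{(1)}_{\gamma k}&T^{(3)}_{\gamma k}\\ T^{(2)}_{\gamma k}&T^{(4)}_{\gamma k}\end{bmatrix}\begin{bmatrix}R_{\gamma k}u_k-R_{\gamma v}u_v\\ D_{\gamma k}u_k+D_{\gamma v}u_v\end{bmatrix},$$ $$s_k^B=\sum_{\gamma\subset\Gamma^D\cap\Gamma_k}[R_{\gamma k}^T\; D_{\gamma k}^T]\begin{bmatrix}T_\gamma^{(D)}\\ -B_\gamma\end{bmatrix}(R_{\gamma k}u_k-u_{\gamma k})+\sum_{\gamma\subset\Gamma^N\cap\Gamma_k}R_{\gamma k}^TB_\gamma(D_{\gamma k}u_k-w_{\gamma k}),$$ $f_k$, $u_{\gamma k}$, $w_{\gamma k}$ the nodal values of $\mathcal F$, $\mathcal U$, $n\cdot(\lambda\nabla\mathcal U)$; set $L_{h,k}(u)=-D^{(2)}_ku_k+H_k^{-1}s^I_k+H_k^{-1}s^B_k$. **Definitions.** *Energy stable*: for $\mathcal F=\mathcal U_D=\mathcal U_N=0$, $\frac{d}{dt}\sum_ku_{h,k}^TH_ku_{h,k}\le0$. *Consistent*: $\lim_{h\to0}\sum_k\|L_{h,k}(u)-f_k\|_{H_k}=0$ for the exact steady solution in $\mathcal C^{p+1}$. *Conservative*: for $f_k=0$, $\sum_k\mathbf 1^TH_k\frac{du_{h,k}}{dt}$ reduces to boundary-facet terms only. *Adjoint consistent*: $\lim_{h\to0}\sum_k\|L^*_{h,k}(\psi)-g_k\|_{H_k}=0$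 for the exact adjoint in $\mathcal C^{p+1}$, where $g_k$ are nodal values of $\mathcal G$ and $L^*_{h,k}(\psi)=-D_k^{(2)}\psi_k+H_k^{-1}(s_k^I)^*+H_k^{-1}(s_k^B)^*$, $(s_k^B)^*$ being $s_k^B$ with $(u_k,u_{\gamma k},w_{\gamma k})$ replaced by $\psi_k$ and the facet values of $\psi$, $n\cdot(\lambda\nabla\psi)$, and $$(s_k^I)^*=\sum_{\gamma\subset\Gamma_k^I}[R_{\gamma k}^T\; D_{\gamma k}^T]\begin{bmatrix}T^{(1)}_{\gamma k}&-T^{(1)}_{\gamma v}&T^{(2)}_{\gamma k}+B_\gamma&-T^{(2)}_{\gamma v}\\ T^{(3)}_{\gamma k}-B_\gamma&T^{(3)}_{\gamma v}&T^{(4)}_{\gamma k}&T^{(4)}_{\gamma v}\end{bmatrix}\begin{bmatrix}R_{\gamma k}\psi_k\\ R_{\gamma v}\psi_v\\ D_{\gamma k}\psi_k\\ D_{\gamma v}\psi_v\end{bmatrix}.$$ **CDG and switches.** On each interior facet the switches $\beta_{\gamma k},\beta_{\gamma v}\in\{0,1\}$ are constants with $\beta_{\gamma k}+\beta_{\gamma v}=1$ (chosen as $\beta_{\gamma k}=1$ if $n_k\cdot\mathbf g\ge0$, else $0$, for a fixed global vector $\mathbf g$ and the normal $n_k$ of the straight-sided facet). The compact discontinuous Galerkin (CDG) method uses interior fluxes $\widehat{\mathcal U}=\{\mathcal U_h\}-\boldsymbol\beta\cdot[\![\mathcal U_h]\!]$, $\widehat{\mathcal W}=\{\mathcal W_h^\gamma\}+\boldsymbol\beta[\![\mathcal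 W_h^\gamma]\!]-\mu h^{-1}[\![\mathcal U_h]\!]$ with $\boldsymbol\beta=\frac12(\beta_{\gamma k}n_k+\beta_{\gamma v}n_v)$ and $\mathcal W^\gamma_h$ the auxiliary (flux) variable defined with facet-local lifting operators; $\mu$ is its mesh-dependent stabilization parameter. The coefficients in the claim, except for the scalings of $T^{(1)}$ and $T^{(D)}$, are those obtained by discretizing this method.
   Formalization: Consistency and adjoint consistency are stated for p ≥ 3 and λ of class C^p on uniformly regular meshes with α bounded below: with the literal sum of unsquared norms they fail for p = 1, 2 (e.g. x²+y², x³) and for rough λ; stability and conservation hold for all p. *)

theory Defs
  imports "HOL-Analysis.Analysis"
begin

section \<open>Differential notions in the plane\<close>

definition pd :: "2 \<Rightarrow> (real^2 \<Rightarrow> real) \<Rightarrow> real^2 \<Rightarrow> real" where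
  "pd i f x = frechet_derivative f (at x) (axis i 1)"

definition grad :: "(real^2 \<Rightarrow> real) \<Rightarrow> real^2 \<Rightarrow> real^2" where
  "grad f x = (\<chi> i. pd i f x)"

definition divergence :: "(real^2 \<Rightarrow> real^2) \<Rightarrow> real^2 \<Rightarrow> real" where
  "divergence W x = (\<Sum>i\<in>UNIV. pd i (\<lambda>y. W y $ i) x)"

fun C_open :: "nat \<Rightarrow> (real^2) set \<Rightarrow> (real^2 \<Rightarrow> real) \<Rightarrow> bool" where
  "C_open 0 S f = continuous_on S f"
| "C_open (Suc m) S f =
     ((\<forall>x\<in>S. f differentiable (at x)) \<and> (\<forall>i. C_open m S (pd i f)))"

text \<open>On a set that is not open, \<open>m\<close> times continuously differentiable means: so on some open
  neighbourhood.\<close>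

definition C_class :: "nat \<Rightarrow> (real^2) set \<Rightarrow> (real^2 \<Rightarrow> real) \<Rightarrow> bool" where
  "C_class m S f \<longleftrightarrow> (\<exists>U. open U \<and> S \<subseteq> U \<and> C_open m U f)"

text \<open>\<open>n\<close> is a unit vector, \<open>S\<close> has the tangent half plane \<open>n \<bullet> (y - x) \<le> 0\<close> at \<open>x\<close>.
  At a corner of \<open>S\<close> there is no such \<open>n\<close>.\<close>

definition outward_unit_normal :: "(real^2) set \<Rightarrow> real^2 \<Rightarrow> real^2 \<Rightarrow> bool" where
  "outward_unit_normal S x n \<longleftrightarrow> norm n = 1 \<and>
     (\<forall>e>0. \<exists>d>0. \<forall>y. norm (y - x) < d \<longrightarrow>
        (n \<bullet> (y - x) > e * norm (y - x) \<longrightarrow> y \<notin> S) \<and>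
        (n \<bullet> (y - x) < - e * norm (y - x) \<longrightarrow> y \<in> S))"

definition poly2 :: "nat \<Rightarrow> (real^2 \<Rightarrow> real) \<Rightarrow> bool" where
  "poly2 m q \<longleftrightarrow> (\<exists>c :: nat \<Rightarrow> nat \<Rightarrow> real.
     \<forall>x. q x = (\<Sum>a\<le>m. \<Sum>b\<le>m - a. c a b * (x $ 1) ^ a * (x $ 2) ^ b))"


section \<open>The diffusion problem\<close>

record diffusion_problem =
  Omega :: "(real^2) set"
  GammaD :: "(real^2) set"
  GammaN :: "(real^2) set"
  lam :: "real^2 \<Rightarrow> real^2^2"

definition SPD :: "real^2^2 \<Rightarrow> bool" where
  "SPD A \<longleftrightarrow> transpose A = A \<and> (\<forall>v. v \<noteq> 0 \<longrightarrow> v \<bullet> (A *v v) > 0)"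

definition piecewise_smooth_curve :: "(real^2) set \<Rightarrow> bool" where
  "piecewise_smooth_curve S \<longleftrightarrow> (\<exists>G. finite G \<and> S = (\<Union>g\<in>G. path_image g) \<and>
     (\<forall>g\<in>G. arc g \<and> g C1_differentiable_on {0..1} \<and>
            (\<forall>t\<in>{0..1}. vector_derivative g (at t) \<noteq> 0)))"

definition valid_problem :: "diffusion_problem \<Rightarrow> bool" where
  "valid_problem P \<longleftrightarrow> compact (Omega P) \<and>
     frontier (Omega P) = GammaD P \<union> GammaN P \<and>
     piecewise_smooth_curve (frontier (Omega P)) \<and> GammaD P \<noteq> {} \<and>
     (\<forall>x\<in>Omega P. SPD (lam P x))"

text \<open>The steady problem with source \<open>F\<close>, Dirichlet data \<open>gD\<close> and Neumann data \<open>gN\<close>.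
  The adjoint problem is the same problem with the data \<open>\<G>\<close>, \<open>\<psi>\<^sub>D\<close>, \<open>\<psi>\<^sub>N\<close>.\<close>

definition steady_solution ::
  "diffusion_problem \<Rightarrow> (real^2 \<Rightarrow> real) \<Rightarrow> (real^2 \<Rightarrow> real) \<Rightarrow> (real^2 \<Rightarrow> real) \<Rightarrow>
   (real^2 \<Rightarrow> real) \<Rightarrow> bool" where
  "steady_solution P F gD gN U \<longleftrightarrow>
     (\<forall>x\<in>Omega P. - divergence (\<lambda>y. lam P y *v grad U y) x = F x) \<and>
     (\<forall>x\<in>GammaD P. U x = gD x) \<and>
     (\<forall>x\<in>GammaN P. \<forall>n. outward_unit_normal (Omega P) x n \<longrightarrow>
        (lam P x *v grad U x) \<bullet> n = gN x)"


section \<open>Reference element, mesh and operators\<close>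

text \<open>\<open>'n\<close> indexes the volume nodes of an element, \<open>'f\<close> the nodes of a facet.\<close>

record ('n::finite, 'f::finite) reference_element =
  vol_nodes :: "(real^2)^'n"
  gl_nodes :: "real^'f"
  gl_weights :: "real^'f"

definition ref_triangle :: "(real^2) set" where
  "ref_triangle = {x. 0 \<le> x $ 1 \<and> 0 \<le> x $ 2 \<and> x $ 1 + x $ 2 \<le> 1}"

definition ref_edge :: "nat \<Rightarrow> real \<Rightarrow> real^2" where
  "ref_edge i t = (if i = 0 then vector [t, 0]
                   else if i = 1 then vector [1 - t, t]
                   else vector [0, 1 - t])"

text \<open>\<open>p + 1\<close> nodes integrating degree \<open>2 * p + 1\<close> exactly: this determines the
  Legendre-Gauss rule on the unit interval.\<close>

definition valid_reference_element :: "nat \<Rightarrow> ('n::finite, 'f::finite) reference_element \<Rightarrow> bool"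
  where
  "valid_reference_element p E \<longleftrightarrow>
     (\<forall>j. vol_nodes E $ j \<in> ref_triangle) \<and>
     CARD('f) = p + 1 \<and>
     (\<forall>m. gl_nodes E $ m \<in> {0<..<1} \<and> gl_weights E $ m > 0) \<and>
     (\<forall>d\<le>2 * p + 1. (\<Sum>m\<in>UNIV. gl_weights E $ m * (gl_nodes E $ m) ^ d)
                     = integral {0..1} (\<lambda>t. t ^ d))"

text \<open>Elements are indexed by natural numbers; a facet is identified with its set of points.

  \<open>map_coef k i a b\<close>: coefficient of \<open>x\<^sub>1\<^sup>a x\<^sub>2\<^sup>b\<close> in component \<open>i\<close> of the map of element \<open>k\<close>;
  \<open>param \<gamma>\<close>: a parametrization of \<open>\<gamma>\<close> over \<open>[0, 1]\<close> shared by both sides, which numbers the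
  facet nodes; \<open>H_weights k\<close>: diagonal of \<open>H\<^sub>k\<close>; \<open>Dmat 1\<close>, \<open>Dmat 2\<close>: \<open>D\<^sub>x\<close>, \<open>D\<^sub>y\<close>;
  \<open>normal \<gamma> k\<close>: normals at the nodes of \<open>\<gamma>\<close> pointing out of element \<open>k\<close>.\<close>

record ('n::finite, 'f::finite) disc =
  elems :: "nat set"
  map_coef :: "nat \<Rightarrow> 2 \<Rightarrow> nat \<Rightarrow> nat \<Rightarrow> real"
  param :: "(real^2) set \<Rightarrow> real \<Rightarrow> real^2"
  H_weights :: "nat \<Rightarrow> real^'n"
  Dmat :: "2 \<Rightarrow> nat \<Rightarrow> real^'n^'n"
  Rmat :: "(real^2) set \<Rightarrow> nat \<Rightarrow> real^'n^'f"
  normal :: "(real^2) set \<Rightarrow> nat \<Rightarrow> (real^2)^'f"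
  alpha :: "(real^2) set \<Rightarrow> nat \<Rightarrow> real"
  beta :: "(real^2) set \<Rightarrow> nat \<Rightarrow> real"

definition elem_map :: "nat \<Rightarrow> ('n::finite, 'f::finite) disc \<Rightarrow> nat \<Rightarrow> real^2 \<Rightarrow> real^2" where
  "elem_map p M k x =
     (\<chi> i. \<Sum>a\<le>p + 1. \<Sum>b\<le>p + 1 - a. map_coef M k i a b * (x $ 1) ^ a * (x $ 2) ^ b)"

definition elem :: "nat \<Rightarrow> ('n::finite, 'f::finite) disc \<Rightarrow> nat \<Rightarrow> (real^2) set" where
  "elem p M k = elem_map p M k ` ref_triangle"

definition facets :: "nat \<Rightarrow> ('n::finite, 'f::finite) disc \<Rightarrow> nat \<Rightarrow> (real^2) set set" where
  "facets p M k = (\<lambda>i. (\<lambda>t. elem_map p M k (ref_edge i t)) ` {0..1}) ` {0, 1, 2}"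

definition mesh_size :: "nat \<Rightarrow> ('n::finite, 'f::finite) disc \<Rightarrow> real" where
  "mesh_size p M = Max ((\<lambda>k. diameter (elem p M k)) ` elems M)"

definition is_neighbour ::
  "nat \<Rightarrow> ('n::finite, 'f::finite) disc \<Rightarrow> nat \<Rightarrow> (real^2) set \<Rightarrow> nat \<Rightarrow> bool" where
  "is_neighbour p M k \<gamma> v \<longleftrightarrow> v \<in> elems M \<and> v \<noteq> k \<and> \<gamma> \<in> facets p M v"

definition neighbour :: "nat \<Rightarrow> ('n::finite, 'f::finite) disc \<Rightarrow> nat \<Rightarrow> (real^2) set \<Rightarrow> nat" where
  "neighbour p M k \<gamma> = (THE v. is_neighbour p M k \<gamma> v)"

definition facets_I :: "nat \<Rightarrow> ('n::finite, 'f::finite) disc \<Rightarrow> nat \<Rightarrow> (real^2) set set" where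
  "facets_I p M k = {\<gamma> \<in> facets p M k. \<exists>v. is_neighbour p M k \<gamma> v}"

definition facets_D ::
  "diffusion_problem \<Rightarrow> nat \<Rightarrow> ('n::finite, 'f::finite) disc \<Rightarrow> nat \<Rightarrow> (real^2) set set" where
  "facets_D P p M k = {\<gamma> \<in> facets p M k - facets_I p M k. \<gamma> \<subseteq> GammaD P}"

definition facets_N ::
  "diffusion_problem \<Rightarrow> nat \<Rightarrow> ('n::finite, 'f::finite) disc \<Rightarrow> nat \<Rightarrow> (real^2) set set" where
  "facets_N P p M k = {\<gamma> \<in> facets p M k - facets_I p M k. \<gamma> \<subseteq> GammaN P}"

definition facet_node ::
  "('n::finite, 'f::finite) reference_element \<Rightarrow> ('n, 'f) disc \<Rightarrow> (real^2) set \<Rightarrow> 'f \<Rightarrow> real^2" where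
  "facet_node E M \<gamma> m = param M \<gamma> (gl_nodes E $ m)"

definition vol_node ::
  "nat \<Rightarrow> ('n::finite, 'f::finite) reference_element \<Rightarrow> ('n, 'f) disc \<Rightarrow> nat \<Rightarrow> 'n \<Rightarrow> real^2" where
  "vol_node p E M k j = elem_map p M k (vol_nodes E $ j)"

definition nodal ::
  "nat \<Rightarrow> ('n::finite, 'f::finite) reference_element \<Rightarrow> ('n, 'f) disc \<Rightarrow> (real^2 \<Rightarrow> real) \<Rightarrow>
   nat \<Rightarrow> real^'n" where
  "nodal p E M g k = (\<chi> j. g (vol_node p E M k j))"

definition diag :: "real^'a \<Rightarrow> real^'a^'a" where
  "diag d = (\<chi> i j. if i = j then d $ i else 0)"

definition Hmat :: "('n::finite, 'f::finite) disc \<Rightarrow> nat \<Rightarrow> real^'n^'n" where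
  "Hmat M k = diag (H_weights M k)"

definition Nmat :: "('n::finite, 'f::finite) disc \<Rightarrow> 2 \<Rightarrow> (real^2) set \<Rightarrow> nat \<Rightarrow> real^'f^'f" where
  "Nmat M a \<gamma> k = diag (\<chi> m. normal M \<gamma> k $ m $ a)"

definition Bmat ::
  "('n::finite, 'f::finite) reference_element \<Rightarrow> ('n, 'f) disc \<Rightarrow> (real^2) set \<Rightarrow> real^'f^'f" where
  "Bmat E M \<gamma> =
     diag (\<chi> m. gl_weights E $ m * norm (vector_derivative (param M \<gamma>) (at (gl_nodes E $ m))))"

definition conforming_mesh ::
  "diffusion_problem \<Rightarrow> nat \<Rightarrow> ('n::finite, 'f::finite) disc \<Rightarrow> bool" where
  "conforming_mesh P p M \<longleftrightarrow>
     finite (elems M) \<and> elems M \<noteq> {} \<and>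
     Omega P = (\<Union>k\<in>elems M. elem p M k) \<and>
     (\<forall>k\<in>elems M. \<forall>v\<in>elems M. k \<noteq> v \<longrightarrow>
        interior (elem p M k) \<inter> interior (elem p M v) = {}) \<and>
     (\<forall>k\<in>elems M. inj_on (elem_map p M k) ref_triangle \<and>
        (\<forall>x\<in>ref_triangle. det (jacobian (elem_map p M k) (at x)) \<noteq> 0)) \<and>
     (\<forall>k\<in>elems M. \<forall>\<gamma>\<in>facets p M k.
        (\<exists>!v. is_neighbour p M k \<gamma> v) \<or>
        (\<nexists>v. is_neighbour p M k \<gamma> v) \<and> (\<gamma> \<subseteq> GammaD P) \<noteq> (\<gamma> \<subseteq> GammaN P)) \<and>
     (\<forall>k\<in>elems M. \<forall>\<gamma>\<in>facets p M k. \<exists>i\<in>{0, 1, 2}.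
        (\<forall>t\<in>{0..1}. param M \<gamma> t = elem_map p M k (ref_edge i t)) \<or>
        (\<forall>t\<in>{0..1}. param M \<gamma> t = elem_map p M k (ref_edge i (1 - t))))"

text \<open>The order of accuracy of \<open>Dmat\<close> is a statement about mesh refinement (an operator on a
  curved element need not be exact on any nonconstant polynomial) and therefore part of
  \<open>mesh_family\<close> below.\<close>

definition discretization ::
  "diffusion_problem \<Rightarrow> nat \<Rightarrow> ('n::finite, 'f::finite) reference_element \<Rightarrow> ('n, 'f) disc \<Rightarrow> bool"
  where
  "discretization P p E M \<longleftrightarrow> conforming_mesh P p M \<and>
     (\<forall>k\<in>elems M.
        (\<forall>j. H_weights M k $ j > 0) \<and>
        (\<forall>a. Dmat M a k *v 1 = 0 \<and>
             Hmat M k ** Dmat M a k + transpose (Hmat M k ** Dmat M a k) =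
             (\<Sum>\<gamma>\<in>facets p M k.
                transpose (Rmat M \<gamma> k) ** Bmat E M \<gamma> ** Nmat M a \<gamma> k ** Rmat M \<gamma> k)) \<and>
        (\<forall>\<gamma>\<in>facets p M k.
           (\<forall>m. outward_unit_normal (elem p M k) (facet_node E M \<gamma> m) (normal M \<gamma> k $ m)) \<and>
           (\<forall>q. poly2 p q \<longrightarrow>
              Rmat M \<gamma> k *v (\<chi> j. q (vol_nodes E $ j)) =
              (\<chi> m. q (inv_into ref_triangle (elem_map p M k) (facet_node E M \<gamma> m)))) \<and>
           alpha M \<gamma> k > 0) \<and>
        (\<Sum>\<gamma>\<in>facets p M k. alpha M \<gamma> k) = 1 \<and>
        (\<forall>\<gamma>\<in>facets_I p M k.
           beta M \<gamma> k \<in> {0, 1} \<and> beta M \<gamma> k + beta M \<gamma> (neighbour p M k \<gamma>) = 1))"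

text \<open>Refinement \<open>h \<rightarrow> 0\<close>. The constant \<open>C\<close> expresses that the meshes are uniformly regular
  (for curved elements: coefficients of degree \<open>m\<close> of the element maps are \<open>O(h\<^sup>m)\<close>) and
  that the operators scale like their counterparts on the reference element.\<close>

definition mesh_family ::
  "diffusion_problem \<Rightarrow> nat \<Rightarrow> ('n::finite, 'f::finite) reference_element \<Rightarrow>
   (nat \<Rightarrow> ('n, 'f) disc) \<Rightarrow> bool" where
  "mesh_family P p E Ms \<longleftrightarrow>
     (\<forall>n. discretization P p E (Ms n)) \<and>
     (\<lambda>n. mesh_size p (Ms n)) \<longlonglongrightarrow> 0 \<and>
     (\<exists>C>0. \<forall>n. \<forall>k\<in>elems (Ms n).
        (\<forall>i a b. 1 \<le> a + b \<and> a + b \<le> p + 1 \<longrightarrow>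
           \<bar>map_coef (Ms n) k i a b\<bar> \<le> C * mesh_size p (Ms n) ^ (a + b)) \<and>
        (\<forall>x\<in>ref_triangle.
           (mesh_size p (Ms n))\<^sup>2 \<le> C * \<bar>det (jacobian (elem_map p (Ms n) k) (at x))\<bar>) \<and>
        (\<forall>j. (mesh_size p (Ms n))\<^sup>2 \<le> C * H_weights (Ms n) k $ j \<and>
             H_weights (Ms n) k $ j \<le> C * (mesh_size p (Ms n))\<^sup>2) \<and>
        (\<forall>a i j. \<bar>Dmat (Ms n) a k $ i $ j\<bar> \<le> C / mesh_size p (Ms n)) \<and>
        (\<forall>\<gamma>\<in>facets p (Ms n) k.
           1 \<le> C * alpha (Ms n) \<gamma> k \<and> (\<forall>m j. \<bar>Rmat (Ms n) \<gamma> k $ m $ j\<bar> \<le> C))) \<and>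
     (\<forall>V. C_class (p + 1) (Omega P) V \<longrightarrow>
        (\<exists>C. \<forall>n. \<forall>k\<in>elems (Ms n). \<forall>a j.
           \<bar>(Dmat (Ms n) a k *v nodal p E (Ms n) V k) $ j - pd a V (vol_node p E (Ms n) k j)\<bar>
           \<le> C * mesh_size p (Ms n) ^ p))"


section \<open>The SBP-SAT discretization\<close>

definition Lmat ::
  "diffusion_problem \<Rightarrow> nat \<Rightarrow> ('n::finite, 'f::finite) reference_element \<Rightarrow> ('n, 'f) disc \<Rightarrow>
   2 \<Rightarrow> 2 \<Rightarrow> nat \<Rightarrow> real^'n^'n" where
  "Lmat P p E M a b k = diag (\<chi> j. lam P (vol_node p E M k j) $ a $ b)"

definition D2 ::
  "diffusion_problem \<Rightarrow> nat \<Rightarrow> ('n::finite, 'f::finite) reference_element \<Rightarrow> ('n, 'f) disc \<Rightarrow>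
   nat \<Rightarrow> real^'n^'n" where
  "D2 P p E M k = (\<Sum>a\<in>UNIV. \<Sum>b\<in>UNIV. Dmat M a k ** Lmat P p E M a b k ** Dmat M b k)"

definition Dgam ::
  "diffusion_problem \<Rightarrow> nat \<Rightarrow> ('n::finite, 'f::finite) reference_element \<Rightarrow> ('n, 'f) disc \<Rightarrow>
   (real^2) set \<Rightarrow> nat \<Rightarrow> real^'n^'f" where
  "Dgam P p E M \<gamma> k = (\<Sum>a\<in>UNIV. \<Sum>b\<in>UNIV.
     transpose (Nmat M a \<gamma> k) ** Rmat M \<gamma> k ** Lmat P p E M a b k ** Dmat M b k)"

definition Ups ::
  "diffusion_problem \<Rightarrow> nat \<Rightarrow> ('n::finite, 'f::finite) reference_element \<Rightarrow> ('n, 'f) disc \<Rightarrow>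
   (real^2) set \<Rightarrow> nat \<Rightarrow> real^'f^'f" where
  "Ups P p E M \<gamma> k = (\<Sum>a\<in>UNIV. \<Sum>b\<in>UNIV.
     transpose (Nmat M a \<gamma> k) ** Rmat M \<gamma> k ** matrix_inv (Hmat M k) ** Lmat P p E M a b k
       ** transpose (Rmat M \<gamma> k) ** Nmat M b \<gamma> k)"

text \<open>SAT coefficients, with \<open>T\<^sup>(\<^sup>5\<^sup>)\<close> and \<open>T\<^sup>(\<^sup>6\<^sup>)\<close> identically zero.
  \<open>T1 S \<gamma> k\<close> is the coefficient on \<open>\<gamma>\<close> seen from element \<open>k\<close>.\<close>

record 'f sat =
  T1 :: "(real^2) set \<Rightarrow> nat \<Rightarrow> real^'f^'f"
  T2 :: "(real^2) set \<Rightarrow> nat \<Rightarrow> real^'f^'f"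
  T3 :: "(real^2) set \<Rightarrow> nat \<Rightarrow> real^'f^'f"
  T4 :: "(real^2) set \<Rightarrow> nat \<Rightarrow> real^'f^'f"
  TD :: "(real^2) set \<Rightarrow> nat \<Rightarrow> real^'f^'f"

definition s_I ::
  "diffusion_problem \<Rightarrow> nat \<Rightarrow> ('n::finite, 'f::finite) reference_element \<Rightarrow> ('n, 'f) disc \<Rightarrow>
   'f sat \<Rightarrow> (nat \<Rightarrow> real^'n) \<Rightarrow> nat \<Rightarrow> real^'n" where
  "s_I P p E M S u k = (\<Sum>\<gamma>\<in>facets_I p M k.
     let v = neighbour p M k \<gamma>;
         a = Rmat M \<gamma> k *v u k - Rmat M \<gamma> v *v u v;
         d = Dgam P p E M \<gamma> k *v u k + Dgam P p E M \<gamma> v *v u v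
     in transpose (Rmat M \<gamma> k) *v (T1 S \<gamma> k *v a + T3 S \<gamma> k *v d) +
        transpose (Dgam P p E M \<gamma> k) *v (T2 S \<gamma> k *v a + T4 S \<gamma> k *v d))"

definition s_B ::
  "diffusion_problem \<Rightarrow> nat \<Rightarrow> ('n::finite, 'f::finite) reference_element \<Rightarrow> ('n, 'f) disc \<Rightarrow>
   'f sat \<Rightarrow> (nat \<Rightarrow> real^'n) \<Rightarrow> ((real^2) set \<Rightarrow> nat \<Rightarrow> real^'f) \<Rightarrow>
   ((real^2) set \<Rightarrow> nat \<Rightarrow> real^'f) \<Rightarrow> nat \<Rightarrow> real^'n" where
  "s_B P p E M S u uB wB k =
     (\<Sum>\<gamma>\<in>facets_D P p M k.
        let a = Rmat M \<gamma> k *v u k - uB \<gamma> k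
        in transpose (Rmat M \<gamma> k) *v (TD S \<gamma> k *v a) +
           transpose (Dgam P p E M \<gamma> k) *v (- Bmat E M \<gamma> *v a)) +
     (\<Sum>\<gamma>\<in>facets_N P p M k.
        transpose (Rmat M \<gamma> k) *v (Bmat E M \<gamma> *v (Dgam P p E M \<gamma> k *v u k - wB \<gamma> k)))"

definition s_I_adj ::
  "diffusion_problem \<Rightarrow> nat \<Rightarrow> ('n::finite, 'f::finite) reference_element \<Rightarrow> ('n, 'f) disc \<Rightarrow>
   'f sat \<Rightarrow> (nat \<Rightarrow> real^'n) \<Rightarrow> nat \<Rightarrow> real^'n" where
  "s_I_adj P p E M S z k = (\<Sum>\<gamma>\<in>facets_I p M k.
     let v = neighbour p M k \<gamma>;
         ak = Rmat M \<gamma> k *v z k;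
         av = Rmat M \<gamma> v *v z v;
         dk = Dgam P p E M \<gamma> k *v z k;
         dv = Dgam P p E M \<gamma> v *v z v
     in transpose (Rmat M \<gamma> k) *v
          (T1 S \<gamma> k *v ak - T1 S \<gamma> v *v av
           + (T2 S \<gamma> k + Bmat E M \<gamma>) *v dk - T2 S \<gamma> v *v dv) +
        transpose (Dgam P p E M \<gamma> k) *v
          ((T3 S \<gamma> k - Bmat E M \<gamma>) *v ak + T3 S \<gamma> v *v av
           + T4 S \<gamma> k *v dk + T4 S \<gamma> v *v dv))"

definition semidiscrete_rhs ::
  "diffusion_problem \<Rightarrow> nat \<Rightarrow> ('n::finite, 'f::finite) reference_element \<Rightarrow> ('n, 'f) disc \<Rightarrow>
   'f sat \<Rightarrow> (nat \<Rightarrow> real^'n) \<Rightarrow> ((real^2) set \<Rightarrow> nat \<Rightarrow> real^'f) \<Rightarrow>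
   ((real^2) set \<Rightarrow> nat \<Rightarrow> real^'f) \<Rightarrow> (nat \<Rightarrow> real^'n) \<Rightarrow> nat \<Rightarrow> real^'n" where
  "semidiscrete_rhs P p E M S f uB wB u k =
     D2 P p E M k *v u k + f k - matrix_inv (Hmat M k) *v s_I P p E M S u k
     - matrix_inv (Hmat M k) *v s_B P p E M S u uB wB k"

definition Lh ::
  "diffusion_problem \<Rightarrow> nat \<Rightarrow> ('n::finite, 'f::finite) reference_element \<Rightarrow> ('n, 'f) disc \<Rightarrow>
   'f sat \<Rightarrow> ((real^2) set \<Rightarrow> nat \<Rightarrow> real^'f) \<Rightarrow> ((real^2) set \<Rightarrow> nat \<Rightarrow> real^'f) \<Rightarrow>
   (nat \<Rightarrow> real^'n) \<Rightarrow> nat \<Rightarrow> real^'n" where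
  "Lh P p E M S uB wB u k =
     - (D2 P p E M k *v u k) + matrix_inv (Hmat M k) *v s_I P p E M S u k
     + matrix_inv (Hmat M k) *v s_B P p E M S u uB wB k"

definition Lh_adj ::
  "diffusion_problem \<Rightarrow> nat \<Rightarrow> ('n::finite, 'f::finite) reference_element \<Rightarrow> ('n, 'f) disc \<Rightarrow>
   'f sat \<Rightarrow> ((real^2) set \<Rightarrow> nat \<Rightarrow> real^'f) \<Rightarrow> ((real^2) set \<Rightarrow> nat \<Rightarrow> real^'f) \<Rightarrow>
   (nat \<Rightarrow> real^'n) \<Rightarrow> nat \<Rightarrow> real^'n" where
  "Lh_adj P p E M S zB wB z k =
     - (D2 P p E M k *v z k) + matrix_inv (Hmat M k) *v s_I_adj P p E M S z k
     + matrix_inv (Hmat M k) *v s_B P p E M S z zB wB k"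

definition facet_values ::
  "('n::finite, 'f::finite) reference_element \<Rightarrow> ('n, 'f) disc \<Rightarrow> (real^2 \<Rightarrow> real) \<Rightarrow>
   (real^2) set \<Rightarrow> nat \<Rightarrow> real^'f" where
  "facet_values E M U \<gamma> k = (\<chi> m. U (facet_node E M \<gamma> m))"

definition facet_fluxes ::
  "diffusion_problem \<Rightarrow> ('n::finite, 'f::finite) reference_element \<Rightarrow> ('n, 'f) disc \<Rightarrow>
   (real^2 \<Rightarrow> real) \<Rightarrow> (real^2) set \<Rightarrow> nat \<Rightarrow> real^'f" where
  "facet_fluxes P E M U \<gamma> k =
     (\<chi> m. normal M \<gamma> k $ m \<bullet> (lam P (facet_node E M \<gamma> m) *v grad U (facet_node E M \<gamma> m)))"

definition H_norm :: "real^'n^'n \<Rightarrow> real^'n \<Rightarrow> real" where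
  "H_norm H v = sqrt (v \<bullet> (H *v v))"


section \<open>Properties of a choice of SAT coefficients\<close>

text \<open>A scheme \<open>T\<close> assigns SAT coefficients to every discretization.\<close>

definition energy_stable ::
  "diffusion_problem \<Rightarrow> nat \<Rightarrow> ('n::finite, 'f::finite) reference_element \<Rightarrow>
   (('n, 'f) disc \<Rightarrow> 'f sat) \<Rightarrow> bool" where
  "energy_stable P p E T \<longleftrightarrow> (\<forall>M (u :: real \<Rightarrow> nat \<Rightarrow> real^'n).
     discretization P p E M \<longrightarrow>
     (\<forall>t\<ge>0. \<forall>k\<in>elems M.
        ((\<lambda>s. u s k) has_vector_derivative
           semidiscrete_rhs P p E M (T M) (\<lambda>_. 0) (\<lambda>_ _. 0) (\<lambda>_ _. 0) (u t) k)
        (at t within {0..})) \<longrightarrow>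
     (\<forall>t\<ge>0. \<exists>e\<le>0.
        ((\<lambda>s. \<Sum>k\<in>elems M. u s k \<bullet> (Hmat M k *v u s k)) has_real_derivative e)
        (at t within {0..})))"

text \<open>The boundary-facet terms that remain are those of the summation-by-parts identity
  \<open>\<one>\<^sup>T H\<^sub>k D\<^sub>k\<^sup>(\<^sup>2\<^sup>) u\<^sub>k = \<Sum>\<^sub>\<gamma> \<one>\<^sup>T R\<^sub>\<gamma>\<^sub>k\<^sup>T B\<^sub>\<gamma> D\<^sub>\<gamma>\<^sub>k u\<^sub>k\<close>, restricted to boundary facets, and the
  boundary SATs: all contributions of interior facets cancel.\<close>

definition conservative ::
  "diffusion_problem \<Rightarrow> nat \<Rightarrow> ('n::finite, 'f::finite) reference_element \<Rightarrow>
   (('n, 'f) disc \<Rightarrow> 'f sat) \<Rightarrow> bool" where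
  "conservative P p E T \<longleftrightarrow> (\<forall>M u uB wB.
     discretization P p E M \<longrightarrow>
     (\<Sum>k\<in>elems M. 1 \<bullet> (Hmat M k *v semidiscrete_rhs P p E M (T M) (\<lambda>_. 0) uB wB u k)) =
     (\<Sum>k\<in>elems M.
        (\<Sum>\<gamma>\<in>facets_D P p M k \<union> facets_N P p M k.
           1 \<bullet> (transpose (Rmat M \<gamma> k) *v (Bmat E M \<gamma> *v (Dgam P p E M \<gamma> k *v u k))))
        - 1 \<bullet> s_B P p E M (T M) u uB wB k))"

definition consistent ::
  "diffusion_problem \<Rightarrow> nat \<Rightarrow> ('n::finite, 'f::finite) reference_element \<Rightarrow>
   (('n, 'f) disc \<Rightarrow> 'f sat) \<Rightarrow> bool" where
  "consistent P p E T \<longleftrightarrow> (\<forall>Ms F gD gN U.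
     mesh_family P p E Ms \<and> steady_solution P F gD gN U \<and> C_class (p + 1) (Omega P) U \<longrightarrow>
     (\<lambda>n. \<Sum>k\<in>elems (Ms n). H_norm (Hmat (Ms n) k)
        (Lh P p E (Ms n) (T (Ms n)) (facet_values E (Ms n) U) (facet_fluxes P E (Ms n) U)
           (nodal p E (Ms n) U) k - nodal p E (Ms n) F k)) \<longlonglongrightarrow> 0)"

definition adjoint_consistent ::
  "diffusion_problem \<Rightarrow> nat \<Rightarrow> ('n::finite, 'f::finite) reference_element \<Rightarrow>
   (('n, 'f) disc \<Rightarrow> 'f sat) \<Rightarrow> bool" where
  "adjoint_consistent P p E T \<longleftrightarrow> (\<forall>Ms G psiD psiN psi.
     mesh_family P p E Ms \<and> steady_solution P G psiD psiN psi \<and>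
     C_class (p + 1) (Omega P) psi \<longrightarrow>
     (\<lambda>n. \<Sum>k\<in>elems (Ms n). H_norm (Hmat (Ms n) k)
        (Lh_adj P p E (Ms n) (T (Ms n)) (facet_values E (Ms n) psi) (facet_fluxes P E (Ms n) psi)
           (nodal p E (Ms n) psi) k - nodal p E (Ms n) G k)) \<longlonglongrightarrow> 0)"


section \<open>The CDG coefficients with \<open>\<mu> = 0\<close>\<close>

definition cdg_sat ::
  "diffusion_problem \<Rightarrow> nat \<Rightarrow> ('n::finite, 'f::finite) reference_element \<Rightarrow> ('n, 'f) disc \<Rightarrow>
   'f sat" where
  "cdg_sat P p E M = \<lparr>
     T1 = (\<lambda>\<gamma> k. let v = neighbour p M k \<gamma> in
       (1 / 2) *\<^sub>R (Bmat E M \<gamma> **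
         (((beta M \<gamma> k - beta M \<gamma> v + 1) / alpha M \<gamma> k) *\<^sub>R Ups P p E M \<gamma> k +
          ((beta M \<gamma> v - beta M \<gamma> k + 1) / alpha M \<gamma> v) *\<^sub>R Ups P p E M \<gamma> v) ** Bmat E M \<gamma>)),
     T2 = (\<lambda>\<gamma> k. let v = neighbour p M k \<gamma> in
       ((beta M \<gamma> v - beta M \<gamma> k - 1) / 2) *\<^sub>R Bmat E M \<gamma>),
     T3 = (\<lambda>\<gamma> k. let v = neighbour p M k \<gamma> in
       ((beta M \<gamma> v - beta M \<gamma> k + 1) / 2) *\<^sub>R Bmat E M \<gamma>),
     T4 = (\<lambda>\<gamma> k. 0),
     TD = (\<lambda>\<gamma> k. (1 / alpha M \<gamma> k) *\<^sub>R (Bmat E M \<gamma> ** Ups P p E M \<gamma> k ** Bmat E M \<gamma>)) \<rparr>"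

end

(* Energy estimate: the interior and boundary penalties are exactly what is needed to complete the
   square in the diffusion form of each element, where the weights alpha split the volume energy of
   an element among its facets; with mu = 0 the switches make each interior facet draw on only one
   of its two elements.  Conservation follows from the same pairing of the two sides of a facet.
   For these coefficients the adjoint interface term coincides with the primal one, so adjoint
   consistency is consistency of the adjoint problem.  For consistency all residuals are
   O(h^(p-1)) at the nodes: R_gamma is exact on Taylor polynomials pulled back to the reference
   element up to O(h^(p+1)), since degree m coefficients of the element maps are O(h^m), and D is
   applied to the merely C^p flux through its Taylor polynomial at the node considered.  The H-norm
   contributes a factor h, and there are O(h^(-2)) elements because each has area at least c h^2. *)

theory Submission
  imports Defs
begin

section \<open>Taylor expansion in the plane\<close>

text \<open>The threshold \<open>3 \<le> p\<close> stems from the form of consistency: element norms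
  are added, not their squares, so the orders in h leave h^(p-2). The obstacle is uniformity. The
  accuracy of \<open>Dmat\<close> is given for one fixed C^(p+1) function at a time, with a constant
  depending on it, while a Taylor polynomial that moves with the node is a new function for every
  node and mesh. Expanded in global coordinates it is a combination of finitely many monomials with
  bounded coefficients, and linearity then yields a single constant. Extrapolation needs the dual
  bookkeeping: exactness holds in reference coordinates, where a pulled back polynomial has degree
  far above p and only the powers of h in its coefficients make the excess harmless. The predicate
  \<open>graded\<close> serves both, with scale 1 and with the mesh size as scale. Curved elements
  need not be convex, so Taylor segments can leave the domain; the expansions therefore live on a
  compact neighbourhood of it, once h is below its width. That the exact fluxes of two neighbours
  cancel requires opposite normals, which are derived from the disjointness of the element
  interiors.\<close>

lemma pd_eqI: "(f has_derivative f') (at x) \<Longrightarrow> pd i f x = f' (axis i 1)"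
  by (metis frechet_derivative_at pd_def)

lemma pd_cong:
  assumes "open S" "x \<in> S" "\<And>x. x \<in> S \<Longrightarrow> f x = g x"
  shows "pd i f x = pd i g x"
proof -
  have "(f has_derivative f') (at x) \<longleftrightarrow> (g has_derivative f') (at x)" for f'
    using has_derivative_transform_within_open[OF _ assms(1,2)] assms(3) by metis
  then show ?thesis by (simp add: pd_def frechet_derivative_def)
qed

lemma C_open_cong:
  assumes "open S" "\<And>x. x \<in> S \<Longrightarrow> f x = g x" "C_open m S f"
  shows "C_open m S g"
  using assms(2,3)
proof (induction m arbitrary: f g)
  case 0
  then show ?case using continuous_on_cong[of S S f g] by simp
next
  case (Suc m)
  have "g differentiable (at x)" if "x \<in> S" for x
    using Suc.prems that has_derivative_transform_within_open[OF _ assms(1) that]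
    unfolding differentiable_def by (metis C_open.simps(2) differentiable_def)
  moreover have "C_open m S (pd i g)" for i
    using Suc.IH[of "pd i f" "pd i g"] Suc.prems pd_cong[OF assms(1) _ Suc.prems(1)] by auto
  ultimately show ?case by simp
qed

lemma C_open_SucD: "C_open (Suc m) S f \<Longrightarrow> C_open m S f"
proof (induction m arbitrary: f)
  case 0
  then show ?case
    by (auto intro!: continuous_at_imp_continuous_on differentiable_imp_continuous_within)
qed (auto simp del: C_open.simps(1))

lemma C_open_le: "m \<le> n \<Longrightarrow> C_open n S f \<Longrightarrow> C_open m S f"
  by (induction rule: dec_induct) (auto dest: C_open_SucD simp del: C_open.simps)

lemma C_open_subset: "T \<subseteq> S \<Longrightarrow> C_open m S f \<Longrightarrow> C_open m T f"
  by (induction m arbitrary: f) (auto intro: continuous_on_subset)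

lemma C_open_add:
  assumes "open S" "C_open m S f" "C_open m S g"
  shows "C_open m S (\<lambda>x. f x + g x)"
  using assms(2,3)
proof (induction m arbitrary: f g)
  case (Suc m)
  have "C_open m S (pd i (\<lambda>x. f x + g x))" for i
  proof (rule C_open_cong[OF assms(1)])
    show "C_open m S (\<lambda>x. pd i f x + pd i g x)" using Suc by simp
    fix x assume "x \<in> S"
    then have "(f has_derivative frechet_derivative f (at x)) (at x)"
      "(g has_derivative frechet_derivative g (at x)) (at x)"
      using Suc.prems by (auto simp: frechet_derivative_works)
    from pd_eqI[OF has_derivative_add[OF this], of i]
    show "pd i f x + pd i g x = pd i (\<lambda>x. f x + g x) x" by (simp add: pd_def)
  qed
  then show ?case using Suc.prems by simp
qed (simp add: continuous_on_add)

lemma C_open_mult: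
  assumes "open S" "C_open m S f" "C_open m S g"
  shows "C_open m S (\<lambda>x. f x * g x)"
  using assms(2,3)
proof (induction m arbitrary: f g)
  case (Suc m)
  have "C_open m S (pd i (\<lambda>x. f x * g x))" for i
  proof (rule C_open_cong[OF assms(1)])
    show "C_open m S (\<lambda>x. f x * pd i g x + pd i f x * g x)"
      using Suc.prems by (intro C_open_add[OF assms(1)] Suc.IH C_open_SucD[OF Suc.prems(1)]
          C_open_SucD[OF Suc.prems(2)]) simp_all
    fix x assume "x \<in> S"
    then have "(f has_derivative frechet_derivative f (at x)) (at x)"
      "(g has_derivative frechet_derivative g (at x)) (at x)"
      using Suc.prems by (auto simp: frechet_derivative_works)
    from pd_eqI[OF has_derivative_mult[OF this], of i]
    show "f x * pd i g x + pd i f x * g x = pd i (\<lambda>x. f x * g x) x" by (simp add: pd_def)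
  qed
  then show ?case using Suc.prems by simp
qed (simp add: continuous_on_mult)

lemma C_open_const: "C_open m S (\<lambda>_. c)"
proof (induction m arbitrary: c)
  case (Suc m)
  have "pd i (\<lambda>_. c) = (\<lambda>_. 0)" for i
    by (rule ext) (rule pd_eqI[OF has_derivative_const])
  then show ?case using Suc by simp
qed simp

lemma C_open_coord: "C_open m S (\<lambda>x. x $ j)"
proof (cases m)
  case (Suc n)
  have d: "((\<lambda>x::real^2. x $ j) has_derivative (\<lambda>x. x $ j)) (at x)" for x
    by (rule bounded_linear_imp_has_derivative) (rule bounded_linear_vec_nth)
  have "pd i (\<lambda>x. x $ j) = (\<lambda>_. axis i 1 $ j)" for i
    by (rule ext) (rule pd_eqI[OF d])
  then show ?thesis using Suc d by (auto simp: C_open_const differentiable_def)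
qed (auto intro!: continuous_intros)

lemma C_open_power:
  assumes "open S" "C_open m S f"
  shows "C_open m S (\<lambda>x. f x ^ k)"
proof (induction k)
  case (Suc k)
  then show ?case using C_open_mult[OF assms(1,2) Suc] by simp
qed (simp add: C_open_const)

text \<open>Monomials are the only functions to which the accuracy clause for \<open>Dmat\<close> in
  \<open>mesh_family\<close> is ever applied; all others are reduced to them.\<close>

lemma C_class_monomial: "C_class m S (\<lambda>x. c * x $ 1 ^ a * x $ 2 ^ b)"
  unfolding C_class_def
  by (intro exI[of _ UNIV] conjI C_open_mult C_open_power C_open_const C_open_coord) auto

text \<open>The \<open>i\<close>-th directional derivative of \<open>f\<close> along \<open>v\<close> at \<open>x\<close>.\<close>

fun dsum :: "nat \<Rightarrow> (real^2 \<Rightarrow> real) \<Rightarrow> real^2 \<Rightarrow> real^2 \<Rightarrow> real" where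
  "dsum 0 f v x = f x"
| "dsum (Suc i) f v x = v $ 1 * dsum i (pd 1 f) v x + v $ 2 * dsum i (pd 2 f) v x"

lemma has_derivative_grad:
  assumes "f differentiable (at x)"
  shows "(f has_derivative (\<lambda>v. v $ 1 * pd 1 f x + v $ 2 * pd 2 f x)) (at x)"
proof -
  let ?D = "frechet_derivative f (at x)"
  have d: "(f has_derivative ?D) (at x)" using assms frechet_derivative_works by blast
  then interpret linear ?D by (rule has_derivative_linear)
  have "?D v = v $ 1 * pd 1 f x + v $ 2 * pd 2 f x" for v
  proof -
    have "v $ 1 *\<^sub>R axis 1 1 + v $ 2 *\<^sub>R axis 2 1 = v"
      by (simp add: vec_eq_iff forall_2 axis_def)
    moreover have "?D (v $ 1 *\<^sub>R axis 1 1 + v $ 2 *\<^sub>R axis 2 1) = v $ 1 * pd 1 f x + v $ 2 * pd 2 f x"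
      by (simp add: add scale pd_def)
    ultimately show ?thesis by simp
  qed
  then show ?thesis by (intro has_derivative_eq_rhs[OF d] ext)
qed

text \<open>The factors \<open>v $ 1\<close> and \<open>v $ 2\<close> are constant along the line,
  so differentiation passes into the recursion; \<open>f\<close> varies in the induction because the
  recursion replaces it by its partial derivatives.\<close>

lemma dsum_has_derivative_line:
  assumes "C_open (Suc i) S f" "x + t *\<^sub>R v \<in> S"
  shows "((\<lambda>t. dsum i f v (x + t *\<^sub>R v)) has_real_derivative dsum (Suc i) f v (x + t *\<^sub>R v)) (at t)"
  using assms
proof (induction i arbitrary: f)
  case 0
  have "((\<lambda>t. x + t *\<^sub>R v) has_derivative (\<lambda>t. t *\<^sub>R v)) (at t)"
    by (auto intro!: derivative_eq_intros)
  from has_derivative_compose[OF this has_derivative_grad, of f] 0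
  have "((\<lambda>t. f (x + t *\<^sub>R v)) has_derivative (\<lambda>s. (s *\<^sub>R v) $ 1 * pd 1 f (x + t *\<^sub>R v) +
      (s *\<^sub>R v) $ 2 * pd 2 f (x + t *\<^sub>R v))) (at t)" by simp
  then show ?case
    unfolding has_field_derivative_def dsum.simps
    by (rule has_derivative_eq_rhs) (auto simp: algebra_simps)
next
  case (Suc i)
  then have "((\<lambda>t. dsum i (pd j f) v (x + t *\<^sub>R v)) has_real_derivative
      dsum (Suc i) (pd j f) v (x + t *\<^sub>R v)) (at t)" for j
    by simp
  from DERIV_add[OF DERIV_cmult[OF this[of 1], of "v $ 1"] DERIV_cmult[OF this[of 2], of "v $ 2"]]
  show ?case by simp
qed

lemma dsum_bound:
  assumes "C_open i S f" "compact K" "K \<subseteq> S"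
  shows "\<exists>B\<ge>0. \<forall>x\<in>K. \<forall>v. \<bar>dsum i f v x\<bar> \<le> B * norm v ^ i"
  using assms(1)
proof (induction i arbitrary: f)
  case 0
  then have "compact (f ` K)"
    using compact_continuous_image[OF continuous_on_subset[OF _ assms(3)] assms(2), of f] by simp
  then obtain B where "\<forall>y\<in>f ` K. norm y \<le> B" using compact_imp_bounded bounded_iff by metis
  then show ?case by (intro exI[of _ "max B 0"]) auto
next
  case (Suc i)
  from Suc.IH[of "pd 1 f"] Suc.prems obtain B1 where
    B1: "B1 \<ge> 0" "\<And>x v. x \<in> K \<Longrightarrow> \<bar>dsum i (pd 1 f) v x\<bar> \<le> B1 * norm v ^ i" by auto
  from Suc.IH[of "pd 2 f"] Suc.prems obtain B2 where
    B2: "B2 \<ge> 0" "\<And>x v. x \<in> K \<Longrightarrow> \<bar>dsum i (pd 2 f) v x\<bar> \<le> B2 * norm v ^ i" by auto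
  have "\<bar>dsum (Suc i) f v x\<bar> \<le> (B1 + B2) * norm v ^ Suc i" if "x \<in> K" for x v
  proof -
    have "\<bar>dsum (Suc i) f v x\<bar> \<le> \<bar>v $ 1\<bar> * \<bar>dsum i (pd 1 f) v x\<bar> + \<bar>v $ 2\<bar> * \<bar>dsum i (pd 2 f) v x\<bar>"
      using abs_triangle_ineq[of "v $ 1 * dsum i (pd 1 f) v x" "v $ 2 * dsum i (pd 2 f) v x"] by (simp add: abs_mult)
    also have "\<dots> \<le> norm v * (B1 * norm v ^ i) + norm v * (B2 * norm v ^ i)"
      using B1 B2 that by (intro add_mono mult_mono component_le_norm_cart) auto
    finally show ?thesis by (simp add: algebra_simps)
  qed
  then show ?case using B1(1) B2(1) by (intro exI[of _ "B1 + B2"]) auto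
qed

text \<open>One-variable Taylor formula with Lagrange remainder for the restriction of
  \<open>f\<close> to the segment, whose iterated derivatives are the values of
  \<open>dsum\<close>.\<close>

lemma taylor_dsum:
  assumes S: "open S" and f: "C_open m S f" and m: "0 < m"
    and seg: "closed_segment x y \<subseteq> S"
  shows "\<exists>z\<in>closed_segment x y. f y =
    (\<Sum>i<m. dsum i f (y - x) x / fact i) + dsum m f (y - x) z / fact m"
proof -
  define v where "v = y - x"
  have in_seg: "x + t *\<^sub>R v \<in> closed_segment x y" if "0 \<le> t" "t \<le> 1" for t
    using that unfolding closed_segment_def v_def
    by (auto intro!: exI[of _ t] simp: algebra_simps)
  have d: "\<forall>i t. i < m \<and> 0 \<le> t \<and> t \<le> 1 \<longrightarrow> ((\<lambda>t. dsum i f v (x + t *\<^sub>R v)) has_real_derivative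
      dsum (Suc i) f v (x + t *\<^sub>R v)) (at t)"
  proof (intro allI impI)
    fix i t assume a: "i < m \<and> 0 \<le> t \<and> t \<le> (1::real)"
    show "((\<lambda>t. dsum i f v (x + t *\<^sub>R v)) has_real_derivative dsum (Suc i) f v (x + t *\<^sub>R v)) (at t)"
      using a seg in_seg by (intro dsum_has_derivative_line[of i S] C_open_le[OF _ f]) auto
  qed
  from Maclaurin[where diff = "\<lambda>i t. dsum i f v (x + t *\<^sub>R v)" and f = "\<lambda>t. f (x + t *\<^sub>R v)",
      OF zero_less_one m _ d]
  obtain t where "0 < t" "t < 1" "f (x + 1 *\<^sub>R v) = (\<Sum>i<m. dsum i f v (x + 0 *\<^sub>R v) / fact i * 1 ^ i)
      + dsum m f v (x + t *\<^sub>R v) / fact m * 1 ^ m" by auto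
  then show ?thesis
    using in_seg[of t] by (intro bexI[of _ "x + t *\<^sub>R v"]) (auto simp: v_def)
qed

text \<open>The intermediate point of the remainder lies on the segment, hence in \<open>K\<close>,
  where compactness bounds the derivatives of order \<open>m\<close>; one \<open>B\<close> therefore
  serves all pairs of points.\<close>

lemma taylor_bound:
  assumes S: "open S" and f: "C_open m S f" and m: "0 < m" and K: "compact K" "K \<subseteq> S"
  shows "\<exists>B\<ge>0. \<forall>x y. closed_segment x y \<subseteq> K \<longrightarrow>
    \<bar>f y - (\<Sum>i<m. dsum i f (y - x) x / fact i)\<bar> \<le> B * norm (y - x) ^ m"
proof -
  obtain B where B: "B \<ge> 0" "\<And>x v. x \<in> K \<Longrightarrow> \<bar>dsum m f v x\<bar> \<le> B * norm v ^ m"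
    using dsum_bound[OF f K] by blast
  have "\<bar>f y - (\<Sum>i<m. dsum i f (y - x) x / fact i)\<bar> \<le> B * norm (y - x) ^ m"
    if seg: "closed_segment x y \<subseteq> K" for x y
  proof -
    obtain z where z: "z \<in> K" "f y = (\<Sum>i<m. dsum i f (y - x) x / fact i) + dsum m f (y - x) z / fact m"
      using taylor_dsum[OF S f m, of x y] seg K by blast
    have "\<bar>dsum m f (y - x) z / fact m\<bar> \<le> \<bar>dsum m f (y - x) z\<bar> / 1"
      unfolding abs_divide by (intro divide_left_mono frac_le) (auto simp: fact_ge_1)
    then show ?thesis using B(2)[OF z(1), of "y - x"] z(2) by simp
  qed
  then show ?thesis using B(1) by blast
qed

lemma dsum_differentiable: "(\<lambda>v. dsum i f v x) differentiable (at v)"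
proof (induction i arbitrary: f)
  case (Suc i)
  have "(\<lambda>v::real^2. v $ j) differentiable (at v)" for j
    using bounded_linear_imp_differentiable[OF bounded_linear_vec_nth] .
  then show ?case using Suc by simp
qed simp

text \<open>Each summand is a component of \<open>v\<close> times a factor that also vanishes at 0,
  so both terms of the product rule vanish.\<close>

lemma dsum_has_derivative_zero:
  assumes "2 \<le> i"
  shows "((\<lambda>v. dsum i f v x) has_derivative (\<lambda>_. 0)) (at 0)"
proof -
  obtain k where i: "i = Suc (Suc k)"
    using assms by (metis Suc_le_D numeral_2_eq_2 Suc_le_mono)
  have "((\<lambda>v. v $ j * dsum (Suc k) g v x) has_derivative (\<lambda>_. 0)) (at 0)" for j g
  proof -
    have 1: "((\<lambda>v::real^2. v $ j) has_derivative (\<lambda>v. v $ j)) (at 0)"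
      by (rule bounded_linear_imp_has_derivative) (rule bounded_linear_vec_nth)
    obtain D where "((\<lambda>v. dsum (Suc k) g v x) has_derivative D) (at 0)"
      using dsum_differentiable unfolding differentiable_def by blast
    from has_derivative_mult[OF 1 this] show ?thesis by simp
  qed
  from has_derivative_add[OF this[of 1 "pd 1 f"] this[of 2 "pd 2 f"]]
  show ?thesis unfolding i by simp
qed

text \<open>Only the term \<open>i = 1\<close> contributes, because higher terms vanish to second
  order at the base point. Thus the derivative of a function at a node may be read off its Taylor
  polynomial there.\<close>

lemma taylor_poly_pd:
  assumes "2 \<le> m"
  shows "pd j (\<lambda>y. \<Sum>i<m. dsum i f (y - x) x / fact i) x = pd j f x"
proof -
  have sub: "((\<lambda>y. y - x) has_derivative (\<lambda>v. v)) (at x)"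
    by (auto intro!: derivative_eq_intros)
  have "((\<lambda>y. dsum i f (y - x) x) has_derivative
      (\<lambda>v. if i = 1 then v $ 1 * pd 1 f x + v $ 2 * pd 2 f x else 0)) (at x)" for i
  proof (cases "2 \<le> i")
    case True
    have "((\<lambda>v. dsum i f v x) has_derivative (\<lambda>_. 0)) (at (x - x))"
      using dsum_has_derivative_zero[OF True] by simp
    from has_derivative_compose[OF sub this] show ?thesis using True by simp
  next
    case False
    then consider "i = 0" | "i = 1" by linarith
    then show ?thesis
    proof cases
      case 2
      have "((\<lambda>v. dsum 1 f v x) has_derivative (\<lambda>v. v $ 1 * pd 1 f x + v $ 2 * pd 2 f x)) (at (x - x))"
        by (auto intro!: bounded_linear_imp_has_derivative bounded_linear_add
            bounded_linear_mult_const[OF bounded_linear_vec_nth])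
      from has_derivative_compose[OF sub this] show ?thesis using 2 by simp
    qed simp
  qed
  then have "((\<lambda>y. \<Sum>i<m. dsum i f (y - x) x * (1 / fact i)) has_derivative
      (\<lambda>v. \<Sum>i<m. (if i = 1 then v $ 1 * pd 1 f x + v $ 2 * pd 2 f x else 0) * (1 / fact i))) (at x)"
    by (intro has_derivative_sum has_derivative_mult_left)
  from pd_eqI[OF this, of j]
  have "pd j (\<lambda>y. \<Sum>i<m. dsum i f (y - x) x / fact i) x =
     (\<Sum>i<m. (if i = 1 then axis j 1 $ 1 * pd 1 f x + axis j 1 $ 2 * pd 2 f x else 0) * (1 / fact i))"
    by simp
  also have "\<dots> = (\<Sum>i<m. if i = 1 then axis j 1 $ 1 * pd 1 f x + axis j 1 $ 2 * pd 2 f x else 0)"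
    by (rule sum.cong) auto
  also have "\<dots> = axis j 1 $ 1 * pd 1 f x + axis j 1 $ 2 * pd 2 f x"
    using assms by simp
  also have "\<dots> = pd j f x"
    using exhaust_2[of j] by (auto simp: axis_def)
  finally show ?thesis .
qed

section \<open>Polynomials of bounded degree and their scaling in h\<close>

lemma poly2_monomial:
  assumes "a + b \<le> m"
  shows "poly2 m (\<lambda>x. c * x $ 1 ^ a * x $ 2 ^ b)"
  unfolding poly2_def
proof (intro exI allI)
  fix x :: "real^2"
  let ?c = "\<lambda>a' b'. if a' = a \<and> b' = b then c else (0::real)"
  have "(\<Sum>a'\<le>m. \<Sum>b'\<le>m - a'. ?c a' b' * x $ 1 ^ a' * x $ 2 ^ b') =
     (\<Sum>a'\<le>m. if a' = a then c * x $ 1 ^ a * x $ 2 ^ b else 0)"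
  proof (rule sum.cong[OF refl])
    fix a'
    have "(\<Sum>b'\<le>m - a'. ?c a' b' * x $ 1 ^ a' * x $ 2 ^ b') =
        (\<Sum>b'\<le>m - a'. if b' = b then (if a' = a then c * x $ 1 ^ a * x $ 2 ^ b else 0) else 0)"
      by (rule sum.cong) auto
    then show "(\<Sum>b'\<le>m - a'. ?c a' b' * x $ 1 ^ a' * x $ 2 ^ b') =
        (if a' = a then c * x $ 1 ^ a * x $ 2 ^ b else 0)"
      using assms by auto
  qed
  then show "c * x $ 1 ^ a * x $ 2 ^ b = (\<Sum>a'\<le>m. \<Sum>b'\<le>m - a'. ?c a' b' * x $ 1 ^ a' * x $ 2 ^ b')"
    using assms by simp
qed

lemma poly2_const: "poly2 m (\<lambda>_. c)"
  using poly2_monomial[of 0 0 m c] by simp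

lemma poly2_add:
  assumes "poly2 m f" "poly2 m g"
  shows "poly2 m (\<lambda>x. f x + g x)"
proof -
  obtain c d where c: "\<forall>x. f x = (\<Sum>a\<le>m. \<Sum>b\<le>m - a. c a b * (x $ 1) ^ a * (x $ 2) ^ b)"
    and d: "\<forall>x. g x = (\<Sum>a\<le>m. \<Sum>b\<le>m - a. d a b * (x $ 1) ^ a * (x $ 2) ^ b)"
    using assms unfolding poly2_def by blast
  show ?thesis
    unfolding poly2_def
    by (intro exI[of _ "\<lambda>a b. c a b + d a b"])
      (simp add: c[rule_format] d[rule_format] sum.distrib algebra_simps)
qed

text \<open>Functions \<open>x \<mapsto> F (h x)\<close> with \<open>F\<close> a polynomial of degree at most \<open>N\<close> whose coefficients have
  absolute sum at most \<open>B\<close>: the form that element maps, and hence pulled back Taylor polynomials,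
  have on the reference element.\<close>

inductive graded :: "real \<Rightarrow> nat \<Rightarrow> real \<Rightarrow> (real^2 \<Rightarrow> real) \<Rightarrow> bool" for h N where
  monomial: "a + b \<le> N \<Longrightarrow> \<bar>c\<bar> \<le> B * h ^ (a + b) \<Longrightarrow> graded h N B (\<lambda>x. c * x $ 1 ^ a * x $ 2 ^ b)"
| add: "graded h N B f \<Longrightarrow> graded h N C g \<Longrightarrow> graded h N (B + C) (\<lambda>x. f x + g x)"

lemma graded_nonneg: "graded h N B f \<Longrightarrow> 0 < h \<Longrightarrow> 0 \<le> B"
proof (induction rule: graded.induct)
  case (monomial a b c B)
  have "0 \<le> B * h ^ (a + b)" using monomial(2) abs_ge_zero order_trans by blast
  moreover have "0 < h ^ (a + b)" using monomial by simp
  ultimately show ?case by (metis linorder_not_le mult_neg_pos)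
qed simp

lemma graded_mono: "graded h N B f \<Longrightarrow> 0 < h \<Longrightarrow> B \<le> C \<Longrightarrow> N \<le> N' \<Longrightarrow> graded h N' C f"
proof (induction arbitrary: C rule: graded.induct)
  case (monomial a b c B)
  then have "\<bar>c\<bar> \<le> C * h ^ (a + b)"
    by (meson mult_right_mono order_trans zero_le_power less_imp_le)
  then show ?case using monomial by (intro graded.monomial) auto
next
  case (add B f C' g)
  \<comment> \<open>The surplus in the bound goes to the first summand:
    \<open>B + C' \<le> C\<close> makes \<open>C - C'\<close> at least \<open>B\<close>.\<close>
  have "graded h N' (C - C') f" "graded h N' C' g" using add by (auto simp: algebra_simps)
  from graded.add[OF this] show ?case by simp
qed

lemma graded_const: "\<bar>c\<bar> \<le> B \<Longrightarrow> graded h N B (\<lambda>_. c)"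
  using graded.monomial[of 0 0 N c B h] by simp

lemma graded_mult:
  assumes "graded h N B f" "graded h N' C g" "0 < h"
  shows "graded h (N + N') (B * C) (\<lambda>x. f x * g x)"
  using assms(1)
proof (induction rule: graded.induct)
  case (monomial a b c B)
  note ab = monomial
  show ?case
    using assms(2)
  proof (induction rule: graded.induct)
    case (monomial a' b' c' C)
    have "\<bar>c * c'\<bar> \<le> (B * h ^ (a + b)) * (C * h ^ (a' + b'))"
      unfolding abs_mult using ab monomial by (intro mult_mono) (auto intro: order_trans[OF abs_ge_zero])
    also have "\<dots> = B * C * h ^ ((a + a') + (b + b'))" by (simp add: power_add algebra_simps)
    finally have "graded h (N + N') (B * C) (\<lambda>x. (c * c') * x $ 1 ^ (a + a') * x $ 2 ^ (b + b'))"
      using ab monomial by (intro graded.monomial) auto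
    then show ?case by (simp add: power_add algebra_simps)
  next
    case (add C1 g1 C2 g2)
    from graded.add[OF add(3,4)] show ?case by (simp add: algebra_simps)
  qed
next
  case (add B1 f1 B2 f2)
  from graded.add[OF add(3,4)] show ?case by (simp add: algebra_simps)
qed

lemma graded_cmult:
  assumes "graded h N B f" "0 < h"
  shows "graded h N (\<bar>c\<bar> * B) (\<lambda>x. c * f x)"
  using graded_mult[OF graded_const[of c "\<bar>c\<bar>" h 0] assms] by simp

lemma graded_sum:
  assumes "finite I" "\<And>i. i \<in> I \<Longrightarrow> graded h N (B i) (f i)"
  shows "graded h N (\<Sum>i\<in>I. B i) (\<lambda>x. \<Sum>i\<in>I. f i x)"
  using assms by (induction I) (auto intro: graded_const graded.add)

lemma ref_triangle_bounds:
  assumes "x \<in> ref_triangle"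
  shows "0 \<le> x $ 1" "x $ 1 \<le> 1" "0 \<le> x $ 2" "x $ 2 \<le> 1"
  using assms by (auto simp: ref_triangle_def)

text \<open>Take for \<open>q\<close> the truncation to degree \<open>p\<close>. A dropped monomial
  has a coefficient of order h^(p+1) or smaller, as \<open>h \<le> 1\<close>, and the coordinates
  are at most 1 on the reference triangle; the degree \<open>N\<close> does not enter.\<close>

lemma graded_approx:
  assumes "graded h N B f" "0 < h" "h \<le> 1"
  shows "\<exists>q. poly2 p q \<and> (\<forall>x\<in>ref_triangle. \<bar>f x - q x\<bar> \<le> B * h ^ (p + 1))"
  using assms(1)
proof (induction rule: graded.induct)
  case (monomial a b c B)
  have B: "0 \<le> B" using graded_nonneg[OF graded.monomial[OF monomial]] assms by simp
  show ?case
  proof (cases "a + b \<le> p")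
    case True
    show ?thesis
      using poly2_monomial[OF True, of c] B assms
      by (intro exI[of _ "\<lambda>x. c * x $ 1 ^ a * x $ 2 ^ b"]) simp
  next
    case False
    have "\<bar>c * x $ 1 ^ a * x $ 2 ^ b - 0\<bar> \<le> B * h ^ (p + 1)" if x: "x \<in> ref_triangle" for x
    proof -
      have "\<bar>c * x $ 1 ^ a * x $ 2 ^ b - 0\<bar> \<le> \<bar>c\<bar> * 1 * 1"
        unfolding diff_zero abs_mult power_abs using ref_triangle_bounds[OF x]
        by (intro mult_mono power_le_one) auto
      also have "\<dots> \<le> B * h ^ (a + b)" using monomial by simp
      also have "\<dots> \<le> B * h ^ (p + 1)"
        using B assms False by (intro mult_left_mono power_decreasing) auto
      finally show ?thesis .
    qed
    then show ?thesis using poly2_const[of p 0] by blast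
  qed
next
  case (add B f C g)
  then obtain q r where q: "poly2 p q" "poly2 p r"
    "\<And>x. x \<in> ref_triangle \<Longrightarrow> \<bar>f x - q x\<bar> \<le> B * h ^ (p + 1)"
    "\<And>x. x \<in> ref_triangle \<Longrightarrow> \<bar>g x - r x\<bar> \<le> C * h ^ (p + 1)" by blast
  have "\<bar>f x + g x - (q x + r x)\<bar> \<le> (B + C) * h ^ (p + 1)" if "x \<in> ref_triangle" for x
    using q(3,4)[OF that] unfolding distrib_right by linarith
  then show ?case using poly2_add[OF q(1,2)] by blast
qed

lemma power_diff_bound:
  fixes s t :: real
  assumes "\<bar>s\<bar> \<le> 1" "\<bar>t\<bar> \<le> 1"
  shows "\<bar>s ^ a - t ^ a\<bar> \<le> a * \<bar>s - t\<bar>"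
  using norm_power_diff[of s t a] assms by simp

text \<open>Constants drop out of the difference and every other coefficient is at most
  \<open>B * h\<close>, which is the source of the factor \<open>h\<close>; \<open>N\<close> bounds
  the exponents that come out of the differences of powers.\<close>

lemma graded_lipschitz:
  assumes "graded h N B f" "0 < h" "h \<le> 1" "x \<in> ref_triangle" "y \<in> ref_triangle"
  shows "\<bar>f x - f y\<bar> \<le> B * N * h * (\<bar>x $ 1 - y $ 1\<bar> + \<bar>x $ 2 - y $ 2\<bar>)"
  using assms(1)
proof (induction rule: graded.induct)
  case (monomial a b c B)
  let ?d = "\<bar>x $ 1 - y $ 1\<bar> + \<bar>x $ 2 - y $ 2\<bar>"
  have B: "0 \<le> B" using graded_nonneg[OF graded.monomial[OF monomial]] assms by simp
  note bounds = ref_triangle_bounds[OF assms(4)] ref_triangle_bounds[OF assms(5)]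
  show ?case
  proof (cases "a + b = 0")
    case True
    then show ?thesis using B assms by simp
  next
    case False
    have "c * x $ 1 ^ a * x $ 2 ^ b - c * y $ 1 ^ a * y $ 2 ^ b =
      c * ((x $ 1 ^ a - y $ 1 ^ a) * x $ 2 ^ b + y $ 1 ^ a * (x $ 2 ^ b - y $ 2 ^ b))"
      by (simp add: algebra_simps)
    also have "\<bar>\<dots>\<bar> \<le> \<bar>c\<bar> * (\<bar>x $ 1 ^ a - y $ 1 ^ a\<bar> * \<bar>x $ 2 ^ b\<bar> + \<bar>y $ 1 ^ a\<bar> * \<bar>x $ 2 ^ b - y $ 2 ^ b\<bar>)"
      unfolding abs_mult by (intro mult_left_mono order_trans[OF abs_triangle_ineq]) (auto simp: abs_mult)
    also have "\<dots> \<le> \<bar>c\<bar> * ((a * \<bar>x $ 1 - y $ 1\<bar>) * 1 + 1 * (b * \<bar>x $ 2 - y $ 2\<bar>))"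
      using bounds
      by (intro mult_left_mono add_mono mult_mono power_diff_bound) (auto simp: power_abs intro!: power_le_one)
    also have "\<dots> \<le> \<bar>c\<bar> * (N * ?d)"
    proof -
      have "real a * \<bar>x $ 1 - y $ 1\<bar> \<le> N * \<bar>x $ 1 - y $ 1\<bar>" "real b * \<bar>x $ 2 - y $ 2\<bar> \<le> N * \<bar>x $ 2 - y $ 2\<bar>"
        using monomial(1) by (auto intro!: mult_right_mono)
      then show ?thesis by (intro mult_left_mono) (auto simp: algebra_simps)
    qed
    also have "\<dots> \<le> (B * h) * (N * ?d)"
    proof -
      have "\<bar>c\<bar> \<le> B * h ^ (a + b)" by (rule monomial)
      also have "\<dots> \<le> B * h ^ 1" using False assms B by (intro mult_left_mono power_decreasing) auto
      finally show ?thesis by (intro mult_right_mono) auto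
    qed
    finally show ?thesis by (simp add: algebra_simps)
  qed
next
  case (add B f C g)
  have "\<bar>f x + g x - (f y + g y)\<bar> \<le> \<bar>f x - f y\<bar> + \<bar>g x - g y\<bar>" by linarith
  also note add_mono[OF add(3,4)]
  finally show ?case by (simp add: algebra_simps)
qed

text \<open>Every order of differentiation brings one component of \<open>v\<close>, hence degree
  \<open>N\<close> and a factor \<open>A\<close>. The point is that \<open>B\<close> is uniform in
  \<open>x\<close>, \<open>h\<close> and \<open>v\<close>, since \<open>v\<close> will be the
  displacement from a point that varies with the mesh and the element.\<close>

lemma dsum_graded:
  assumes "C_open i S f" "compact K" "K \<subseteq> S" "0 \<le> A"
  shows "\<exists>B\<ge>0. \<forall>x\<in>K. \<forall>h>0. \<forall>v. graded h N A (\<lambda>\<xi>. v \<xi> $ 1) \<longrightarrow> graded h N A (\<lambda>\<xi>. v \<xi> $ 2) \<longrightarrow>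
    graded h (i * N) B (\<lambda>\<xi>. dsum i f (v \<xi>) x)"
  using assms(1)
proof (induction i arbitrary: f)
  case 0
  obtain B where "B \<ge> 0" "\<forall>x\<in>K. \<forall>v. \<bar>dsum 0 f v x\<bar> \<le> B * norm v ^ 0"
    using dsum_bound[OF 0 assms(2,3)] by blast
  then show ?case by (intro exI[of _ B]) (auto intro: graded_const)
next
  case (Suc i)
  from Suc.IH[of "pd 1 f"] Suc.prems obtain B1 where B1: "B1 \<ge> 0"
    "\<And>x h v. x \<in> K \<Longrightarrow> 0 < h \<Longrightarrow> graded h N A (\<lambda>\<xi>. v \<xi> $ 1) \<Longrightarrow> graded h N A (\<lambda>\<xi>. v \<xi> $ 2) \<Longrightarrow>
      graded h (i * N) B1 (\<lambda>\<xi>. dsum i (pd 1 f) (v \<xi>) x)" by auto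
  from Suc.IH[of "pd 2 f"] Suc.prems obtain B2 where B2: "B2 \<ge> 0"
    "\<And>x h v. x \<in> K \<Longrightarrow> 0 < h \<Longrightarrow> graded h N A (\<lambda>\<xi>. v \<xi> $ 1) \<Longrightarrow> graded h N A (\<lambda>\<xi>. v \<xi> $ 2) \<Longrightarrow>
      graded h (i * N) B2 (\<lambda>\<xi>. dsum i (pd 2 f) (v \<xi>) x)" by auto
  have "graded h (Suc i * N) (A * B1 + A * B2) (\<lambda>\<xi>. dsum (Suc i) f (v \<xi>) x)"
    if "x \<in> K" "0 < h" "graded h N A (\<lambda>\<xi>. v \<xi> $ 1)" "graded h N A (\<lambda>\<xi>. v \<xi> $ 2)" for x h v
    using graded.add[OF graded_mult[OF that(3) B1(2)[OF that] that(2)]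
        graded_mult[OF that(4) B2(2)[OF that] that(2)]] by simp
  then show ?case using B1(1) B2(1) assms(4)
    by (intro exI[of _ "A * B1 + A * B2"]) auto
qed

lemma taylor_graded:
  assumes "C_open m S f" "compact K" "K \<subseteq> S" "0 \<le> A"
  shows "\<exists>B\<ge>0. \<forall>x\<in>K. \<forall>h>0. \<forall>v. graded h N A (\<lambda>\<xi>. v \<xi> $ 1) \<longrightarrow> graded h N A (\<lambda>\<xi>. v \<xi> $ 2) \<longrightarrow>
    graded h (m * N) B (\<lambda>\<xi>. \<Sum>i<m. dsum i f (v \<xi>) x / fact i)"
proof -
  have "\<forall>i\<in>{..<m}. \<exists>B\<ge>0. \<forall>x\<in>K. \<forall>h>0. \<forall>v. graded h N A (\<lambda>\<xi>. v \<xi> $ 1) \<longrightarrow> graded h N A (\<lambda>\<xi>. v \<xi> $ 2) \<longrightarrow>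
    graded h (i * N) B (\<lambda>\<xi>. dsum i f (v \<xi>) x)"
    using dsum_graded[OF C_open_le[OF _ assms(1)] assms(2-)] by auto
  then obtain B where B: "\<And>i. i < m \<Longrightarrow> B i \<ge> 0"
    "\<And>i x h v. i < m \<Longrightarrow> x \<in> K \<Longrightarrow> 0 < h \<Longrightarrow> graded h N A (\<lambda>\<xi>. v \<xi> $ 1) \<Longrightarrow>
      graded h N A (\<lambda>\<xi>. v \<xi> $ 2) \<Longrightarrow> graded h (i * N) (B i) (\<lambda>\<xi>. dsum i f (v \<xi>) x)"
    unfolding bchoice_iff by blast
  have "graded h (m * N) (\<Sum>i<m. \<bar>1 / fact i\<bar> * B i) (\<lambda>\<xi>. \<Sum>i<m. 1 / fact i * dsum i f (v \<xi>) x)"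
    if "x \<in> K" "0 < h" "graded h N A (\<lambda>\<xi>. v \<xi> $ 1)" "graded h N A (\<lambda>\<xi>. v \<xi> $ 2)" for x h v
  proof (intro graded_sum)
    fix i assume "i \<in> {..<m}"
    then have i: "i < m" by simp
    show "graded h (m * N) (\<bar>1 / fact i\<bar> * B i) (\<lambda>\<xi>. 1 / fact i * dsum i f (v \<xi>) x)"
      by (rule graded_mono[OF graded_cmult[OF B(2)[OF i that] that(2)] that(2)]) (use i in auto)
  qed simp
  then show ?thesis
    using B(1) by (intro exI[of _ "\<Sum>i<m. \<bar>1 / fact i\<bar> * B i"]) (auto intro!: sum_nonneg)
qed

text \<open>The union of the closed balls is the Minkowski sum of \<open>K\<close> with a single
  ball, hence compact.\<close>

lemma compact_neighbourhood:
  fixes S :: "'a::euclidean_space set"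
  assumes "compact K" "open S" "K \<subseteq> S"
  obtains L \<delta> where "compact L" "L \<subseteq> S" "0 < \<delta>" "\<And>x. x \<in> K \<Longrightarrow> cball x \<delta> \<subseteq> L"
proof -
  obtain \<delta> where \<delta>: "0 < \<delta>" "(\<Union>x\<in>K. cball x \<delta>) \<subseteq> S"
    using compact_subset_open_imp_cball_epsilon_subset[OF assms] .
  have "(\<Union>x\<in>K. cball x \<delta>) = {x + y | x y. x \<in> K \<and> y \<in> cball 0 \<delta>}"
  proof (intro equalityI subsetI)
    fix z assume "z \<in> (\<Union>x\<in>K. cball x \<delta>)"
    then obtain x where "x \<in> K" "dist x z \<le> \<delta>" by auto
    then show "z \<in> {x + y | x y. x \<in> K \<and> y \<in> cball 0 \<delta>}"
      unfolding mem_Collect_eq by (intro exI[of _ x] exI[of _ "z - x"]) (auto simp: dist_norm norm_minus_commute)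
  next
    fix z assume "z \<in> {x + y | x y. x \<in> K \<and> y \<in> cball 0 \<delta>}"
    then obtain x y where "z = x + y" "x \<in> K" "norm y \<le> \<delta>" by auto
    then show "z \<in> (\<Union>x\<in>K. cball x \<delta>)" by (intro UN_I[of x]) (auto simp: dist_norm)
  qed
  then have "compact (\<Union>x\<in>K. cball x \<delta>)"
    using compact_sums[OF assms(1) compact_cball[of 0 \<delta>]] by simp
  then show ?thesis using \<delta>
    by (intro that[of "\<Union>x\<in>K. cball x \<delta>" \<delta>]) (auto intro!: bexI)
qed


section \<open>Energy estimate and conservation\<close>

lemma inner_transpose_mult: "x \<bullet> (transpose A *v y) = (A *v x) \<bullet> (y :: real^'m)"
  by (metis dot_lmul_matrix inner_commute transpose_matrix_vector)

lemma sum_matrix_vector_mult: "(\<Sum>i\<in>I. A i) *v x = (\<Sum>i\<in>I. A i *v (x :: real^'n))"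
  by (induction I rule: infinite_finite_induct) (auto simp: matrix_vector_mult_add_rdistrib)

lemma minus_matrix_vector_mult: "(- A) *v x = - (A *v (x :: real^'n))"
  by (simp add: vec_eq_iff matrix_vector_mult_def sum_negf)

lemma uminus_matrix_mult: "A *v (- x) = - (A *v (x :: real^'n))"
  by (simp add: vec_eq_iff matrix_vector_mult_def sum_negf)

lemma sum_matrix_mult: "A *v (\<Sum>i\<in>I. x i) = (\<Sum>i\<in>I. A *v (x i :: real^'n))"
  by (induction I rule: infinite_finite_induct) (auto simp: matrix_vector_right_distrib)

lemma diag_mult_nth [simp]: "(diag d *v x) $ i = d $ i * (x $ i :: real)"
proof -
  have "(diag d *v x) $ i = (\<Sum>j\<in>UNIV. if j = i then d $ i * x $ i else 0)"
    unfolding diag_def matrix_vector_mult_def vec_lambda_beta by (intro sum.cong) auto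
  then show ?thesis by simp
qed

lemma transpose_diag [simp]: "transpose (diag d) = diag d"
  by (simp add: diag_def transpose_def vec_eq_iff)

lemma diag_mult_diag: "diag d ** diag e = diag (\<chi> i. d $ i * (e $ i :: real))"
  by (simp add: matrix_eq vec_eq_iff flip: matrix_vector_mul_assoc)

text \<open>\<open>matrix_inv\<close> is a choice: the reciprocal diagonal shows that a two-sided
  inverse exists, so the chosen matrix is one, and inverses are unique.\<close>

lemma matrix_inv_diag:
  assumes "\<And>i. d $ i \<noteq> (0::real)"
  shows "matrix_inv (diag d) = diag (\<chi> i. 1 / d $ i)"
proof -
  let ?e = "diag (\<chi> i. 1 / d $ i)"
  have 1: "diag d ** ?e = mat 1" "?e ** diag d = mat 1"
    using assms unfolding diag_mult_diag by (auto simp: diag_def mat_def vec_eq_iff)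
  have "diag d ** matrix_inv (diag d) = mat 1 \<and> matrix_inv (diag d) ** diag d = mat 1"
    unfolding matrix_inv_def using 1 by (rule_tac someI_ex) blast
  then show ?thesis
    by (metis 1(2) matrix_mul_assoc matrix_mul_lid matrix_mul_rid)
qed

lemma inner_diag: "x \<bullet> (diag d *v y) = (diag d *v x) \<bullet> (y :: real^'n)"
  by (simp add: inner_vec_def mult_ac)

section \<open>A single mesh: facets, neighbours and sums over both sides\<close>

locale sbp_sat =
  fixes P :: diffusion_problem and p :: nat
    and E :: "('n::finite, 'f::finite) reference_element" and M :: "('n, 'f) disc"
  assumes P: "valid_problem P" and E: "valid_reference_element p E"
    and M: "discretization P p E M"
begin

lemma mesh: "conforming_mesh P p M"
  using M by (simp add: discretization_def)

lemma finite_elems: "finite (elems M)"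
  using mesh by (simp add: conforming_mesh_def)

lemma finite_facets: "finite (facets p M k)"
  by (simp add: facets_def)

lemma facets_I_subset: "facets_I p M k \<subseteq> facets p M k"
  by (auto simp: facets_I_def)

lemma facets_D_subset: "facets_D P p M k \<subseteq> facets p M k"
  by (auto simp: facets_D_def)

lemma facets_N_subset: "facets_N P p M k \<subseteq> facets p M k"
  by (auto simp: facets_N_def)

lemma finite_facets_sub:
  "finite (facets_I p M k)" "finite (facets_D P p M k)" "finite (facets_N P p M k)"
  using finite_facets facets_I_subset facets_D_subset facets_N_subset finite_subset by metis+

lemma is_neighbour_neighbour:
  assumes "k \<in> elems M" "\<gamma> \<in> facets_I p M k"
  shows "is_neighbour p M k \<gamma> (neighbour p M k \<gamma>)"
proof -
  have "\<exists>!v. is_neighbour p M k \<gamma> v"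
    using assms mesh unfolding conforming_mesh_def facets_I_def by blast
  then show ?thesis unfolding neighbour_def by (rule theI')
qed

lemma is_neighbour_unique:
  assumes "k \<in> elems M" "\<gamma> \<in> facets p M k" "is_neighbour p M k \<gamma> v"
  shows "neighbour p M k \<gamma> = v"
proof -
  have "\<exists>!v. is_neighbour p M k \<gamma> v"
    using assms mesh unfolding conforming_mesh_def by blast
  then show ?thesis using assms(3) unfolding neighbour_def by (rule the1_equality)
qed

text \<open>Crossing a facet is an involution: \<open>k\<close> is itself a neighbour of
  \<open>v\<close> across it, and \<open>conforming_mesh\<close> leaves no other. Every pairing of
  the two sides rests on this.\<close>

lemma neighbour_facts:
  assumes "k \<in> elems M" "\<gamma> \<in> facets_I p M k"
  defines "v \<equiv> neighbour p M k \<gamma>"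
  shows "v \<in> elems M" "v \<noteq> k" "\<gamma> \<in> facets_I p M v" "neighbour p M v \<gamma> = k"
proof -
  have n: "is_neighbour p M k \<gamma> v"
    using is_neighbour_neighbour assms by simp
  then show 1: "v \<in> elems M" "v \<noteq> k" by (auto simp: is_neighbour_def)
  have k: "is_neighbour p M v \<gamma> k"
    using n assms facets_I_subset by (auto simp: is_neighbour_def)
  show "\<gamma> \<in> facets_I p M v" using n k by (auto simp: facets_I_def is_neighbour_def)
  show "neighbour p M v \<gamma> = k"
    using is_neighbour_unique[OF 1(1) _ k] n by (auto simp: is_neighbour_def)
qed

lemma facets_split:
  assumes "k \<in> elems M"
  shows "facets p M k = facets_I p M k \<union> (facets_D P p M k \<union> facets_N P p M k)"
    "facets_I p M k \<inter> (facets_D P p M k \<union> facets_N P p M k) = {}"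
    "facets_D P p M k \<inter> facets_N P p M k = {}"
proof -
  have 1: "(\<exists>v. is_neighbour p M k \<gamma> v) \<or> (\<gamma> \<subseteq> GammaD P) \<noteq> (\<gamma> \<subseteq> GammaN P)"
    if "\<gamma> \<in> facets p M k" for \<gamma>
    using mesh assms that unfolding conforming_mesh_def by blast
  have 2: "(\<gamma> \<subseteq> GammaD P) \<noteq> (\<gamma> \<subseteq> GammaN P)"
    if "\<gamma> \<in> facets p M k - facets_I p M k" for \<gamma>
    using 1[of \<gamma>] that by (auto simp: facets_I_def)
  show "facets p M k = facets_I p M k \<union> (facets_D P p M k \<union> facets_N P p M k)"
    using 2 by (auto simp: facets_D_def facets_N_def facets_I_def)
  show "facets_I p M k \<inter> (facets_D P p M k \<union> facets_N P p M k) = {}"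
    by (auto simp: facets_D_def facets_N_def)
  show "facets_D P p M k \<inter> facets_N P p M k = {}"
    using 2 by (auto simp: facets_D_def facets_N_def)
qed

lemma sum_facets:
  fixes f :: "(real^2) set \<Rightarrow> 'a::comm_monoid_add"
  assumes "k \<in> elems M"
  shows "(\<Sum>\<gamma>\<in>facets p M k. f \<gamma>) = (\<Sum>\<gamma>\<in>facets_I p M k. f \<gamma>) +
    ((\<Sum>\<gamma>\<in>facets_D P p M k. f \<gamma>) + (\<Sum>\<gamma>\<in>facets_N P p M k. f \<gamma>))"
  using facets_split[OF assms] finite_facets_sub
  by (simp add: sum.union_disjoint)

text \<open>Exchanging sides is a permutation of the pairs formed by an element and one of its
  interior facets.\<close>

lemma sum_facets_I_swap:
  fixes F :: "nat \<Rightarrow> (real^2) set \<Rightarrow> nat \<Rightarrow> real"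
  shows "(\<Sum>k\<in>elems M. \<Sum>\<gamma>\<in>facets_I p M k. F k \<gamma> (neighbour p M k \<gamma>)) =
    (\<Sum>k\<in>elems M. \<Sum>\<gamma>\<in>facets_I p M k. F (neighbour p M k \<gamma>) \<gamma> k)"
proof -
  let ?S = "Sigma (elems M) (facets_I p M)"
  let ?g = "\<lambda>(k, \<gamma>). (neighbour p M k \<gamma>, \<gamma>)"
  have "(\<Sum>(k, \<gamma>)\<in>?S. F k \<gamma> (neighbour p M k \<gamma>)) =
        (\<Sum>(k, \<gamma>)\<in>?S. F (neighbour p M k \<gamma>) \<gamma> k)"
    by (rule sum.reindex_bij_witness[of _ ?g ?g]) (auto simp: neighbour_facts)
  then show ?thesis
    by (simp add: sum.Sigma finite_elems finite_facets_sub)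
qed

text \<open>Reduces a statement on the interior sum to one on a single facet seen from both sides;
  the 2 appears because each facet is met twice.\<close>

lemma sum_facets_I_symmetrize:
  fixes F :: "nat \<Rightarrow> (real^2) set \<Rightarrow> nat \<Rightarrow> real"
  shows "2 * (\<Sum>k\<in>elems M. \<Sum>\<gamma>\<in>facets_I p M k. F k \<gamma> (neighbour p M k \<gamma>)) =
    (\<Sum>k\<in>elems M. \<Sum>\<gamma>\<in>facets_I p M k.
       F k \<gamma> (neighbour p M k \<gamma>) + F (neighbour p M k \<gamma>) \<gamma> k)"
  using sum_facets_I_swap[of F] by (simp add: sum.distrib)

section \<open>Summation by parts and the diffusion form\<close>

lemma H_pos: "k \<in> elems M \<Longrightarrow> H_weights M k $ j > 0"
  using M by (simp add: discretization_def)

lemma matrix_inv_Hmat: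
  "k \<in> elems M \<Longrightarrow> matrix_inv (Hmat M k) = diag (\<chi> j. 1 / H_weights M k $ j)"
  unfolding Hmat_def using H_pos[of k] by (intro matrix_inv_diag) (metis less_irrefl)

lemma Hmat_inv_mult: "k \<in> elems M \<Longrightarrow> Hmat M k *v (matrix_inv (Hmat M k) *v x) = x"
  using H_pos[of k] unfolding matrix_inv_Hmat
  by (simp add: Hmat_def vec_eq_iff less_imp_neq[symmetric])

lemma inner_Hmat: "x \<bullet> (Hmat M k *v y) = (Hmat M k *v x) \<bullet> y"
  by (simp add: Hmat_def inner_diag)

lemma inner_Bmat: "x \<bullet> (Bmat E M \<gamma> *v y) = (Bmat E M \<gamma> *v x) \<bullet> y"
  by (simp add: Bmat_def inner_diag)

lemma transpose_Nmat [simp]: "transpose (Nmat M a \<gamma> k) = Nmat M a \<gamma> k"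
  by (simp add: Nmat_def)

text \<open>Discrete integration by parts: the SBP identity read as a bilinear form.\<close>

lemma sbp_inner:
  assumes k: "k \<in> elems M"
  shows "x \<bullet> (Hmat M k *v (Dmat M a k *v y)) = - ((Dmat M a k *v x) \<bullet> (Hmat M k *v y)) +
    (\<Sum>\<gamma>\<in>facets p M k. (Rmat M \<gamma> k *v x) \<bullet> (Bmat E M \<gamma> *v (Nmat M a \<gamma> k *v (Rmat M \<gamma> k *v y))))"
proof -
  have "Hmat M k ** Dmat M a k + transpose (Hmat M k ** Dmat M a k) =
     (\<Sum>\<gamma>\<in>facets p M k. transpose (Rmat M \<gamma> k) ** Bmat E M \<gamma> ** Nmat M a \<gamma> k ** Rmat M \<gamma> k)"
    using M k by (simp add: discretization_def)
  then have "x \<bullet> ((Hmat M k ** Dmat M a k + transpose (Hmat M k ** Dmat M a k)) *v y) =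
     x \<bullet> ((\<Sum>\<gamma>\<in>facets p M k. transpose (Rmat M \<gamma> k) ** Bmat E M \<gamma> ** Nmat M a \<gamma> k ** Rmat M \<gamma> k) *v y)"
    by simp
  then show ?thesis
    by (simp add: matrix_vector_mult_add_rdistrib sum_matrix_vector_mult inner_add_right
        inner_sum_right inner_transpose_mult inner_Hmat del: transpose_matrix_vector
        flip: matrix_vector_mul_assoc)
qed

text \<open>Quadrature over the element of w . (lam z). The arguments are arbitrary fields and not
  only discrete gradients, because the energy estimate evaluates it at a gradient plus a lifted
  facet term.\<close>

definition diff_form :: "nat \<Rightarrow> (2 \<Rightarrow> real^'n) \<Rightarrow> (2 \<Rightarrow> real^'n) \<Rightarrow> real" where
  "diff_form k w z = (\<Sum>a\<in>UNIV. \<Sum>b\<in>UNIV. w a \<bullet> (Hmat M k *v (Lmat P p E M a b k *v z b)))"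

lemma Dgam_mult: "Dgam P p E M \<gamma> k *v u = (\<Sum>a\<in>UNIV. \<Sum>b\<in>UNIV.
    Nmat M a \<gamma> k *v (Rmat M \<gamma> k *v (Lmat P p E M a b k *v (Dmat M b k *v u))))"
  by (simp add: Dgam_def sum_matrix_vector_mult flip: matrix_vector_mul_assoc)

text \<open>Discrete Green identity; it is used with \<open>u\<close> as test vector for the energy
  and with 1 for conservation.\<close>

lemma D2_inner:
  assumes k: "k \<in> elems M"
  shows "x \<bullet> (Hmat M k *v (D2 P p E M k *v u)) =
    - diff_form k (\<lambda>a. Dmat M a k *v x) (\<lambda>a. Dmat M a k *v u) +
    (\<Sum>\<gamma>\<in>facets p M k. (Rmat M \<gamma> k *v x) \<bullet> (Bmat E M \<gamma> *v (Dgam P p E M \<gamma> k *v u)))"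
proof -
  have "x \<bullet> (Hmat M k *v (D2 P p E M k *v u)) = (\<Sum>a\<in>UNIV. \<Sum>b\<in>UNIV.
     x \<bullet> (Hmat M k *v (Dmat M a k *v (Lmat P p E M a b k *v (Dmat M b k *v u)))))"
    by (simp add: D2_def sum_matrix_vector_mult sum_matrix_mult inner_sum_right
        flip: matrix_vector_mul_assoc)
  also have "\<dots> = - diff_form k (\<lambda>a. Dmat M a k *v x) (\<lambda>a. Dmat M a k *v u) +
    (\<Sum>a\<in>UNIV. \<Sum>b\<in>UNIV. \<Sum>\<gamma>\<in>facets p M k. (Rmat M \<gamma> k *v x) \<bullet> (Bmat E M \<gamma> *v
      (Nmat M a \<gamma> k *v (Rmat M \<gamma> k *v (Lmat P p E M a b k *v (Dmat M b k *v u))))))"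
    by (simp add: sbp_inner[OF k] diff_form_def sum.distrib sum_negf sum_subtractf)
  also have "(\<Sum>a\<in>UNIV. \<Sum>b\<in>UNIV. \<Sum>\<gamma>\<in>facets p M k. (Rmat M \<gamma> k *v x) \<bullet> (Bmat E M \<gamma> *v
      (Nmat M a \<gamma> k *v (Rmat M \<gamma> k *v (Lmat P p E M a b k *v (Dmat M b k *v u)))))) =
    (\<Sum>\<gamma>\<in>facets p M k. (Rmat M \<gamma> k *v x) \<bullet> (Bmat E M \<gamma> *v (Dgam P p E M \<gamma> k *v u)))"
    unfolding Dgam_mult sum_matrix_mult inner_sum_right sum_2
      matrix_vector_right_distrib inner_add_right by (simp add: sum.distrib)
  finally show ?thesis .
qed

lemma vol_node_in: "k \<in> elems M \<Longrightarrow> vol_node p E M k j \<in> elem p M k"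
  using E by (auto simp: valid_reference_element_def vol_node_def elem_def)

lemma elem_subset: "k \<in> elems M \<Longrightarrow> elem p M k \<subseteq> Omega P"
  using mesh by (auto simp: conforming_mesh_def)

lemma SPD_vol_node: "k \<in> elems M \<Longrightarrow> SPD (lam P (vol_node p E M k j))"
  using P vol_node_in elem_subset unfolding valid_problem_def by blast

lemma lam_symmetric:
  assumes "k \<in> elems M"
  shows "lam P (vol_node p E M k j) $ a $ b = lam P (vol_node p E M k j) $ b $ a"
proof -
  have "transpose (lam P (vol_node p E M k j)) = lam P (vol_node p E M k j)"
    using SPD_vol_node[OF assms] by (simp add: SPD_def)
  then show ?thesis unfolding transpose_def by (metis (mono_tags, lifting) vec_lambda_beta)
qed

text \<open>Since H and the blocks of Lambda are diagonal, the form decouples into weighted 2 x 2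
  forms at the nodes. Positivity and symmetry are then inherited from \<open>SPD\<close> of
  \<open>lam\<close>.\<close>

lemma diff_form_eq:
  "diff_form k w z = (\<Sum>j\<in>UNIV. H_weights M k $ j *
     ((\<chi> a. w a $ j) \<bullet> (lam P (vol_node p E M k j) *v (\<chi> a. z a $ j))))"
proof -
  have "(\<chi> a. w a $ j) \<bullet> (lam P (vol_node p E M k j) *v (\<chi> a. z a $ j)) =
    (\<Sum>a\<in>UNIV. \<Sum>b\<in>UNIV. w a $ j * (lam P (vol_node p E M k j) $ a $ b * z b $ j))" for j
    by (simp add: inner_vec_def matrix_vector_mult_def sum_distrib_left)
  then show ?thesis
    by (simp add: diff_form_def Hmat_def Lmat_def inner_vec_def sum_2
        algebra_simps sum.distrib sum_distrib_left)
qed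

lemma diff_form_nonneg:
  assumes "k \<in> elems M"
  shows "0 \<le> diff_form k w w"
proof -
  have "0 \<le> x \<bullet> (lam P (vol_node p E M k j) *v x)" for j x
    using SPD_vol_node[OF assms, of j] unfolding SPD_def by (cases "x = 0") (auto simp: less_imp_le)
  then show ?thesis
    unfolding diff_form_eq using H_pos[OF assms] by (intro sum_nonneg mult_nonneg_nonneg) (auto simp: less_imp_le)
qed

lemma diff_form_commute:
  assumes "k \<in> elems M"
  shows "diff_form k w z = diff_form k z w"
proof -
  have "x \<bullet> (lam P (vol_node p E M k j) *v y) = y \<bullet> (lam P (vol_node p E M k j) *v x)" for x y j
    using lam_symmetric[OF assms, of j 1 2]
    by (simp add: inner_vec_def matrix_vector_mult_def sum_2 algebra_simps)
  then show ?thesis unfolding diff_form_eq by metis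
qed

lemma diff_form_add:
  "diff_form k (\<lambda>a. w a + c *\<^sub>R z a) (\<lambda>a. w a + c *\<^sub>R z a) =
   diff_form k w w + c * diff_form k w z + c * diff_form k z w + c\<^sup>2 * diff_form k z z"
  by (simp add: diff_form_def sum_2 matrix_vector_right_distrib matrix_vector_mult_scaleR
      inner_add_left inner_add_right algebra_simps power2_eq_square)

text \<open>Nonnegativity of the diffusion form at \<open>\<nabla>\<^sub>h u + \<alpha>\<^sup>-\<^sup>1 H\<^sup>-\<^sup>1 R\<^sup>T N z\<close>.\<close>

lemma facet_energy:
  assumes k: "k \<in> elems M" and \<alpha>: "\<alpha> > 0"
  shows "0 \<le> \<alpha> * diff_form k (\<lambda>a. Dmat M a k *v u) (\<lambda>a. Dmat M a k *v u)
    + 2 * (z \<bullet> (Dgam P p E M \<gamma> k *v u)) + 1 / \<alpha> * (z \<bullet> (Ups P p E M \<gamma> k *v z))"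
proof -
  define w where "w = (\<lambda>a. Dmat M a k *v u)"
  \<comment> \<open>\<open>g\<close> is a discrete lifting of \<open>z\<close>: its factor H^(-1)
    cancels the norm matrix, so pairing with \<open>g\<close> tests \<open>z\<close> against normal
    traces, which produces \<open>Dgam\<close> in the mixed form and \<open>Ups\<close> in the pure
    one.\<close>
  define g where "g = (\<lambda>a. matrix_inv (Hmat M k) *v (transpose (Rmat M \<gamma> k) *v (Nmat M a \<gamma> k *v z)))"
  have Nm: "x \<bullet> (Nmat M a \<gamma> k *v y) = (Nmat M a \<gamma> k *v x) \<bullet> y" for x y a
    by (simp add: Nmat_def inner_diag)
  have gw: "g a \<bullet> (Hmat M k *v y) = z \<bullet> (Nmat M a \<gamma> k *v (Rmat M \<gamma> k *v y))" for a y
    by (simp add: inner_Hmat g_def Hmat_inv_mult[OF k] Nm dot_lmul_matrix)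
  \<comment> \<open>Diagonal matrices commute, which moves H^(-1) to the place it has in
    \<open>Ups\<close>.\<close>
  have comm: "Lmat P p E M a b k *v (matrix_inv (Hmat M k) *v y) =
      matrix_inv (Hmat M k) *v (Lmat P p E M a b k *v y)" for a b y
    by (simp add: Lmat_def matrix_inv_Hmat[OF k] vec_eq_iff)
  have 1: "diff_form k g w = z \<bullet> (Dgam P p E M \<gamma> k *v u)"
    by (simp add: diff_form_def gw Dgam_mult inner_sum_right w_def)
  have 2: "diff_form k g g = z \<bullet> (Ups P p E M \<gamma> k *v z)"
    unfolding diff_form_def gw
    by (simp add: Ups_def sum_matrix_vector_mult inner_sum_right g_def comm
        flip: matrix_vector_mul_assoc)
  have "0 \<le> diff_form k (\<lambda>a. w a + (1/\<alpha>) *\<^sub>R g a) (\<lambda>a. w a + (1/\<alpha>) *\<^sub>R g a)"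
    by (rule diff_form_nonneg[OF k])
  also have "\<dots> = diff_form k w w + 2 * (1/\<alpha>) * diff_form k g w + (1/\<alpha>)\<^sup>2 * diff_form k g g"
    unfolding diff_form_add diff_form_commute[OF k, of w g] by simp
  \<comment> \<open>Scaling by \<alpha> turns the coefficients 1, 2/\<alpha>, 1/\<alpha>^2 into
    \<alpha>, 2, 1/\<alpha>: the share of the facet in the volume energy, the flux term, and the
    penalty.\<close>
  finally have "0 \<le> \<alpha> * (diff_form k w w + 2 * (1/\<alpha>) * diff_form k g w + (1/\<alpha>)\<^sup>2 * diff_form k g g)"
    using \<alpha> by simp
  also have "\<dots> = \<alpha> * diff_form k w w + 2 * diff_form k g w + 1/\<alpha> * diff_form k g g"
    using \<alpha> by (simp add: field_simps power2_eq_square)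
  finally show ?thesis unfolding 1 2 by (simp add: w_def)
qed

section \<open>Action on constants and conservation\<close>

lemma one_vec_nth [simp]: "(1 :: real^'a) $ i = 1"
  by (simp add: one_vec_def)

lemma Dmat_one: "k \<in> elems M \<Longrightarrow> Dmat M a k *v 1 = 0"
  using M by (simp add: discretization_def)

lemma Rmat_exact:
  assumes "k \<in> elems M" "\<gamma> \<in> facets p M k" "poly2 p q"
  shows "Rmat M \<gamma> k *v (\<chi> j. q (vol_nodes E $ j)) =
    (\<chi> m. q (inv_into ref_triangle (elem_map p M k) (facet_node E M \<gamma> m)))"
  using M assms by (simp add: discretization_def)

lemma Rmat_one:
  assumes "k \<in> elems M" "\<gamma> \<in> facets p M k"
  shows "Rmat M \<gamma> k *v 1 = 1"
  using Rmat_exact[OF assms poly2_const[of p 1]] by (simp add: one_vec_def)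

lemma Dgam_one: "k \<in> elems M \<Longrightarrow> Dgam P p E M \<gamma> k *v 1 = 0"
  by (simp add: Dgam_mult Dmat_one)

text \<open>Interface terms of element \<open>k\<close> on \<open>\<gamma>\<close>, before lifting by \<open>R\<^sup>T\<close> and \<open>D\<^sup>T\<close>.\<close>

definition half_sat where
  "half_sat u k \<gamma> v =
     (let a = Rmat M \<gamma> k *v u k - Rmat M \<gamma> v *v u v;
          d = Dgam P p E M \<gamma> k *v u k + Dgam P p E M \<gamma> v *v u v
      in (T1 (cdg_sat P p E M) \<gamma> k *v a + T3 (cdg_sat P p E M) \<gamma> k *v d,
          T2 (cdg_sat P p E M) \<gamma> k *v a))"

lemma inner_s_I:
  "x \<bullet> s_I P p E M (cdg_sat P p E M) u k = (\<Sum>\<gamma>\<in>facets_I p M k.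
     (Rmat M \<gamma> k *v x) \<bullet> fst (half_sat u k \<gamma> (neighbour p M k \<gamma>)) +
     (Dgam P p E M \<gamma> k *v x) \<bullet> snd (half_sat u k \<gamma> (neighbour p M k \<gamma>)))"
proof -
  have [simp]: "T4 (cdg_sat P p E M) \<gamma> k = 0" for \<gamma> k by (simp add: cdg_sat_def)
  show ?thesis
    by (simp add: s_I_def half_sat_def Let_def inner_sum_right inner_add_right
      inner_transpose_mult del: transpose_matrix_vector)
qed

lemma T1_symmetric:
  assumes "k \<in> elems M" "\<gamma> \<in> facets_I p M k"
  shows "T1 (cdg_sat P p E M) \<gamma> (neighbour p M k \<gamma>) = T1 (cdg_sat P p E M) \<gamma> k"
  using neighbour_facts[OF assms] by (simp add: cdg_sat_def Let_def add.commute)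

text \<open>The switch parts are antisymmetric in the two sides. With the symmetry of
  \<open>T1\<close> this is all that conservation requires: testing with 1 annihilates
  \<open>Dgam\<close>, so the terms lifted by its transpose are invisible.\<close>

lemma T3_sum:
  assumes "k \<in> elems M" "\<gamma> \<in> facets_I p M k"
  shows "T3 (cdg_sat P p E M) \<gamma> k + T3 (cdg_sat P p E M) \<gamma> (neighbour p M k \<gamma>) = Bmat E M \<gamma>"
  using neighbour_facts[OF assms]
  by (simp add: cdg_sat_def Let_def flip: scaleR_add_left add_divide_distrib)

lemma inner_H_rhs:
  assumes k: "k \<in> elems M"
  shows "x \<bullet> (Hmat M k *v semidiscrete_rhs P p E M S (\<lambda>_. 0) uB wB u k) =
    x \<bullet> (Hmat M k *v (D2 P p E M k *v u k)) - x \<bullet> s_I P p E M S u k - x \<bullet> s_B P p E M S u uB wB k"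
  by (simp add: semidiscrete_rhs_def matrix_vector_mult_diff_distrib inner_diff_right
      Hmat_inv_mult[OF k])

lemma conservation:
  "(\<Sum>k\<in>elems M. 1 \<bullet> (Hmat M k *v
       semidiscrete_rhs P p E M (cdg_sat P p E M) (\<lambda>_. 0) uB wB u k)) =
   (\<Sum>k\<in>elems M. (\<Sum>\<gamma>\<in>facets_D P p M k \<union> facets_N P p M k.
       1 \<bullet> (transpose (Rmat M \<gamma> k) *v (Bmat E M \<gamma> *v (Dgam P p E M \<gamma> k *v u k))))
      - 1 \<bullet> s_B P p E M (cdg_sat P p E M) u uB wB k)"
proof -
  let ?S = "cdg_sat P p E M"
  define F where "F k \<gamma> v = 1 \<bullet> (Bmat E M \<gamma> *v (Dgam P p E M \<gamma> k *v u k)) -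
    1 \<bullet> fst (half_sat u k \<gamma> v)" for k \<gamma> v
  have H1: "1 \<bullet> (Hmat M k *v (D2 P p E M k *v u k)) =
     (\<Sum>\<gamma>\<in>facets p M k. 1 \<bullet> (Bmat E M \<gamma> *v (Dgam P p E M \<gamma> k *v u k)))"
    if k: "k \<in> elems M" for k
    unfolding D2_inner[OF k]
    by (simp add: Dmat_one[OF k] diff_form_def Rmat_one[OF k] cong: sum.cong)
  have I1: "1 \<bullet> s_I P p E M ?S u k = (\<Sum>\<gamma>\<in>facets_I p M k. 1 \<bullet> fst (half_sat u k \<gamma> (neighbour p M k \<gamma>)))"
    if k: "k \<in> elems M" for k
    unfolding inner_s_I
    by (rule sum.cong) (auto simp: Rmat_one[OF k subsetD[OF facets_I_subset]] Dgam_one[OF k])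
  have pair: "F k \<gamma> (neighbour p M k \<gamma>) + F (neighbour p M k \<gamma>) \<gamma> k = 0"
    if k: "k \<in> elems M" and g: "\<gamma> \<in> facets_I p M k" for k \<gamma>
  proof -
    define v where "v = neighbour p M k \<gamma>"
    define a where "a = Rmat M \<gamma> k *v u k - Rmat M \<gamma> v *v u v"
    define d where "d = Dgam P p E M \<gamma> k *v u k + Dgam P p E M \<gamma> v *v u v"
    have a': "Rmat M \<gamma> v *v u v - Rmat M \<gamma> k *v u k = - a"
      by (simp add: a_def)
    have d': "Dgam P p E M \<gamma> v *v u v + Dgam P p E M \<gamma> k *v u k = d"
      by (simp add: d_def)
    \<comment> \<open>The jump of \<open>u\<close> changes sign between the sides and cancels
      through the symmetric \<open>T1\<close>; \<open>d\<close> is common to both, so the two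
      \<open>T3\<close> add up to B and reproduce the volume fluxes of both elements.\<close>
    have "fst (half_sat u k \<gamma> v) + fst (half_sat u v \<gamma> k) = Bmat E M \<gamma> *v d"
      using T3_sum[OF k g] T1_symmetric[OF k g]
      by (simp add: half_sat_def Let_def a' d' uminus_matrix_mult flip: v_def a_def d_def
          matrix_vector_mult_add_rdistrib)
    then have "1 \<bullet> fst (half_sat u k \<gamma> v) + 1 \<bullet> fst (half_sat u v \<gamma> k) = 1 \<bullet> (Bmat E M \<gamma> *v d)"
      by (metis inner_add_right)
    then show ?thesis
      by (simp add: F_def d_def matrix_vector_right_distrib inner_add_right flip: v_def)
  qed
  have "2 * (\<Sum>k\<in>elems M. \<Sum>\<gamma>\<in>facets_I p M k. F k \<gamma> (neighbour p M k \<gamma>)) = 0"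
    unfolding sum_facets_I_symmetrize using pair by simp
  then have F0: "(\<Sum>k\<in>elems M. \<Sum>\<gamma>\<in>facets_I p M k. F k \<gamma> (neighbour p M k \<gamma>)) = 0"
    by simp
  have "1 \<bullet> (Hmat M k *v semidiscrete_rhs P p E M ?S (\<lambda>_. 0) uB wB u k) =
      (\<Sum>\<gamma>\<in>facets_I p M k. F k \<gamma> (neighbour p M k \<gamma>)) +
      ((\<Sum>\<gamma>\<in>facets_D P p M k \<union> facets_N P p M k.
       1 \<bullet> (transpose (Rmat M \<gamma> k) *v (Bmat E M \<gamma> *v (Dgam P p E M \<gamma> k *v u k))))
      - 1 \<bullet> s_B P p E M ?S u uB wB k)" if k: "k \<in> elems M" for k
  proof -
    have B: "(\<Sum>\<gamma>\<in>facets_D P p M k \<union> facets_N P p M k.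
       1 \<bullet> (transpose (Rmat M \<gamma> k) *v (Bmat E M \<gamma> *v (Dgam P p E M \<gamma> k *v u k)))) =
       (\<Sum>\<gamma>\<in>facets_D P p M k. 1 \<bullet> (Bmat E M \<gamma> *v (Dgam P p E M \<gamma> k *v u k))) +
       (\<Sum>\<gamma>\<in>facets_N P p M k. 1 \<bullet> (Bmat E M \<gamma> *v (Dgam P p E M \<gamma> k *v u k)))"
    proof -
      have "(\<Sum>\<gamma>\<in>facets_D P p M k \<union> facets_N P p M k.
         1 \<bullet> (transpose (Rmat M \<gamma> k) *v (Bmat E M \<gamma> *v (Dgam P p E M \<gamma> k *v u k)))) =
       (\<Sum>\<gamma>\<in>facets_D P p M k \<union> facets_N P p M k. 1 \<bullet> (Bmat E M \<gamma> *v (Dgam P p E M \<gamma> k *v u k)))"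
        unfolding inner_transpose_mult
        by (rule sum.cong)
          (auto simp: Rmat_one[OF k subsetD[OF facets_D_subset]] Rmat_one[OF k subsetD[OF facets_N_subset]])
      then show ?thesis
        using facets_split[OF k] finite_facets_sub by (simp add: sum.union_disjoint)
    qed
    show ?thesis
      unfolding inner_H_rhs[OF k] H1[OF k] sum_facets[OF k] I1[OF k] B F_def
      by (simp add: sum_subtractf)
  qed
  then show ?thesis
    by (simp add: sum.distrib F0)
qed

text \<open>With this switch \<open>T2\<close> lives only on \<open>k\<close>, \<open>T3\<close>
  only on \<open>v\<close>, and \<open>T1\<close> contains only \<open>Ups\<close> of
  \<open>k\<close>. The volume flux of \<open>v\<close> cancels, so the completed square lies
  entirely in \<open>k\<close>, and the energy share of \<open>v\<close> is discarded as
  nonnegative.\<close>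

lemma interior_facet_energy:
  fixes u :: "nat \<Rightarrow> real^'n"
  assumes k: "k \<in> elems M" and g: "\<gamma> \<in> facets_I p M k" and \<beta>: "beta M \<gamma> k = 1"
  defines "v \<equiv> neighbour p M k \<gamma>"
  defines "q \<equiv> \<lambda>k. diff_form k (\<lambda>a. Dmat M a k *v u k) (\<lambda>a. Dmat M a k *v u k)"
  defines "F \<equiv> \<lambda>k v. (Rmat M \<gamma> k *v u k) \<bullet> (Bmat E M \<gamma> *v (Dgam P p E M \<gamma> k *v u k))
    - alpha M \<gamma> k * q k
    - (Rmat M \<gamma> k *v u k) \<bullet> fst (half_sat u k \<gamma> v) - (Dgam P p E M \<gamma> k *v u k) \<bullet> snd (half_sat u k \<gamma> v)"
  shows "F k v + F v k \<le> 0"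
proof -
  define r where "r = (\<lambda>k. Rmat M \<gamma> k *v u k)"
  define d where "d = (\<lambda>k. Dgam P p E M \<gamma> k *v u k)"
  define a where "a = r k - r v"
  let ?B = "Bmat E M \<gamma>"
  note nf = neighbour_facts[OF k g, folded v_def]
  have \<beta>v: "beta M \<gamma> v = 0"
    using M k g \<beta> unfolding discretization_def v_def by force
  have \<alpha>: "alpha M \<gamma> k > 0" "alpha M \<gamma> v > 0"
    using M k g nf facets_I_subset unfolding discretization_def by blast+
  have T: "T1 (cdg_sat P p E M) \<gamma> k = (1 / alpha M \<gamma> k) *\<^sub>R (?B ** Ups P p E M \<gamma> k ** ?B)"
    "T1 (cdg_sat P p E M) \<gamma> v = T1 (cdg_sat P p E M) \<gamma> k"
    "T2 (cdg_sat P p E M) \<gamma> k = - ?B" "T2 (cdg_sat P p E M) \<gamma> v = 0"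
    "T3 (cdg_sat P p E M) \<gamma> k = 0" "T3 (cdg_sat P p E M) \<gamma> v = ?B"
    using nf(4) by (simp_all add: cdg_sat_def Let_def \<beta> \<beta>v T1_symmetric[OF k g, folded v_def]
        scalar_matrix_assoc matrix_scalar_ac flip: v_def)
  have rv: "r v - r k = - a" by (simp add: a_def)
  have "(r k) \<bullet> fst (half_sat u k \<gamma> v) + (r v) \<bullet> fst (half_sat u v \<gamma> k) +
      (d k) \<bullet> snd (half_sat u k \<gamma> v) + (d v) \<bullet> snd (half_sat u v \<gamma> k) =
      a \<bullet> (T1 (cdg_sat P p E M) \<gamma> k *v a) + r v \<bullet> (?B *v (d k + d v)) - d k \<bullet> (?B *v a)"
    unfolding half_sat_def Let_def fst_conv snd_conv r_def[symmetric, THEN fun_cong]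
      d_def[symmetric, THEN fun_cong] a_def[symmetric] rv T(2-)
    by (simp add: minus_matrix_vector_mult uminus_matrix_mult a_def matrix_vector_mult_diff_distrib
        matrix_vector_right_distrib inner_add_right inner_diff_right inner_diff_left)
  moreover have "a \<bullet> (T1 (cdg_sat P p E M) \<gamma> k *v a) =
      1 / alpha M \<gamma> k * ((- (?B *v a)) \<bullet> (Ups P p E M \<gamma> k *v (- (?B *v a))))"
    unfolding T(1) by (simp add: uminus_matrix_mult inner_Bmat flip: scaleR_matrix_vector_assoc matrix_vector_mul_assoc)
  \<comment> \<open>For the facet datum \<open>- (?B *v a)\<close> the cross term is what the fluxes
    leave over, and the quadratic term is exactly the \<open>T1\<close> penalty of the preceding
    step.\<close>
  moreover have "0 \<le> alpha M \<gamma> k * q k + 2 * ((- (?B *v a)) \<bullet> d k) +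
      1 / alpha M \<gamma> k * ((- (?B *v a)) \<bullet> (Ups P p E M \<gamma> k *v (- (?B *v a))))"
    unfolding q_def d_def by (rule facet_energy[OF k \<alpha>(1)])
  moreover have "0 \<le> alpha M \<gamma> v * q v"
    unfolding q_def using diff_form_nonneg[OF nf(1)] \<alpha>(2) by (simp add: less_imp_le)
  moreover have "d k \<bullet> (?B *v a) = (?B *v a) \<bullet> d k" by (rule inner_commute)
  moreover have "r v \<bullet> (?B *v (d k + d v)) - d k \<bullet> (?B *v a) =
      r k \<bullet> (?B *v d k) + r v \<bullet> (?B *v d v) + 2 * ((- (?B *v a)) \<bullet> d k)"
    by (simp add: a_def inner_Bmat inner_commute[of "d k"] matrix_vector_mult_diff_distrib inner_diff_left
        inner_add_right)
  ultimately show ?thesis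
    unfolding F_def by (simp flip: r_def[THEN fun_cong] d_def[THEN fun_cong])
qed

lemma energy_rate:
  fixes u :: "nat \<Rightarrow> real^'n"
  shows "(\<Sum>k\<in>elems M. u k \<bullet> (Hmat M k *v
    semidiscrete_rhs P p E M (cdg_sat P p E M) (\<lambda>_. 0) (\<lambda>_ _. 0) (\<lambda>_ _. 0) u k)) \<le> 0"
proof -
  let ?S = "cdg_sat P p E M"
  define q where "q k = diff_form k (\<lambda>a. Dmat M a k *v u k) (\<lambda>a. Dmat M a k *v u k)" for k
  define r where "r \<gamma> k = Rmat M \<gamma> k *v u k" for \<gamma> k
  define d where "d \<gamma> k = Dgam P p E M \<gamma> k *v u k" for \<gamma> k
  define F where "F k \<gamma> v = r \<gamma> k \<bullet> (Bmat E M \<gamma> *v d \<gamma> k) - alpha M \<gamma> k * q k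
    - r \<gamma> k \<bullet> fst (half_sat u k \<gamma> v) - d \<gamma> k \<bullet> snd (half_sat u k \<gamma> v)" for k \<gamma> v
  define FD where "FD k \<gamma> = r \<gamma> k \<bullet> (Bmat E M \<gamma> *v d \<gamma> k) - alpha M \<gamma> k * q k
    - (r \<gamma> k \<bullet> (TD ?S \<gamma> k *v r \<gamma> k) - d \<gamma> k \<bullet> (Bmat E M \<gamma> *v r \<gamma> k))" for k \<gamma>
  \<comment> \<open>The homogeneous Neumann term cancels the volume flux exactly, so only
    dissipation is left.\<close>
  define FN where "FN k \<gamma> = - alpha M \<gamma> k * q k" for k \<gamma>
  have \<alpha>: "alpha M \<gamma> k > 0" if "k \<in> elems M" "\<gamma> \<in> facets p M k" for k \<gamma>
    using that M by (simp add: discretization_def)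
  have split: "u k \<bullet> (Hmat M k *v semidiscrete_rhs P p E M ?S (\<lambda>_. 0) (\<lambda>_ _. 0) (\<lambda>_ _. 0) u k) =
    (\<Sum>\<gamma>\<in>facets_I p M k. F k \<gamma> (neighbour p M k \<gamma>)) +
    ((\<Sum>\<gamma>\<in>facets_D P p M k. FD k \<gamma>) + (\<Sum>\<gamma>\<in>facets_N P p M k. FN k \<gamma>))"
    if k: "k \<in> elems M" for k
  proof -
    have "(\<Sum>\<gamma>\<in>facets p M k. alpha M \<gamma> k) = 1"
      using M k by (simp add: discretization_def)
    then have q: "q k = (\<Sum>\<gamma>\<in>facets p M k. alpha M \<gamma> k * q k)"
      by (simp flip: sum_distrib_right)
    have "u k \<bullet> (Hmat M k *v (D2 P p E M k *v u k)) =
      (\<Sum>\<gamma>\<in>facets p M k. r \<gamma> k \<bullet> (Bmat E M \<gamma> *v d \<gamma> k) - alpha M \<gamma> k * q k)"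
      unfolding D2_inner[OF k] sum_subtractf q[symmetric] by (simp add: q_def r_def d_def)
    moreover have "u k \<bullet> s_B P p E M ?S u (\<lambda>_ _. 0) (\<lambda>_ _. 0) k =
      (\<Sum>\<gamma>\<in>facets_D P p M k. r \<gamma> k \<bullet> (TD ?S \<gamma> k *v r \<gamma> k) - d \<gamma> k \<bullet> (Bmat E M \<gamma> *v r \<gamma> k)) +
      (\<Sum>\<gamma>\<in>facets_N P p M k. r \<gamma> k \<bullet> (Bmat E M \<gamma> *v d \<gamma> k))"
      unfolding s_B_def Let_def inner_add_right inner_sum_right inner_transpose_mult
      by (simp add: r_def d_def minus_matrix_vector_mult)
    ultimately show ?thesis
      unfolding inner_H_rhs[OF k] sum_facets[OF k] inner_s_I F_def FD_def FN_def
      by (simp add: sum_subtractf sum.distrib sum_negf algebra_simps r_def d_def)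
  qed
  have "F k \<gamma> (neighbour p M k \<gamma>) + F (neighbour p M k \<gamma>) \<gamma> k \<le> 0"
    if k: "k \<in> elems M" and g: "\<gamma> \<in> facets_I p M k" for k \<gamma>
  proof -
    define v where "v = neighbour p M k \<gamma>"
    note nf = neighbour_facts[OF k g, folded v_def]
    \<comment> \<open>The switches are 0 or 1 with sum 1, so one of the two elements has the switch
      1; if it is \<open>v\<close>, the facet estimate is applied from the other side.\<close>
    consider "beta M \<gamma> k = 1" | "beta M \<gamma> v = 1"
      using M k g unfolding discretization_def v_def by force
    then have "F k \<gamma> v + F v \<gamma> k \<le> 0"
    proof cases
      case 1
      show ?thesis
        using interior_facet_energy[OF k g 1, of u] by (simp add: F_def q_def r_def d_def v_def)
    next
      case 2
      show ?thesis
        using interior_facet_energy[OF nf(1,3) 2, of u] nf(4) by (simp add: F_def q_def r_def d_def)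
    qed
    then show ?thesis by (simp add: v_def)
  qed
  then have "2 * (\<Sum>k\<in>elems M. \<Sum>\<gamma>\<in>facets_I p M k. F k \<gamma> (neighbour p M k \<gamma>)) \<le> 0"
    unfolding sum_facets_I_symmetrize by (intro sum_nonpos)
  moreover have "FD k \<gamma> \<le> 0" if k: "k \<in> elems M" and g: "\<gamma> \<in> facets_D P p M k" for k \<gamma>
  proof -
    \<comment> \<open>The same square as on an interior facet, with the exterior value replaced by
      the zero Dirichlet datum.\<close>
    let ?z = "- (Bmat E M \<gamma> *v r \<gamma> k)"
    have "r \<gamma> k \<bullet> (TD ?S \<gamma> k *v r \<gamma> k) = 1 / alpha M \<gamma> k * (?z \<bullet> (Ups P p E M \<gamma> k *v ?z))"
      by (simp add: cdg_sat_def uminus_matrix_mult inner_Bmat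
          flip: scaleR_matrix_vector_assoc matrix_vector_mul_assoc)
    moreover have "0 \<le> alpha M \<gamma> k * q k + 2 * (?z \<bullet> d \<gamma> k) +
        1 / alpha M \<gamma> k * (?z \<bullet> (Ups P p E M \<gamma> k *v ?z))"
      unfolding q_def d_def using facets_D_subset g by (intro facet_energy[OF k \<alpha>[OF k]]) blast
    moreover have "r \<gamma> k \<bullet> (Bmat E M \<gamma> *v d \<gamma> k) = - (?z \<bullet> d \<gamma> k)"
      "d \<gamma> k \<bullet> (Bmat E M \<gamma> *v r \<gamma> k) = - (?z \<bullet> d \<gamma> k)"
      by (simp_all add: inner_Bmat[of "r \<gamma> k"] inner_commute[of "d \<gamma> k"])
    ultimately show ?thesis unfolding FD_def by simp
  qed
  moreover have "FN k \<gamma> \<le> 0" if k: "k \<in> elems M" and g: "\<gamma> \<in> facets_N P p M k" for k \<gamma>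
    using \<alpha>[OF k subsetD[OF facets_N_subset g]] diff_form_nonneg[OF k]
    by (simp add: FN_def q_def)
  ultimately show ?thesis
    by (simp add: split sum.distrib add_nonpos_nonpos sum_nonpos)
qed

text \<open>With s half the difference of the switches, \<open>T2\<close> and \<open>T3\<close> are
  (s - 1/2) B and (s + 1/2) B, and the other side has -s for s. Hence \<open>T2\<close> + B equals
  \<open>T3\<close> here and minus \<open>T2\<close> on the other side, while \<open>T3\<close> - B
  equals \<open>T2\<close> here and minus \<open>T3\<close> on the other side.\<close>

lemma s_I_adj_eq:
  assumes k: "k \<in> elems M"
  shows "s_I_adj P p E M (cdg_sat P p E M) z k = s_I P p E M (cdg_sat P p E M) z k"
  unfolding s_I_adj_def s_I_def Let_def
proof (intro sum.cong refl, goal_cases)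
  case (1 \<gamma>)
  note g = 1
  define v where "v = neighbour p M k \<gamma>"
  let ?B = "Bmat E M \<gamma>" and ?S = "cdg_sat P p E M"
  define s where "s = (beta M \<gamma> v - beta M \<gamma> k) / 2"
  note nf = neighbour_facts[OF k g, folded v_def]
  have T: "T1 ?S \<gamma> v = T1 ?S \<gamma> k" "T4 ?S \<gamma> k = 0" "T4 ?S \<gamma> v = 0"
    "T2 ?S \<gamma> k = (s - 1/2) *\<^sub>R ?B" "T2 ?S \<gamma> v = (- s - 1/2) *\<^sub>R ?B"
    "T3 ?S \<gamma> k = (s + 1/2) *\<^sub>R ?B" "T3 ?S \<gamma> v = (- s + 1/2) *\<^sub>R ?B"
    using T1_symmetric[OF k g] nf(4)
    by (simp_all add: cdg_sat_def Let_def s_def field_simps flip: v_def)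
  have c: "(s - 1/2) *\<^sub>R ?B + ?B = (s + 1/2) *\<^sub>R ?B" "(s + 1/2) *\<^sub>R ?B - ?B = (s - 1/2) *\<^sub>R ?B"
    using scaleR_add_left[of "s - 1/2" 1 ?B] scaleR_diff_left[of "s + 1/2" 1 ?B]
    by (simp_all add: algebra_simps)
  have d: "(- s - 1/2) *\<^sub>R x = - ((s + 1/2) *\<^sub>R x)" "(- s + 1/2) *\<^sub>R x = - ((s - 1/2) *\<^sub>R x)"
    "(1/2 - s) *\<^sub>R x = - ((s - 1/2) *\<^sub>R x)"
    for x :: "real^'f"
    by (simp_all flip: scaleR_minus_left)
  show ?case
    unfolding v_def[symmetric] T c
    by (simp add: scaleR_matrix_vector_assoc[symmetric] matrix_vector_mult_diff_distrib
        matrix_vector_right_distrib d uminus_matrix_mult scaleR_add_right scaleR_diff_right del: transpose_matrix_vector)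
qed

end

lemma energy_stable_cdg:
  fixes E :: "('n::finite, 'f::finite) reference_element"
  assumes P: "valid_problem P" and E: "valid_reference_element p E"
  shows "energy_stable P p E (cdg_sat P p E)"
  unfolding energy_stable_def
proof (intro allI impI)
  fix M :: "('n, 'f) disc" and u :: "real \<Rightarrow> nat \<Rightarrow> real^'n" and t :: real
  let ?rhs = "semidiscrete_rhs P p E M (cdg_sat P p E M) (\<lambda>_. 0) (\<lambda>_ _. 0) (\<lambda>_ _. 0)"
  assume M: "discretization P p E M" and t: "0 \<le> t"
    and u: "\<forall>t\<ge>0. \<forall>k\<in>elems M. ((\<lambda>s. u s k) has_vector_derivative ?rhs (u t) k) (at t within {0..})"
  interpret sbp_sat P p E M using P E M by unfold_locales
  have H: "Hmat M k *v (c *\<^sub>R x) = c *\<^sub>R (Hmat M k *v x)" for c x k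
    by (rule matrix_vector_mult_scaleR)
  \<comment> \<open>The symmetry of H merges the two terms of the product rule, hence the 2.\<close>
  have "((\<lambda>s. u s k \<bullet> (Hmat M k *v u s k)) has_real_derivative
      2 * (u t k \<bullet> (Hmat M k *v ?rhs (u t) k))) (at t within {0..})" if k: "k \<in> elems M" for k
  proof -
    have d: "((\<lambda>s. u s k) has_derivative (\<lambda>x. x *\<^sub>R ?rhs (u t) k)) (at t within {0..})"
      using u t k by (simp add: has_vector_derivative_def)
    have "((\<lambda>s. Hmat M k *v u s k) has_derivative (\<lambda>x. Hmat M k *v (x *\<^sub>R ?rhs (u t) k)))
        (at t within {0..})"
      by (rule bounded_linear.has_derivative[OF matrix_vector_mul_bounded_linear d])
    from has_derivative_inner[OF d this] show ?thesis
      unfolding has_field_derivative_def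
      by (rule has_derivative_eq_rhs)
        (auto simp: H inner_Hmat[of "u t k"] inner_commute[of "?rhs (u t) k"])
  qed
  then have "((\<lambda>s. \<Sum>k\<in>elems M. u s k \<bullet> (Hmat M k *v u s k)) has_real_derivative
      (\<Sum>k\<in>elems M. 2 * (u t k \<bullet> (Hmat M k *v ?rhs (u t) k)))) (at t within {0..})"
    by (rule DERIV_sum)
  moreover have "(\<Sum>k\<in>elems M. 2 * (u t k \<bullet> (Hmat M k *v ?rhs (u t) k))) \<le> 0"
    using energy_rate[of "u t"] by (simp flip: sum_distrib_left)
  ultimately show "\<exists>e\<le>0. ((\<lambda>s. \<Sum>k\<in>elems M. u s k \<bullet> (Hmat M k *v u s k)) has_real_derivative e)
      (at t within {0..})" by blast
qed

lemma conservative_cdg: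
  assumes "valid_problem P" and "valid_reference_element p E"
  shows "conservative P p E (cdg_sat P p E)"
  unfolding conservative_def
proof (intro allI impI, goal_cases)
  case (1 M u uB wB)
  interpret sbp_sat P p E M using assms 1 by unfold_locales
  show ?case by (rule conservation)
qed


section \<open>Geometry of the mesh\<close>

lemma differentiable_vec_nth:
  fixes f :: "real^2 \<Rightarrow> real^2"
  assumes "\<And>i. (\<lambda>x. f x $ i) differentiable (at x)"
  shows "f differentiable (at x)"
  unfolding differentiable_componentwise_within[of f]
  using assms by (auto simp: Basis_vec_def inner_axis)

lemma coord_differentiable: "(\<lambda>x::real^2. x $ i) differentiable (at x within A)"
  by (rule bounded_linear_imp_differentiable[OF bounded_linear_vec_nth])

lemma elem_map_differentiable: "elem_map p M k differentiable (at x)"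
  by (rule differentiable_vec_nth)
    (auto simp: elem_map_def intro!: derivative_intros coord_differentiable)

lemma elem_map_continuous: "continuous_on A (elem_map p M k)"
  by (meson continuous_at_imp_continuous_on differentiable_imp_continuous_within
      elem_map_differentiable)

lemma compact_ref_triangle: "compact ref_triangle"
proof -
  have "ref_triangle = {x. 0 \<le> x $ 1} \<inter> {x. 0 \<le> x $ 2} \<inter> {x. x $ 1 + x $ 2 \<le> 1}"
    by (auto simp: ref_triangle_def)
  moreover have "closed \<dots>"
    by (intro closed_Int closed_Collect_le continuous_intros)
  moreover have "ref_triangle \<subseteq> cball 0 2"
  proof
    fix x :: "real^2" assume "x \<in> ref_triangle"
    then show "x \<in> cball 0 2"
      using norm_le_l1_cart[of x] by (auto simp: sum_2 ref_triangle_def)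
  qed
  ultimately show ?thesis
    using bounded_subset[OF bounded_cball] by (auto simp: compact_eq_bounded_closed)
qed

lemma ref_edge_in_triangle: "t \<in> {0..1} \<Longrightarrow> ref_edge i t \<in> ref_triangle"
  by (auto simp: ref_edge_def ref_triangle_def)

lemma ref_edge_affine: "ref_edge i t = ref_edge i 0 + t *\<^sub>R (ref_edge i 1 - ref_edge i 0)"
  by (auto simp: ref_edge_def vec_eq_iff forall_2)

lemma ref_edge_diff: "\<bar>ref_edge i s $ j - ref_edge i t $ j\<bar> \<le> \<bar>s - t\<bar>"
  using exhaust_2[of j] by (auto simp: ref_edge_def)

text \<open>Increments from the single point \<open>t\<close> suffice: the difference quotients
  there are bounded by \<open>L\<close> and converge to \<open>D\<close>.\<close>

lemma has_vector_derivative_norm_bound: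
  fixes f :: "real \<Rightarrow> 'a::real_normed_vector"
  assumes d: "(f has_vector_derivative D) (at t)" and S: "open S" "t \<in> S"
    and L: "\<And>s. s \<in> S \<Longrightarrow> norm (f s - f t) \<le> L * \<bar>s - t\<bar>"
  shows "norm D \<le> L"
proof -
  let ?r = "\<lambda>s. norm (f s - f t - (s - t) *\<^sub>R D) / norm (s - t)"
  have "(?r \<longlongrightarrow> 0) (at t)"
    using d unfolding has_vector_derivative_def has_derivative_iff_norm by blast
  then have "((\<lambda>s. L + ?r s) \<longlongrightarrow> L + 0) (at t)" by (intro tendsto_intros)
  moreover have "\<forall>\<^sub>F s in at t. norm D \<le> L + ?r s"
    unfolding eventually_at_topological
  proof (intro exI conjI ballI impI)
    fix s assume s: "s \<in> S" "s \<noteq> t"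
    have "\<bar>s - t\<bar> * norm D = norm ((f s - f t) - (f s - f t - (s - t) *\<^sub>R D))" by simp
    also have "\<dots> \<le> norm (f s - f t) + norm (f s - f t - (s - t) *\<^sub>R D)" by (rule norm_triangle_ineq4)
    also have "\<dots> \<le> L * \<bar>s - t\<bar> + norm (f s - f t - (s - t) *\<^sub>R D)" using L[OF s(1)] by simp
    also have "\<dots> = \<bar>s - t\<bar> * (L + ?r s)" using s by (simp add: field_simps)
    finally show "norm D \<le> L + ?r s" using s by simp
  qed (use S in auto)
  ultimately have "norm D \<le> L + 0" by (intro tendsto_le[OF at_neq_bot _ tendsto_const])
  then show ?thesis by simp
qed

context sbp_sat
begin

lemma elem_map_inj: "k \<in> elems M \<Longrightarrow> inj_on (elem_map p M k) ref_triangle"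
  using mesh by (simp add: conforming_mesh_def)

lemma compact_elem: "compact (elem p M k)"
  unfolding elem_def by (rule compact_continuous_image[OF elem_map_continuous compact_ref_triangle])

lemma mesh_size_ge: "k \<in> elems M \<Longrightarrow> diameter (elem p M k) \<le> mesh_size p M"
  unfolding mesh_size_def using finite_elems by (intro Max_ge) auto

lemma elem_dist:
  assumes "k \<in> elems M" "x \<in> elem p M k" "y \<in> elem p M k"
  shows "norm (y - x) \<le> mesh_size p M"
  using diameter_bounded_bound[OF compact_imp_bounded[OF compact_elem] assms(3,2)]
    mesh_size_ge[OF assms(1)] by (simp add: dist_norm)

lemma mesh_size_pos: "0 < mesh_size p M"
proof -
  obtain k where k: "k \<in> elems M" using mesh by (auto simp: conforming_mesh_def)
  have "(0::real^2) \<in> ref_triangle" "axis 1 1 \<in> ref_triangle" "(0::real^2) \<noteq> axis 1 1"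
    by (auto simp: ref_triangle_def axis_def vec_eq_iff)
  then have "elem_map p M k 0 \<noteq> elem_map p M k (axis 1 1)"
    "elem_map p M k 0 \<in> elem p M k" "elem_map p M k (axis 1 1) \<in> elem p M k"
    using inj_onD[OF elem_map_inj[OF k]] unfolding elem_def by blast+
  then show ?thesis using elem_dist[OF k] by (metis order_less_le_trans right_minus_eq zero_less_norm_iff)
qed

text \<open>The parametrization is shared by both neighbours, so along the edge of a given element
  it may run backwards; \<open>e\<close> records the orientation.\<close>

lemma param_eq:
  assumes "k \<in> elems M" "\<gamma> \<in> facets p M k"
  obtains i e where "e = (\<lambda>t. t) \<or> e = (\<lambda>t. 1 - t)"
    "\<And>t. t \<in> {0..1} \<Longrightarrow> param M \<gamma> t = elem_map p M k (ref_edge i (e t))"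
proof -
  have "\<exists>i\<in>{0, 1, 2}. (\<forall>t\<in>{0..1}. param M \<gamma> t = elem_map p M k (ref_edge i t)) \<or>
        (\<forall>t\<in>{0..1}. param M \<gamma> t = elem_map p M k (ref_edge i (1 - t)))"
    using mesh assms by (simp add: conforming_mesh_def)
  then show ?thesis using that by blast
qed

lemma gl_nodes_in: "gl_nodes E $ m \<in> {0<..<1}"
  using E by (simp add: valid_reference_element_def)

lemma facet_node_in:
  assumes "k \<in> elems M" "\<gamma> \<in> facets p M k"
  shows "facet_node E M \<gamma> m \<in> elem p M k"
proof -
  obtain i e where "e = (\<lambda>t. t) \<or> e = (\<lambda>t. 1 - t)"
    "\<And>t. t \<in> {0..1} \<Longrightarrow> param M \<gamma> t = elem_map p M k (ref_edge i (e t))"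
    by (rule param_eq[OF assms]) blast
  then show ?thesis
    using gl_nodes_in[of m] by (auto simp: facet_node_def elem_def intro!: imageI ref_edge_in_triangle)
qed

lemma facet_node_inverse:
  fixes m :: 'f
  assumes "k \<in> elems M" "\<gamma> \<in> facets p M k"
  defines "\<xi> \<equiv> inv_into ref_triangle (elem_map p M k) (facet_node E M \<gamma> m)"
  shows "\<xi> \<in> ref_triangle" "elem_map p M k \<xi> = facet_node E M \<gamma> m"
  using facet_node_in[OF assms(1,2)] unfolding \<xi>_def elem_def
  by (auto intro: inv_into_into f_inv_into_f)

lemma vol_nodes_in: "vol_nodes E $ j \<in> ref_triangle"
  using E by (simp add: valid_reference_element_def)

text \<open>The scaling clause of \<open>mesh_family\<close> for one mesh. The constant coefficient,
  which only places the element, stays free.\<close>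

definition coef_bound :: "real \<Rightarrow> bool" where
  "coef_bound C \<longleftrightarrow> (\<forall>k\<in>elems M. \<forall>i a b. 1 \<le> a + b \<and> a + b \<le> p + 1 \<longrightarrow>
     \<bar>map_coef M k i a b\<bar> \<le> C * mesh_size p M ^ (a + b))"

text \<open>Subtracting the image of the origin removes the one coefficient without a bound. Each
  index takes at most p + 2 values, whence the constant.\<close>

lemma elem_map_graded:
  assumes C: "coef_bound C" "0 \<le> C" and k: "k \<in> elems M"
  shows "graded (mesh_size p M) (p + 1) (real (p + 2) * (real (p + 2) * C))
    (\<lambda>\<xi>. (elem_map p M k \<xi> - elem_map p M k 0) $ i)"
proof -
  let ?h = "mesh_size p M"
  let ?c = "\<lambda>a b. if a + b = 0 then 0 else map_coef M k i a b"
  have eq0: "elem_map p M k 0 $ i = (\<Sum>a\<le>p + 1. \<Sum>b\<le>p + 1 - a. if a + b = 0 then map_coef M k i a b else 0)"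
    unfolding elem_map_def vec_lambda_beta by (intro sum.cong refl) auto
  have eq: "(elem_map p M k \<xi> - elem_map p M k 0) $ i =
      (\<Sum>a\<le>p + 1. \<Sum>b\<le>p + 1 - a. ?c a b * \<xi> $ 1 ^ a * \<xi> $ 2 ^ b)" for \<xi>
    unfolding vector_minus_component eq0 unfolding elem_map_def vec_lambda_beta sum_subtractf[symmetric]
    by (intro sum.cong refl) auto
  have "graded ?h (p + 1) (\<Sum>a\<le>p + 1. \<Sum>b\<le>p + 1 - a. C)
    (\<lambda>\<xi>. \<Sum>a\<le>p + 1. \<Sum>b\<le>p + 1 - a. ?c a b * \<xi> $ 1 ^ a * \<xi> $ 2 ^ b)"
  proof (intro graded_sum graded.monomial)
    fix a b assume ab: "a \<in> {..p + 1}" "b \<in> {..p + 1 - a}"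
    then show "a + b \<le> p + 1" by auto
    then show "\<bar>?c a b\<bar> \<le> C * ?h ^ (a + b)"
      using C k mesh_size_pos unfolding coef_bound_def
      by (cases "a + b = 0") (auto intro!: mult_nonneg_nonneg)
  qed auto
  then have g: "graded ?h (p + 1) (\<Sum>a\<le>p + 1. \<Sum>b\<le>p + 1 - a. C)
    (\<lambda>\<xi>. (elem_map p M k \<xi> - elem_map p M k 0) $ i)"
    unfolding eq .
  have "(\<Sum>a\<le>p + 1. \<Sum>b\<le>p + 1 - a. C) \<le> (\<Sum>a\<le>p + 1. real (p + 2) * C)"
    using C(2) by (intro sum_mono) (auto intro!: mult_right_mono)
  also have "\<dots> = real (p + 2) * (real (p + 2) * C)" by simp
  finally show ?thesis by (rule graded_mono[OF g mesh_size_pos]) simp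
qed

text \<open>The speed of the facet parametrization is the only mesh dependent factor in
  \<open>Bmat\<close>. It is O(h) because the element map is Lipschitz with constant O(h) on the
  reference triangle.\<close>

lemma Bmat_bound:
  assumes C: "coef_bound C" "0 \<le> C" and h: "mesh_size p M \<le> 1"
    and k: "k \<in> elems M" and g: "\<gamma> \<in> facets p M k"
  shows "norm (vector_derivative (param M \<gamma>) (at (gl_nodes E $ m))) \<le>
    4 * (real (p + 2) * (real (p + 2) * C)) * real (p + 1) * mesh_size p M"
proof -
  let ?h = "mesh_size p M" and ?t = "gl_nodes E $ m"
  let ?A = "real (p + 2) * (real (p + 2) * C)"
  obtain i e where e: "e = (\<lambda>t. t) \<or> e = (\<lambda>t. 1 - t)" and
    param: "\<And>t. t \<in> {0..1} \<Longrightarrow> param M \<gamma> t = elem_map p M k (ref_edge i (e t))"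
    by (rule param_eq[OF k g]) blast
  have e': "(e has_real_derivative e 1 - e 0) (at ?t)" "\<And>s t. \<bar>e s - e t\<bar> = \<bar>s - t\<bar>"
    using e by (auto intro!: derivative_eq_intros)
  have "((\<lambda>t. ref_edge i (e t)) has_vector_derivative ((e 1 - e 0) *\<^sub>R (ref_edge i 1 - ref_edge i 0))) (at ?t)"
    by (subst ref_edge_affine) (use e' in \<open>auto intro!: derivative_eq_intros
      simp: has_real_derivative_iff_has_vector_derivative has_vector_derivative_def has_field_derivative_def\<close>)
  then have "(\<lambda>t. ref_edge i (e t)) differentiable (at ?t)"
    by (auto simp: has_vector_derivative_def differentiable_def)
  from differentiable_chain_at[OF this elem_map_differentiable]
  have "(\<lambda>t. elem_map p M k (ref_edge i (e t))) differentiable (at ?t)" by (simp add: o_def)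
  then obtain D where D: "((\<lambda>t. elem_map p M k (ref_edge i (e t))) has_vector_derivative D) (at ?t)"
    using vector_derivative_works by blast
  \<comment> \<open>\<open>param\<close> is prescribed on the closed unit interval only; Gauss nodes
    are interior, so its two-sided derivative is still determined there.\<close>
  have S: "open {0<..<(1::real)}" "?t \<in> {0<..<1}" using gl_nodes_in by auto
  have D': "(param M \<gamma> has_vector_derivative D) (at ?t)"
    using S param by (intro has_vector_derivative_transform_within_open[OF D S]) auto
  have "norm D \<le> 4 * ?A * real (p + 1) * ?h"
  proof (rule has_vector_derivative_norm_bound[OF D' S])
    fix s :: real assume s: "s \<in> {0<..<1}"
    let ?x = "ref_edge i (e s)" and ?y = "ref_edge i (e ?t)"
    have T: "?x \<in> ref_triangle" "?y \<in> ref_triangle"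
      using s S(2) e by (auto intro!: ref_edge_in_triangle)
    have "norm (param M \<gamma> s - param M \<gamma> ?t) \<le> (\<Sum>j\<in>UNIV. \<bar>(elem_map p M k ?x - elem_map p M k ?y) $ j\<bar>)"
      using s S(2) norm_le_l1_cart[of "elem_map p M k ?x - elem_map p M k ?y"] by (simp add: param)
    \<comment> \<open>The factor 4 is two components of the map times two reference coordinates,
      each of which moves by at most \<open>\<bar>s - ?t\<bar>\<close> along an edge.\<close>
    also have "\<dots> \<le> (\<Sum>j\<in>(UNIV::2 set). ?A * real (p + 1) * ?h * (2 * \<bar>s - ?t\<bar>))"
    proof (rule sum_mono)
      fix j :: 2
      have "\<bar>(elem_map p M k ?x - elem_map p M k ?y) $ j\<bar> \<le>
          ?A * real (p + 1) * ?h * (\<bar>?x $ 1 - ?y $ 1\<bar> + \<bar>?x $ 2 - ?y $ 2\<bar>)"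
        using graded_lipschitz[OF elem_map_graded[OF C k, of j] mesh_size_pos h T] by simp
      also have "\<dots> \<le> ?A * real (p + 1) * ?h * (2 * \<bar>s - ?t\<bar>)"
        using ref_edge_diff[of i "e s" 1 "e ?t"] ref_edge_diff[of i "e s" 2 "e ?t"] e'(2)[of s ?t]
          C(2) mesh_size_pos
        by (intro mult_left_mono) auto
      finally show "\<bar>(elem_map p M k ?x - elem_map p M k ?y) $ j\<bar> \<le> ?A * real (p + 1) * ?h * (2 * \<bar>s - ?t\<bar>)" .
    qed
    finally show "norm (param M \<gamma> s - param M \<gamma> ?t) \<le> 4 * ?A * real (p + 1) * ?h * \<bar>s - ?t\<bar>"
      by (simp add: algebra_simps)
  qed
  then show ?thesis using vector_derivative_at[OF D'] by simp
qed

text \<open>Otherwise the negative sum of the two normals points strictly into both elements, and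
  the tangent half planes place a nonempty open set in both, against the disjointness of interiors.
  The exact fluxes of the two sides cancel by this.\<close>

lemma normal_opposite:
  assumes k: "k \<in> elems M" and g: "\<gamma> \<in> facets_I p M k"
  shows "normal M \<gamma> (neighbour p M k \<gamma>) $ m = - normal M \<gamma> k $ m"
proof (rule ccontr)
  define v where "v = neighbour p M k \<gamma>"
  define x where "x = facet_node E M \<gamma> m"
  define nk where "nk = normal M \<gamma> k $ m"
  define nv where "nv = normal M \<gamma> v $ m"
  note nf = neighbour_facts[OF k g, folded v_def]
  assume "normal M \<gamma> (neighbour p M k \<gamma>) $ m \<noteq> - normal M \<gamma> k $ m"
  then have ne: "nk + nv \<noteq> 0"
    by (metis add.commute add_eq_0_iff2 nk_def nv_def v_def)
  have n: "outward_unit_normal (elem p M k) x nk" "outward_unit_normal (elem p M v) x nv"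
    using M k g nf facets_I_subset unfolding discretization_def x_def nk_def nv_def by blast+
  define w where "w = - (nk + nv)"
  \<comment> \<open>For unit vectors the product of either normal with their sum is 1 + nk . nv,
    which is half the squared norm of the sum.\<close>
  define c where "c = (norm (nk + nv))\<^sup>2 / 2"
  have c: "0 < c" using ne by (simp add: c_def)
  have norms: "nk \<bullet> nk = 1" "nv \<bullet> nv = 1"
    using n by (auto simp: outward_unit_normal_def dot_square_norm)
  then have dots: "nk \<bullet> w = - c" "nv \<bullet> w = - c"
    by (auto simp: w_def c_def power2_norm_eq_inner inner_add_left inner_add_right
        inner_diff_right inner_commute add_divide_distrib)
  have w0: "0 < norm w" using ne unfolding w_def norm_minus_cancel by simp
  \<comment> \<open>Half of the slope with which \<open>w\<close> enters the elements, so that the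
    ray along \<open>w\<close> satisfies both cone conditions strictly.\<close>
  define e where "e = c / (2 * norm w)"
  have e: "0 < e" using c w0 by (simp add: e_def)
  obtain d1 where d1: "d1 > 0" "\<And>y. norm (y - x) < d1 \<Longrightarrow> nk \<bullet> (y - x) < - e * norm (y - x) \<Longrightarrow> y \<in> elem p M k"
    using n(1) e unfolding outward_unit_normal_def by blast
  obtain d2 where d2: "d2 > 0" "\<And>y. norm (y - x) < d2 \<Longrightarrow> nv \<bullet> (y - x) < - e * norm (y - x) \<Longrightarrow> y \<in> elem p M v"
    using n(2) e unfolding outward_unit_normal_def by blast
  define d where "d = min d1 d2"
  define U where "U = {y. norm (y - x) < d} \<inter> {y. nk \<bullet> (y - x) < - e * norm (y - x)} \<inter>
    {y. nv \<bullet> (y - x) < - e * norm (y - x)}"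
  have "open U" unfolding U_def
    by (intro open_Int open_Collect_less continuous_intros)
  moreover have "U \<subseteq> elem p M k" "U \<subseteq> elem p M v" using d1 d2 by (auto simp: U_def d_def)
  ultimately have "U \<subseteq> interior (elem p M k) \<inter> interior (elem p M v)"
    by (simp add: interior_maximal)
  moreover have "interior (elem p M k) \<inter> interior (elem p M v) = {}"
    using mesh k nf(1,2) by (auto simp: conforming_mesh_def)
  moreover have "x + (d / (2 * norm w)) *\<^sub>R w \<in> U"
  proof -
    define s where "s = d / (2 * norm w)"
    have d: "0 < d" using d1 d2 by (simp add: d_def)
    then have s: "0 < s" using w0 by (simp add: s_def)
    have "s * norm w < d" using w0 d by (simp add: s_def)
    moreover have "s * (- c) < - e * (s * norm w)"
      using s c w0 by (simp add: e_def)
    ultimately show ?thesis using s dots by (simp add: U_def flip: s_def)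
  qed
  ultimately show False by blast
qed

text \<open>Area count: the determinant bound gives every element an area of order h^2 at least, and
  disjoint pieces of the elements fit into the domain.\<close>

lemma card_elems_bound:
  assumes C: "0 < C" "\<And>k x. k \<in> elems M \<Longrightarrow> x \<in> ref_triangle \<Longrightarrow>
    (mesh_size p M)\<^sup>2 \<le> C * \<bar>det (jacobian (elem_map p M k) (at x))\<bar>"
  shows "real (card (elems M)) * (mesh_size p M)\<^sup>2 \<le> 4 * C * measure lebesgue (Omega P)"
proof -
  let ?h = "mesh_size p M"
  \<comment> \<open>An open square inside the reference triangle: its images are open by invariance
    of domain, hence lie in the disjoint interiors, so overlaps of element boundaries never arise.
    Its area 1/4 gives the 4 in the bound.\<close>
  define Q :: "(real^2) set" where "Q = box 0 (\<chi> i. 1 / 2)"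
  have Q: "Q \<subseteq> ref_triangle"
    by (auto simp: Q_def ref_triangle_def mem_box_cart forall_2)
  have Q1: "measure lebesgue Q = 1 / 4"
  proof -
    have "measure lebesgue Q = measure lborel Q" by (simp add: Q_def)
    also have "\<dots> = measure lborel (cbox 0 (\<chi> i. 1 / 2) :: (real^2) set)"
      unfolding Q_def measure_lborel_box_eq measure_lborel_cbox_eq ..
    also have "\<dots> = 1 / 4" by (subst content_cbox_cart) (auto simp: interval_ne_empty_cart power2_eq_square)
    finally show ?thesis .
  qed
  have Om: "Omega P \<in> lmeasurable"
    using P by (intro lmeasurable_compact) (simp add: valid_problem_def)
  have img: "open (elem_map p M k ` Q)" "elem_map p M k ` Q \<subseteq> interior (elem p M k)"
    "elem_map p M k ` Q \<in> lmeasurable" "?h\<^sup>2 / (4 * C) \<le> measure lebesgue (elem_map p M k ` Q)"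
    if k: "k \<in> elems M" for k
  proof -
    have inj: "inj_on (elem_map p M k) Q" using elem_map_inj[OF k] Q inj_on_subset by blast
    show op: "open (elem_map p M k ` Q)"
      using inj by (intro invariance_of_domain elem_map_continuous) (auto simp: Q_def)
    have "elem_map p M k ` Q \<subseteq> elem p M k" using Q by (auto simp: elem_def)
    then show "elem_map p M k ` Q \<subseteq> interior (elem p M k)" using op by (rule interior_maximal)
    have "bounded (elem_map p M k ` Q)"
      using \<open>_ \<subseteq> elem p M k\<close> compact_imp_bounded[OF compact_elem] bounded_subset by blast
    then show lm: "elem_map p M k ` Q \<in> lmeasurable" using op lmeasurable_open by blast
    have d: "(elem_map p M k has_derivative (\<lambda>h. jacobian (elem_map p M k) (at x) *v h)) (at x within Q)" for x
      using elem_map_differentiable jacobian_works has_derivative_at_withinI by blast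
    have m: "((\<lambda>x. \<bar>det (matrix (\<lambda>h. jacobian (elem_map p M k) (at x) *v h))\<bar>) has_integral
        measure lebesgue (elem_map p M k ` Q)) Q"
      using lm by (subst has_measure_differentiable_image[OF _ d inj, symmetric]) (auto simp: Q_def)
    have c: "((\<lambda>x. ?h\<^sup>2 / C) has_integral ?h\<^sup>2 / C * measure lebesgue Q) Q"
    proof -
      have "Q \<in> lmeasurable" by (simp add: Q_def)
      then have "((\<lambda>x. 1) has_integral measure lebesgue Q) Q"
        by (simp add: has_integral_iff lmeasurable_iff_integrable_on lmeasure_integral)
      from has_integral_mult_right[OF this, of "?h\<^sup>2 / C"] show ?thesis by simp
    qed
    have "?h\<^sup>2 / C * measure lebesgue Q \<le> measure lebesgue (elem_map p M k ` Q)"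
    proof (rule has_integral_le[OF c m])
      fix x assume "x \<in> Q"
      then show "?h\<^sup>2 / C \<le> \<bar>det (matrix (\<lambda>h. jacobian (elem_map p M k) (at x) *v h))\<bar>"
        using C(2)[OF k, of x] C(1) Q by (auto simp: field_simps)
    qed
    then show "?h\<^sup>2 / (4 * C) \<le> measure lebesgue (elem_map p M k ` Q)" by (simp add: Q1)
  qed
  have "real (card (elems M)) * (?h\<^sup>2 / (4 * C)) \<le> (\<Sum>k\<in>elems M. measure lebesgue (elem_map p M k ` Q))"
    using sum_bounded_below[of "elems M" "?h\<^sup>2 / (4 * C)"] img(4) by fastforce
  also have "\<dots> = measure lebesgue (\<Union>k\<in>elems M. elem_map p M k ` Q)"
  proof (rule measure_UNION'[symmetric])
    show "pairwise (\<lambda>i j. disjnt (elem_map p M i ` Q) (elem_map p M j ` Q)) (elems M)"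
      unfolding pairwise_def disjnt_def
    proof (intro ballI impI)
      fix i j assume ij: "i \<in> elems M" "j \<in> elems M" "i \<noteq> j"
      then have "interior (elem p M i) \<inter> interior (elem p M j) = {}"
        using mesh by (auto simp: conforming_mesh_def)
      then show "elem_map p M i ` Q \<inter> elem_map p M j ` Q = {}" using img(2) ij by blast
    qed
  qed (use finite_elems img(3) in auto)
  also have "\<dots> \<le> measure lebesgue (Omega P)"
  proof (rule measure_mono_fmeasurable[OF _ _ Om])
    show "(\<Union>k\<in>elems M. elem_map p M k ` Q) \<subseteq> Omega P"
      using img(2) elem_subset interior_subset by blast
    show "(\<Union>k\<in>elems M. elem_map p M k ` Q) \<in> sets lebesgue"
      using img(3) finite_elems by (intro sets.finite_UN) auto
  qed
  finally show ?thesis using C(1) by (simp add: field_simps)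
qed

end


section \<open>Accuracy of extrapolation and differentiation\<close>

lemma matrix_vector_bound:
  fixes A :: "real^'n^'m"
  assumes "\<And>j. \<bar>A $ i $ j\<bar> \<le> a" "\<And>j. \<bar>x $ j\<bar> \<le> e"
  shows "\<bar>(A *v x) $ i\<bar> \<le> real CARD('n) * a * e"
proof -
  have "0 \<le> a" using assms(1) abs_ge_zero order_trans by blast
  have "\<bar>(A *v x) $ i\<bar> \<le> (\<Sum>j\<in>UNIV. \<bar>A $ i $ j * x $ j\<bar>)"
    unfolding matrix_vector_mult_def by simp
  also have "\<dots> \<le> (\<Sum>j\<in>(UNIV::'n set). a * e)"
    unfolding abs_mult using assms \<open>0 \<le> a\<close> by (intro sum_mono mult_mono) auto
  finally show ?thesis by simp
qed

lemma graded_differentiable: "graded h N B f \<Longrightarrow> f differentiable (at x)"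
  by (induction rule: graded.induct) (auto intro!: derivative_intros coord_differentiable)

lemma pd_add:
  assumes "f differentiable (at x)" "g differentiable (at x)"
  shows "pd i (\<lambda>x. f x + g x) x = pd i f x + pd i g x"
  using pd_eqI[OF has_derivative_add[OF assms[unfolded frechet_derivative_works]]]
  by (simp add: pd_def)

lemma pd_cmult:
  assumes "f differentiable (at x)"
  shows "pd i (\<lambda>x. c * f x) x = c * pd i f x"
  using pd_eqI[OF has_derivative_mult_right[OF assms[unfolded frechet_derivative_works]]]
  by (simp add: pd_def)

lemma nodal_add: "nodal p E M (\<lambda>x. f x + g x) k = nodal p E M f k + nodal p E M g k"
  by (simp add: nodal_def vec_eq_iff)

lemma nodal_cmult: "nodal p E M (\<lambda>x. c * f x) k = c *\<^sub>R nodal p E M f k"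
  by (simp add: nodal_def vec_eq_iff)

text \<open>\<open>S\<close> is a neighbourhood of the domain on which the data are smooth. Elements of size at
  most \<open>\<delta>\<close> need not be convex, but the segments between their points stay in \<open>L\<close>.\<close>

locale sbp_refinement =
  fixes P :: diffusion_problem and p :: nat
    and E :: "('n::finite, 'f::finite) reference_element"
    and Ms :: "nat \<Rightarrow> ('n, 'f) disc" and C :: real
    and S L :: "(real^2) set" and \<delta> :: real
  assumes P: "valid_problem P" and E: "valid_reference_element p E"
    and family: "mesh_family P p E Ms"
    and C_pos: "0 < C"
    and regular: "\<forall>n. \<forall>k\<in>elems (Ms n).
        (\<forall>i a b. 1 \<le> a + b \<and> a + b \<le> p + 1 \<longrightarrow>
           \<bar>map_coef (Ms n) k i a b\<bar> \<le> C * mesh_size p (Ms n) ^ (a + b)) \<and>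
        (\<forall>x\<in>ref_triangle.
           (mesh_size p (Ms n))\<^sup>2 \<le> C * \<bar>det (jacobian (elem_map p (Ms n) k) (at x))\<bar>) \<and>
        (\<forall>j. (mesh_size p (Ms n))\<^sup>2 \<le> C * H_weights (Ms n) k $ j \<and>
             H_weights (Ms n) k $ j \<le> C * (mesh_size p (Ms n))\<^sup>2) \<and>
        (\<forall>a i j. \<bar>Dmat (Ms n) a k $ i $ j\<bar> \<le> C / mesh_size p (Ms n)) \<and>
        (\<forall>\<gamma>\<in>facets p (Ms n) k.
           1 \<le> C * alpha (Ms n) \<gamma> k \<and> (\<forall>m j. \<bar>Rmat (Ms n) \<gamma> k $ m $ j\<bar> \<le> C))"
    and S: "open S" and L: "compact L" "L \<subseteq> S" and \<delta>: "0 < \<delta>"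
    and cball_L: "\<And>x. x \<in> Omega P \<Longrightarrow> cball x \<delta> \<subseteq> L"
begin

sublocale sat: sbp_sat P p E "Ms n" for n
  using P E family by unfold_locales (simp_all add: mesh_family_def)

abbreviation "h n \<equiv> mesh_size p (Ms n)"

lemma h_pos: "0 < h n" by (rule sat.mesh_size_pos)

lemma coef_bound: "sat.coef_bound n C"
  using regular by (auto simp: sat.coef_bound_def)

lemma Omega_compact: "compact (Omega P)"
  using P by (simp add: valid_problem_def)

lemma Omega_subset: "Omega P \<subseteq> S"
proof
  fix x assume "x \<in> Omega P"
  then have "cball x \<delta> \<subseteq> S" using cball_L L by blast
  then show "x \<in> S" using \<delta> centre_in_cball[of x \<delta>] by auto
qed

lemma segment_in_L:
  assumes "k \<in> elems (Ms n)" "h n \<le> \<delta>" "x \<in> elem p (Ms n) k" "y \<in> elem p (Ms n) k"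
  shows "closed_segment x y \<subseteq> L"
proof -
  have "x \<in> Omega P" using sat.elem_subset assms by blast
  then have "cball x \<delta> \<subseteq> L" by (rule cball_L)
  moreover have "closed_segment x y \<subseteq> cball x \<delta>"
    using sat.elem_dist[OF assms(1,3,4)] assms(2) \<delta>
    by (intro closed_segment_subset) (auto simp: dist_norm norm_minus_commute)
  ultimately show ?thesis by blast
qed

lemma taylor_elem:
  assumes f: "C_open m S f" and m: "0 < m"
  shows "\<exists>B\<ge>0. \<forall>n k x y. k \<in> elems (Ms n) \<and> h n \<le> \<delta> \<and> x \<in> elem p (Ms n) k \<and> y \<in> elem p (Ms n) k \<longrightarrow>
    \<bar>f y - (\<Sum>i<m. dsum i f (y - x) x / fact i)\<bar> \<le> B * h n ^ m"
proof -
  obtain B where B: "B \<ge> 0" "\<And>x y. closed_segment x y \<subseteq> L \<Longrightarrow>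
      \<bar>f y - (\<Sum>i<m. dsum i f (y - x) x / fact i)\<bar> \<le> B * norm (y - x) ^ m"
    using taylor_bound[OF S f m L] by blast
  show ?thesis
  proof (intro exI[of _ B] conjI B(1) allI impI, elim conjE)
    fix n k x y assume a: "k \<in> elems (Ms n)" "h n \<le> \<delta>" "x \<in> elem p (Ms n) k" "y \<in> elem p (Ms n) k"
    have "B * norm (y - x) ^ m \<le> B * h n ^ m"
      using sat.elem_dist[OF a(1,3,4)] B(1) by (intro mult_left_mono power_mono) auto
    then show "\<bar>f y - (\<Sum>i<m. dsum i f (y - x) x / fact i)\<bar> \<le> B * h n ^ m"
      using B(2)[OF segment_in_L[OF a]] by linarith
  qed
qed

text \<open>Expand \<open>f\<close> at the image of the origin, so that the displacement has no
  constant term and the pulled back Taylor polynomial is graded in h. Cutting it at degree p costs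
  O(h^(p+1)), which \<open>m \<le> p + 1\<close> absorbs into the Taylor error.\<close>

lemma pullback_approx:
  assumes f: "C_open m S f" and m: "0 < m" "m \<le> p + 1"
  shows "\<exists>B\<ge>0. \<forall>n k. k \<in> elems (Ms n) \<and> h n \<le> \<delta> \<and> h n \<le> 1 \<longrightarrow>
    (\<exists>q. poly2 p q \<and> (\<forall>\<xi>\<in>ref_triangle. \<bar>f (elem_map p (Ms n) k \<xi>) - q \<xi>\<bar> \<le> B * h n ^ m))"
proof -
  let ?A = "real (p + 2) * (real (p + 2) * C)"
  obtain B1 where B1: "B1 \<ge> 0" "\<And>n k x y. k \<in> elems (Ms n) \<Longrightarrow> h n \<le> \<delta> \<Longrightarrow> x \<in> elem p (Ms n) k \<Longrightarrow>
     y \<in> elem p (Ms n) k \<Longrightarrow> \<bar>f y - (\<Sum>i<m. dsum i f (y - x) x / fact i)\<bar> \<le> B1 * h n ^ m"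
    using taylor_elem[OF f m(1)] by blast
  have A: "0 \<le> ?A" using C_pos by simp
  obtain B2 where B2: "B2 \<ge> 0" "\<And>x h v. x \<in> Omega P \<Longrightarrow> 0 < h \<Longrightarrow>
     graded h (p + 1) ?A (\<lambda>\<xi>. v \<xi> $ 1) \<Longrightarrow> graded h (p + 1) ?A (\<lambda>\<xi>. v \<xi> $ 2) \<Longrightarrow>
    graded h (m * (p + 1)) B2 (\<lambda>\<xi>. \<Sum>i<m. dsum i f (v \<xi>) x / fact i)"
    using taylor_graded[OF f Omega_compact Omega_subset A, of "p + 1"] by blast
  have "\<exists>q. poly2 p q \<and> (\<forall>\<xi>\<in>ref_triangle. \<bar>f (elem_map p (Ms n) k \<xi>) - q \<xi>\<bar> \<le> (B1 + B2) * h n ^ m)"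
    if k: "k \<in> elems (Ms n)" and h: "h n \<le> \<delta>" "h n \<le> 1" for n k
  proof -
    let ?\<phi> = "elem_map p (Ms n) k"
    have in_elem: "?\<phi> \<xi> \<in> elem p (Ms n) k" if "\<xi> \<in> ref_triangle" for \<xi>
      using that by (simp add: elem_def)
    have 0: "?\<phi> 0 \<in> elem p (Ms n) k"
      by (rule in_elem) (simp add: ref_triangle_def)
    then have "?\<phi> 0 \<in> Omega P" using sat.elem_subset[OF k] by blast
    from B2(2)[OF this h_pos sat.elem_map_graded[OF coef_bound _ k] sat.elem_map_graded[OF coef_bound _ k]]
    have "graded (h n) (m * (p + 1)) B2 (\<lambda>\<xi>. \<Sum>i<m. dsum i f (?\<phi> \<xi> - ?\<phi> 0) (?\<phi> 0) / fact i)"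
      using C_pos by simp
    from graded_approx[OF this h_pos h(2), of p] obtain q where q: "poly2 p q" "\<And>\<xi>. \<xi> \<in> ref_triangle \<Longrightarrow>
      \<bar>(\<Sum>i<m. dsum i f (?\<phi> \<xi> - ?\<phi> 0) (?\<phi> 0) / fact i) - q \<xi>\<bar> \<le> B2 * h n ^ (p + 1)" by blast
    have le: "B2 * h n ^ (p + 1) \<le> B2 * h n ^ m"
      using m h h_pos[of n] B2(1) by (intro mult_left_mono power_decreasing) auto
    have "\<bar>f (?\<phi> \<xi>) - q \<xi>\<bar> \<le> (B1 + B2) * h n ^ m" if \<xi>: "\<xi> \<in> ref_triangle" for \<xi>
      using B1(2)[OF k h(1) 0 in_elem[OF \<xi>]] q(2)[OF \<xi>] le unfolding distrib_right by linarith
    then show ?thesis using q(1) by blast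
  qed
  then show ?thesis using B1(1) B2(1) by (intro exI[of _ "B1 + B2"]) auto
qed

text \<open>\<open>Rmat\<close> reproduces the polynomial \<open>q\<close> at the facet nodes, so
  only the deviation of \<open>f\<close> from \<open>q\<close> counts: once at the volume nodes,
  amplified by the bounded entries of \<open>Rmat\<close>, and once at the facet node
  itself.\<close>

lemma R_accuracy:
  assumes f: "C_open m S f" and m: "0 < m" "m \<le> p + 1"
  shows "\<exists>B\<ge>0. \<forall>n k. k \<in> elems (Ms n) \<and> h n \<le> \<delta> \<and> h n \<le> 1 \<longrightarrow> (\<forall>\<gamma>\<in>facets p (Ms n) k. \<forall>\<mu>.
    \<bar>(Rmat (Ms n) \<gamma> k *v nodal p E (Ms n) f k) $ \<mu> - f (facet_node E (Ms n) \<gamma> \<mu>)\<bar> \<le> B * h n ^ m)"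
proof -
  obtain B where B: "B \<ge> 0" "\<And>n k. k \<in> elems (Ms n) \<Longrightarrow> h n \<le> \<delta> \<Longrightarrow> h n \<le> 1 \<Longrightarrow>
    (\<exists>q. poly2 p q \<and> (\<forall>\<xi>\<in>ref_triangle. \<bar>f (elem_map p (Ms n) k \<xi>) - q \<xi>\<bar> \<le> B * h n ^ m))"
    using pullback_approx[OF assms] by blast
  have "\<bar>(Rmat (Ms n) \<gamma> k *v nodal p E (Ms n) f k) $ \<mu> - f (facet_node E (Ms n) \<gamma> \<mu>)\<bar>
      \<le> (real CARD('n) * C * B + B) * h n ^ m"
    if k: "k \<in> elems (Ms n)" and h: "h n \<le> \<delta>" "h n \<le> 1" and g: "\<gamma> \<in> facets p (Ms n) k" for n k \<gamma> \<mu>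
  proof -
    obtain q where q: "poly2 p q" "\<And>\<xi>. \<xi> \<in> ref_triangle \<Longrightarrow>
      \<bar>f (elem_map p (Ms n) k \<xi>) - q \<xi>\<bar> \<le> B * h n ^ m" using B(2)[OF k h] by blast
    define \<xi> where "\<xi> = inv_into ref_triangle (elem_map p (Ms n) k) (facet_node E (Ms n) \<gamma> \<mu>)"
    have \<xi>: "\<xi> \<in> ref_triangle" "elem_map p (Ms n) k \<xi> = facet_node E (Ms n) \<gamma> \<mu>"
      using sat.facet_node_inverse[OF k g] by (auto simp: \<xi>_def)
    let ?d = "nodal p E (Ms n) f k - (\<chi> j. q (vol_nodes E $ j))"
    have "\<bar>(Rmat (Ms n) \<gamma> k *v ?d) $ \<mu>\<bar> \<le> real CARD('n) * C * (B * h n ^ m)"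
      using regular k g q(2) sat.vol_nodes_in
      by (intro matrix_vector_bound) (auto simp: nodal_def vol_node_def)
    moreover have "(Rmat (Ms n) \<gamma> k *v ?d) $ \<mu> = (Rmat (Ms n) \<gamma> k *v nodal p E (Ms n) f k) $ \<mu> - q \<xi>"
      using sat.Rmat_exact[OF k g q(1)] by (simp add: matrix_vector_mult_diff_distrib \<xi>_def)
    ultimately show ?thesis
      using q(2)[OF \<xi>(1)] \<xi>(2) unfolding distrib_right by (simp add: mult.assoc)
  qed
  then show ?thesis
    using B(1) C_pos by (intro exI[of _ "real CARD('n) * C * B + B"]) auto
qed

lemma D_accuracy_monomial:
  "\<exists>K. \<forall>n. \<forall>k\<in>elems (Ms n). \<forall>i j. \<bar>(Dmat (Ms n) i k *v nodal p E (Ms n) (\<lambda>x. x $ 1 ^ a * x $ 2 ^ b) k) $ j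
     - pd i (\<lambda>x. x $ 1 ^ a * x $ 2 ^ b) (vol_node p E (Ms n) k j)\<bar> \<le> K * h n ^ p"
  using family C_class_monomial[of "p + 1" "Omega P" 1 a b] by (simp add: mesh_family_def)

text \<open>Turns function dependent constants into one: the error is linear in \<open>g\<close>,
  there are finitely many monomials of degree at most \<open>N\<close>, and \<open>B\<close> bounds
  the sum of the coefficients. Scale 1 means global coordinates.\<close>

lemma D_accuracy_graded:
  "\<exists>K\<ge>0. \<forall>B g. graded 1 N B g \<longrightarrow> (\<forall>n. \<forall>k\<in>elems (Ms n). \<forall>i j.
     \<bar>(Dmat (Ms n) i k *v nodal p E (Ms n) g k) $ j - pd i g (vol_node p E (Ms n) k j)\<bar> \<le> B * K * h n ^ p)"
proof -
  define err where "err g n k i j = (Dmat (Ms n) i k *v nodal p E (Ms n) g k) $ j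
     - pd i g (vol_node p E (Ms n) k j)" for g n k i j
  obtain K where K: "\<And>a b n k i j. k \<in> elems (Ms n) \<Longrightarrow>
      \<bar>err (\<lambda>x. x $ 1 ^ a * x $ 2 ^ b) n k i j\<bar> \<le> K a b * h n ^ p"
  proof -
    have "\<forall>ab. \<exists>K. \<forall>n. \<forall>k\<in>elems (Ms n). \<forall>i j.
        \<bar>err (\<lambda>x. x $ 1 ^ fst ab * x $ 2 ^ snd ab) n k i j\<bar> \<le> K * h n ^ p"
      unfolding err_def using D_accuracy_monomial by blast
    from choice[OF this] obtain K where K: "\<forall>ab n. \<forall>k\<in>elems (Ms n). \<forall>i j.
        \<bar>err (\<lambda>x. x $ 1 ^ fst ab * x $ 2 ^ snd ab) n k i j\<bar> \<le> K ab * h n ^ p" by blast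
    show ?thesis
    proof (rule that[of "\<lambda>a b. K (a, b)"])
      fix a b n k i j assume "k \<in> elems (Ms n)"
      then show "\<bar>err (\<lambda>x. x $ 1 ^ a * x $ 2 ^ b) n k i j\<bar> \<le> K (a, b) * h n ^ p"
        using K[rule_format, of k n "(a, b)" i j] by simp
    qed
  qed
  \<comment> \<open>Absolute values make \<open>K0\<close> nonnegative and dominate each constant,
    whatever the signs of the \<open>K a b\<close>.\<close>
  define K0 where "K0 = (\<Sum>a\<le>N. \<Sum>b\<le>N. \<bar>K a b\<bar>)"
  have K0: "0 \<le> K0" unfolding K0_def by (intro sum_nonneg) auto
  have le: "K a b \<le> K0" if "a + b \<le> N" for a b
  proof -
    have "\<bar>K a b\<bar> \<le> (\<Sum>b\<le>N. \<bar>K a b\<bar>)" using that by (intro member_le_sum) auto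
    also have "\<dots> \<le> K0" unfolding K0_def using that by (intro member_le_sum) (auto intro!: sum_nonneg)
    finally show ?thesis by simp
  qed
  have "\<bar>err g n k i j\<bar> \<le> B * K0 * h n ^ p" if "graded 1 N B g" and k: "k \<in> elems (Ms n)" for B g n k i j
    using that(1)
  proof (induction rule: graded.induct)
    case (monomial a b c B)
    have B: "0 \<le> B" "\<bar>c\<bar> \<le> B" using monomial(2) by auto
    have "(\<lambda>x::real^2. x $ 1 ^ a * x $ 2 ^ b) differentiable (at x)" for x
      by (auto intro!: derivative_intros coord_differentiable)
    then have "err (\<lambda>x. c * (x $ 1 ^ a * x $ 2 ^ b)) n k i j = c * err (\<lambda>x. x $ 1 ^ a * x $ 2 ^ b) n k i j"
      unfolding err_def nodal_cmult matrix_vector_mult_scaleR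
      by (simp add: pd_cmult right_diff_distrib)
    then have "\<bar>err (\<lambda>x. c * x $ 1 ^ a * x $ 2 ^ b) n k i j\<bar> = \<bar>c\<bar> * \<bar>err (\<lambda>x. x $ 1 ^ a * x $ 2 ^ b) n k i j\<bar>"
      by (simp add: abs_mult mult.assoc)
    also have "\<dots> \<le> B * (K0 * h n ^ p)"
    proof (rule mult_mono)
      show "\<bar>err (\<lambda>x. x $ 1 ^ a * x $ 2 ^ b) n k i j\<bar> \<le> K0 * h n ^ p"
        using K[OF k, of a b i j] le[OF monomial(1)] h_pos[of n]
        by (meson mult_right_mono order_trans zero_le_power less_imp_le)
    qed (use B in auto)
    finally show ?case by (simp add: mult.assoc)
  next
    case (add B f B' g)
    have "err (\<lambda>x. f x + g x) n k i j = err f n k i j + err g n k i j"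
      unfolding err_def nodal_add matrix_vector_right_distrib
      by (simp add: pd_add graded_differentiable[OF add(1)] graded_differentiable[OF add(2)])
    then show ?case using add(3,4) by (simp add: algebra_simps)
  qed
  then show ?thesis using K0 unfolding err_def by (intro exI[of _ K0] conjI allI impI ballI)
qed

text \<open>At each node \<open>f\<close> is exchanged for its Taylor polynomial there, which has
  the same gradient at that node. The exchange changes nodal values by O(h^m), and entries of
  \<open>Dmat\<close> of order 1/h cost one power; for the polynomial the uniform estimate applies
  since its coefficients are bounded over the compact domain.\<close>

lemma D_accuracy:
  assumes f: "C_open m S f" and m: "2 \<le> m" "m \<le> p + 1"
  shows "\<exists>B\<ge>0. \<forall>n k. k \<in> elems (Ms n) \<and> h n \<le> \<delta> \<and> h n \<le> 1 \<longrightarrow> (\<forall>i j.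
    \<bar>(Dmat (Ms n) i k *v nodal p E (Ms n) f k) $ j - pd i f (vol_node p E (Ms n) k j)\<bar> \<le> B * h n ^ (m - 1))"
proof -
  obtain B1 where B1: "B1 \<ge> 0" "\<And>n k x y. k \<in> elems (Ms n) \<Longrightarrow> h n \<le> \<delta> \<Longrightarrow> x \<in> elem p (Ms n) k \<Longrightarrow>
     y \<in> elem p (Ms n) k \<Longrightarrow> \<bar>f y - (\<Sum>i<m. dsum i f (y - x) x / fact i)\<bar> \<le> B1 * h n ^ m"
    using taylor_elem[OF f] m by auto
  obtain A0 where A0: "\<And>x. x \<in> Omega P \<Longrightarrow> norm x \<le> A0"
    using compact_imp_bounded[OF Omega_compact] bounded_iff by blast
  \<comment> \<open>Coefficient sum of \<open>(y - x) $ i\<close>: 1 for the coordinate of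
    \<open>y\<close>, and the radius of the domain for the constant \<open>x $ i\<close>.\<close>
  define A where "A = 1 + \<bar>A0\<bar>"
  have A: "0 \<le> A" by (simp add: A_def)
  have coord: "graded 1 1 A (\<lambda>y. (y - x) $ i)" if "x \<in> Omega P" for x i
  proof -
    have c: "graded 1 1 \<bar>A0\<bar> (\<lambda>_. - x $ i)"
      using A0[OF that] component_le_norm_cart[of x i] by (intro graded_const) auto
    have "graded 1 1 1 (\<lambda>y. y $ i)"
      using exhaust_2[of i]
    proof
      assume "i = 1"
      then show ?thesis using graded.monomial[of 1 0 1 1 1 1] by simp
    next
      assume "i = 2"
      then show ?thesis using graded.monomial[of 0 1 1 1 1 1] by simp
    qed
    from graded.add[OF this c] show ?thesis by (simp add: A_def)
  qed
  obtain B2 where B2: "B2 \<ge> 0" "\<And>x h v. x \<in> Omega P \<Longrightarrow> 0 < h \<Longrightarrow>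
     graded h 1 A (\<lambda>\<xi>. v \<xi> $ 1) \<Longrightarrow> graded h 1 A (\<lambda>\<xi>. v \<xi> $ 2) \<Longrightarrow>
    graded h (m * 1) B2 (\<lambda>\<xi>. \<Sum>i<m. dsum i f (v \<xi>) x / fact i)"
    using taylor_graded[OF f Omega_compact Omega_subset A, of 1] by blast
  obtain K where K: "K \<ge> 0" "\<And>B g n k i j. graded 1 m B g \<Longrightarrow> k \<in> elems (Ms n) \<Longrightarrow>
     \<bar>(Dmat (Ms n) i k *v nodal p E (Ms n) g k) $ j - pd i g (vol_node p E (Ms n) k j)\<bar> \<le> B * K * h n ^ p"
    using D_accuracy_graded[of m] by blast
  have "\<bar>(Dmat (Ms n) i k *v nodal p E (Ms n) f k) $ j - pd i f (vol_node p E (Ms n) k j)\<bar>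
      \<le> (real CARD('n) * C * B1 + B2 * K) * h n ^ (m - 1)"
    if k: "k \<in> elems (Ms n)" and h: "h n \<le> \<delta>" "h n \<le> 1" for n k i j
  proof -
    define x where "x = vol_node p E (Ms n) k j"
    have x: "x \<in> elem p (Ms n) k" unfolding x_def by (rule sat.vol_node_in[OF k])
    then have x\<Omega>: "x \<in> Omega P" using sat.elem_subset[OF k] by blast
    define T where "T = (\<lambda>y. \<Sum>i<m. dsum i f (y - x) x / fact i)"
    have T: "graded 1 m B2 T"
      using B2(2)[OF x\<Omega> zero_less_one coord[OF x\<Omega>] coord[OF x\<Omega>]] by (simp add: T_def)
    have pdT: "pd i T x = pd i f x" unfolding T_def by (rule taylor_poly_pd[OF m(1)])
    let ?d = "nodal p E (Ms n) f k - nodal p E (Ms n) T k"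
    have "\<bar>(Dmat (Ms n) i k *v ?d) $ j\<bar> \<le> real CARD('n) * (C / h n) * (B1 * h n ^ m)"
      using regular k B1(2)[OF k h(1) x sat.vol_node_in[OF k]]
      by (intro matrix_vector_bound) (auto simp: nodal_def T_def)
    also have "\<dots> = real CARD('n) * C * B1 * h n ^ (m - 1)"
      using m h_pos[of n] by (simp add: power_diff field_simps power_eq_if)
    finally have 1: "\<bar>(Dmat (Ms n) i k *v nodal p E (Ms n) f k) $ j - (Dmat (Ms n) i k *v nodal p E (Ms n) T k) $ j\<bar>
        \<le> real CARD('n) * C * B1 * h n ^ (m - 1)"
      by (simp add: matrix_vector_mult_diff_distrib)
    have "B2 * K * h n ^ p \<le> B2 * K * h n ^ (m - 1)"
      using m h h_pos[of n] B2(1) K(1) by (intro mult_left_mono power_decreasing) auto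
    with K(2)[OF T k, of i j] 1 pdT show ?thesis
      unfolding x_def[symmetric] distrib_right by linarith
  qed
  then show ?thesis
    using B1(1) B2(1) K(1) C_pos by (intro exI[of _ "real CARD('n) * C * B1 + B2 * K"]) auto
qed

end


section \<open>Uniform bounds and consistency\<close>

text \<open>The norm on matrices is the Frobenius norm, so this is Cauchy-Schwarz applied row by
  row.\<close>

lemma norm_matrix_vector: "norm (A *v x) \<le> norm A * norm (x :: real^'n)"
proof -
  have "norm (A *v x) \<le> L2_set (\<lambda>i. norm (A $ i) * norm x) UNIV"
    unfolding norm_vec_def[of "A *v x"]
    by (intro L2_set_mono) (auto simp: matrix_vector_mul_component Cauchy_Schwarz_ineq2)
  also have "\<dots> = norm A * norm x"
    unfolding norm_vec_def[of A] by (simp add: L2_set_left_distrib)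
  finally show ?thesis .
qed

lemma norm_transpose: "norm (transpose A) = norm (A :: real^'n^'m)"
  unfolding norm_vec_def L2_set_def transpose_def
  by (simp add: sum_nonneg) (rule sum.swap)

lemma norm_matrix_matrix: "norm (A ** B) \<le> norm (A :: real^'n^'m) * norm (B :: real^'k^'n)"
proof -
  have col: "transpose (A ** B) $ j = A *v (transpose B $ j)" for j
    by (simp add: vec_eq_iff transpose_def matrix_matrix_mult_def matrix_vector_mult_def)
  have "norm (transpose (A ** B)) \<le> L2_set (\<lambda>j. norm A * norm (transpose B $ j)) UNIV"
    unfolding norm_vec_def[of "transpose (A ** B)"] col
    by (intro L2_set_mono norm_matrix_vector norm_ge_zero)
  also have "\<dots> = norm A * norm (transpose B)"
    unfolding norm_vec_def[of "transpose B"] by (simp add: L2_set_right_distrib)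
  finally show ?thesis by (simp add: norm_transpose)
qed

section \<open>Calculus of uniform orders in h\<close>

context sbp_refinement
begin

text \<open>O(h^r), uniform over meshes, elements and the facets in \<open>Q\<close>. The order is
  an integer since differentiation and H^(-1) have negative ones. The restrictions on h keep Taylor
  segments in \<open>L\<close> and let higher powers be absorbed by lower ones. Quantities of the
  element alone carry a dummy facet.\<close>

definition ubound :: "(nat \<Rightarrow> nat \<Rightarrow> (real^2) set set) \<Rightarrow> int \<Rightarrow>
    (nat \<Rightarrow> nat \<Rightarrow> (real^2) set \<Rightarrow> 'a::real_normed_vector) \<Rightarrow> bool" where
  "ubound Q r x \<longleftrightarrow> (\<exists>K\<ge>0. \<forall>n k \<gamma>. h n \<le> \<delta> \<and> h n \<le> 1 \<and> k \<in> elems (Ms n) \<and> \<gamma> \<in> Q n k \<longrightarrow>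
     norm (x n k \<gamma>) \<le> K * h n powi r)"

lemma uboundI:
  assumes "\<And>n k \<gamma>. h n \<le> \<delta> \<Longrightarrow> h n \<le> 1 \<Longrightarrow> k \<in> elems (Ms n) \<Longrightarrow> \<gamma> \<in> Q n k \<Longrightarrow>
    norm (x n k \<gamma>) \<le> K * h n powi r"
  shows "ubound Q r x"
  unfolding ubound_def
proof (intro exI[of _ "\<bar>K\<bar>"] conjI abs_ge_zero allI impI, elim conjE)
  fix n k \<gamma> assume "h n \<le> \<delta>" "h n \<le> 1" "k \<in> elems (Ms n)" "\<gamma> \<in> Q n k"
  then have "norm (x n k \<gamma>) \<le> K * h n powi r" by (rule assms)
  also have "\<dots> \<le> \<bar>K\<bar> * h n powi r" using h_pos[of n] by (intro mult_right_mono) auto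
  finally show "norm (x n k \<gamma>) \<le> \<bar>K\<bar> * h n powi r" .
qed

lemma uboundE:
  assumes "ubound Q r x"
  obtains K where "0 \<le> K" "\<And>n k \<gamma>. h n \<le> \<delta> \<Longrightarrow> h n \<le> 1 \<Longrightarrow> k \<in> elems (Ms n) \<Longrightarrow> \<gamma> \<in> Q n k \<Longrightarrow>
    norm (x n k \<gamma>) \<le> K * h n powi r"
  using assms unfolding ubound_def by blast

lemma powi_le:
  assumes "r \<le> s" "h n \<le> 1"
  shows "h n powi s \<le> h n powi r"
proof -
  have "h n powi s = h n powi r * h n powi (s - r)"
    using h_pos[of n] by (simp flip: power_int_add)
  also have "\<dots> \<le> h n powi r * 1"
    using assms h_pos[of n] by (intro mult_left_mono power_int_le_one) auto
  finally show ?thesis by simp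
qed

lemma ubound_weaken:
  assumes "ubound Q s x" "r \<le> s" "\<And>n k. k \<in> elems (Ms n) \<Longrightarrow> Q' n k \<subseteq> Q n k"
  shows "ubound Q' r x"
proof -
  obtain K where K: "0 \<le> K" "\<And>n k \<gamma>. h n \<le> \<delta> \<Longrightarrow> h n \<le> 1 \<Longrightarrow> k \<in> elems (Ms n) \<Longrightarrow> \<gamma> \<in> Q n k \<Longrightarrow>
    norm (x n k \<gamma>) \<le> K * h n powi s" using uboundE[OF assms(1)] by blast
  show ?thesis
  proof (rule uboundI)
    fix n k \<gamma> assume a: "h n \<le> \<delta>" "h n \<le> 1" "k \<in> elems (Ms n)" "\<gamma> \<in> Q' n k"
    then have "norm (x n k \<gamma>) \<le> K * h n powi s" using K(2) assms(3) by blast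
    also have "\<dots> \<le> K * h n powi r" using K(1) powi_le[OF assms(2) a(2)] by (rule mult_left_mono[rotated])
    finally show "norm (x n k \<gamma>) \<le> K * h n powi r" .
  qed
qed

lemma ubound_cong:
  assumes "ubound Q r x" "\<And>n k \<gamma>. k \<in> elems (Ms n) \<Longrightarrow> \<gamma> \<in> Q n k \<Longrightarrow> y n k \<gamma> = x n k \<gamma>"
  shows "ubound Q r y"
  using assms unfolding ubound_def by metis

lemma ubound_add:
  assumes "ubound Q r x" "ubound Q r y"
  shows "ubound Q r (\<lambda>n k \<gamma>. x n k \<gamma> + y n k \<gamma>)"
proof -
  obtain K1 where K1: "0 \<le> K1" "\<And>n k \<gamma>. h n \<le> \<delta> \<Longrightarrow> h n \<le> 1 \<Longrightarrow> k \<in> elems (Ms n) \<Longrightarrow> \<gamma> \<in> Q n k \<Longrightarrow>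
    norm (x n k \<gamma>) \<le> K1 * h n powi r" using uboundE[OF assms(1)] by blast
  obtain K2 where K2: "0 \<le> K2" "\<And>n k \<gamma>. h n \<le> \<delta> \<Longrightarrow> h n \<le> 1 \<Longrightarrow> k \<in> elems (Ms n) \<Longrightarrow> \<gamma> \<in> Q n k \<Longrightarrow>
    norm (y n k \<gamma>) \<le> K2 * h n powi r" using uboundE[OF assms(2)] by blast
  show ?thesis
    by (rule uboundI[of _ _ "K1 + K2"], unfold distrib_right)
      (intro order_trans[OF norm_triangle_ineq] add_mono K1(2) K2(2))
qed

lemma ubound_minus: "ubound Q r x \<Longrightarrow> ubound Q r (\<lambda>n k \<gamma>. - x n k \<gamma>)"
  by (simp add: ubound_def)

lemma ubound_diff:
  "ubound Q r x \<Longrightarrow> ubound Q r y \<Longrightarrow> ubound Q r (\<lambda>n k \<gamma>. x n k \<gamma> - y n k \<gamma>)"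
  using ubound_add[OF _ ubound_minus, of Q r x y] by simp

lemma ubound_zero: "ubound Q r (\<lambda>n k \<gamma>. 0)"
  by (rule uboundI[of _ _ 0]) simp

lemma ubound_sum:
  "finite A \<Longrightarrow> (\<And>a. a \<in> A \<Longrightarrow> ubound Q r (x a)) \<Longrightarrow> ubound Q r (\<lambda>n k \<gamma>. \<Sum>a\<in>A. x a n k \<gamma>)"
  by (induction A rule: finite_induct) (auto intro: ubound_zero ubound_add)

text \<open>Orders add under any product that is submultiplicative in the norm. The sum of orders is
  a premise of its own so that it is checked by arithmetic and not by matching.\<close>

lemma ubound_product:
  assumes "ubound Q r x" "ubound Q s y" "t = r + s"
    and "\<And>a b. norm (f a b) \<le> norm a * norm b"
  shows "ubound Q t (\<lambda>n k \<gamma>. f (x n k \<gamma>) (y n k \<gamma>))"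
proof -
  obtain K1 where K1: "0 \<le> K1" "\<And>n k \<gamma>. h n \<le> \<delta> \<Longrightarrow> h n \<le> 1 \<Longrightarrow> k \<in> elems (Ms n) \<Longrightarrow> \<gamma> \<in> Q n k \<Longrightarrow>
    norm (x n k \<gamma>) \<le> K1 * h n powi r" using uboundE[OF assms(1)] by blast
  obtain K2 where K2: "0 \<le> K2" "\<And>n k \<gamma>. h n \<le> \<delta> \<Longrightarrow> h n \<le> 1 \<Longrightarrow> k \<in> elems (Ms n) \<Longrightarrow> \<gamma> \<in> Q n k \<Longrightarrow>
    norm (y n k \<gamma>) \<le> K2 * h n powi s" using uboundE[OF assms(2)] by blast
  show ?thesis
  proof (rule uboundI)
    fix n k \<gamma> assume a: "h n \<le> \<delta>" "h n \<le> 1" "k \<in> elems (Ms n)" "\<gamma> \<in> Q n k"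
    have "norm (f (x n k \<gamma>) (y n k \<gamma>)) \<le> norm (x n k \<gamma>) * norm (y n k \<gamma>)" by (rule assms(4))
    also have "\<dots> \<le> (K1 * h n powi r) * (K2 * h n powi s)"
      using K1 K2 a h_pos[of n] by (intro mult_mono) auto
    also have "\<dots> = K1 * K2 * h n powi t"
      using h_pos[of n] by (simp add: assms(3) power_int_add)
    finally show "norm (f (x n k \<gamma>) (y n k \<gamma>)) \<le> K1 * K2 * h n powi t" .
  qed
qed

lemma ubound_mv:
  fixes A :: "nat \<Rightarrow> nat \<Rightarrow> (real^2) set \<Rightarrow> real^'i::finite^'j::finite"
  assumes "ubound Q r A" "ubound Q s x" "t = r + s"
  shows "ubound Q t (\<lambda>n k \<gamma>. A n k \<gamma> *v x n k \<gamma>)"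
  using assms norm_matrix_vector by (rule ubound_product)

lemma ubound_mm:
  fixes A :: "nat \<Rightarrow> nat \<Rightarrow> (real^2) set \<Rightarrow> real^'i::finite^'j::finite"
    and X :: "nat \<Rightarrow> nat \<Rightarrow> (real^2) set \<Rightarrow> real^'l::finite^'i::finite"
  assumes "ubound Q r A" "ubound Q s X" "t = r + s"
  shows "ubound Q t (\<lambda>n k \<gamma>. A n k \<gamma> ** X n k \<gamma>)"
  using assms norm_matrix_matrix by (rule ubound_product)

lemma ubound_scaleR:
  assumes "ubound Q r c" "ubound Q s x" "t = r + s"
  shows "ubound Q t (\<lambda>n k \<gamma>. c n k \<gamma> *\<^sub>R x n k \<gamma>)"
  by (rule ubound_product[OF assms]) simp

lemma ubound_transpose:
  fixes A :: "nat \<Rightarrow> nat \<Rightarrow> (real^2) set \<Rightarrow> real^'i::finite^'j::finite"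
  shows "ubound Q r A \<Longrightarrow> ubound Q r (\<lambda>n k \<gamma>. transpose (A n k \<gamma>))"
  by (simp add: ubound_def norm_transpose)

lemma ubound_vecI:
  fixes x :: "nat \<Rightarrow> nat \<Rightarrow> (real^2) set \<Rightarrow> 'a::real_normed_vector^'i::finite"
  assumes "\<And>n k \<gamma> i. h n \<le> \<delta> \<Longrightarrow> h n \<le> 1 \<Longrightarrow> k \<in> elems (Ms n) \<Longrightarrow> \<gamma> \<in> Q n k \<Longrightarrow>
    norm (x n k \<gamma> $ i) \<le> K * h n powi r"
  shows "ubound Q r x"
proof (rule uboundI)
  fix n k \<gamma> assume a: "h n \<le> \<delta>" "h n \<le> 1" "k \<in> elems (Ms n)" "\<gamma> \<in> Q n k"
  have "norm (x n k \<gamma>) \<le> (\<Sum>i\<in>UNIV. norm (x n k \<gamma> $ i))"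
    unfolding norm_vec_def by (rule L2_set_le_sum) simp
  also have "\<dots> \<le> (\<Sum>i\<in>(UNIV::'i set). K * h n powi r)" by (intro sum_mono assms a)
  also have "\<dots> = (real CARD('i) * K) * h n powi r" by simp
  finally show "norm (x n k \<gamma>) \<le> (real CARD('i) * K) * h n powi r" .
qed

lemma ubound_matI:
  fixes A :: "nat \<Rightarrow> nat \<Rightarrow> (real^2) set \<Rightarrow> real^'i::finite^'j::finite"
  assumes "\<And>n k \<gamma> i j. h n \<le> \<delta> \<Longrightarrow> h n \<le> 1 \<Longrightarrow> k \<in> elems (Ms n) \<Longrightarrow> \<gamma> \<in> Q n k \<Longrightarrow>
    \<bar>A n k \<gamma> $ i $ j\<bar> \<le> K * h n powi r"
  shows "ubound Q r A"
proof (rule ubound_vecI)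
  fix n k \<gamma> i assume a: "h n \<le> \<delta>" "h n \<le> 1" "k \<in> elems (Ms n)" "\<gamma> \<in> Q n k"
  have "norm (A n k \<gamma> $ i) \<le> (\<Sum>j\<in>UNIV. \<bar>A n k \<gamma> $ i $ j\<bar>)" by (rule norm_le_l1_cart)
  also have "\<dots> \<le> (\<Sum>j\<in>(UNIV::'i set). K * h n powi r)" by (intro sum_mono assms a)
  also have "\<dots> = (real CARD('i) * K) * h n powi r" by simp
  finally show "norm (A n k \<gamma> $ i) \<le> (real CARD('i) * K) * h n powi r" .
qed

lemma ubound_diag:
  fixes d :: "nat \<Rightarrow> nat \<Rightarrow> (real^2) set \<Rightarrow> real^'i::finite"
  assumes "\<And>n k \<gamma> i. h n \<le> \<delta> \<Longrightarrow> h n \<le> 1 \<Longrightarrow> k \<in> elems (Ms n) \<Longrightarrow> \<gamma> \<in> Q n k \<Longrightarrow>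
    \<bar>d n k \<gamma> $ i\<bar> \<le> K * h n powi r" and "0 \<le> K"
  shows "ubound Q r (\<lambda>n k \<gamma>. diag (d n k \<gamma>))"
proof (rule ubound_matI)
  fix n k \<gamma> i j assume "h n \<le> \<delta>" "h n \<le> 1" "k \<in> elems (Ms n)" "\<gamma> \<in> Q n k"
  then show "\<bar>diag (d n k \<gamma>) $ i $ j\<bar> \<le> K * h n powi r"
    using assms(1)[of n k \<gamma> i] assms(2) h_pos[of n] by (auto simp: diag_def)
qed

abbreviation "fac n \<equiv> facets p (Ms n)"
abbreviation "facI n \<equiv> facets_I p (Ms n)"
abbreviation "facD n \<equiv> facets_D P p (Ms n)"
abbreviation "facN n \<equiv> facets_N P p (Ms n)"

lemma ubound_facI: "ubound fac r x \<Longrightarrow> ubound facI r x"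
  by (rule ubound_weaken[OF _ order_refl]) (auto simp: facets_I_def)

lemma ubound_facD: "ubound fac r x \<Longrightarrow> ubound facD r x"
  by (rule ubound_weaken[OF _ order_refl]) (auto simp: facets_D_def)

lemma ubound_facN: "ubound fac r x \<Longrightarrow> ubound facN r x"
  by (rule ubound_weaken[OF _ order_refl]) (auto simp: facets_N_def)

text \<open>The constant does not depend on the element, so it also holds at the neighbour, for
  which the facet is interior as well.\<close>

lemma ubound_neighbour:
  assumes "ubound fac r x"
  shows "ubound facI r (\<lambda>n k \<gamma>. x n (neighbour p (Ms n) k \<gamma>) \<gamma>)"
proof -
  obtain K where K: "0 \<le> K" "\<And>n k \<gamma>. h n \<le> \<delta> \<Longrightarrow> h n \<le> 1 \<Longrightarrow> k \<in> elems (Ms n) \<Longrightarrow> \<gamma> \<in> fac n k \<Longrightarrow>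
    norm (x n k \<gamma>) \<le> K * h n powi r" using uboundE[OF assms] by blast
  show ?thesis
    using sat.neighbour_facts sat.facets_I_subset by (intro uboundI[of _ _ K] K(2)) blast+
qed

lemma ubound_facet_sum:
  assumes "ubound Q r x" "\<And>n k. k \<in> elems (Ms n) \<Longrightarrow> Q n k \<subseteq> fac n k"
  shows "ubound fac r (\<lambda>n k _. \<Sum>\<gamma>\<in>Q n k. x n k \<gamma>)"
proof -
  obtain K where K: "0 \<le> K" "\<And>n k \<gamma>. h n \<le> \<delta> \<Longrightarrow> h n \<le> 1 \<Longrightarrow> k \<in> elems (Ms n) \<Longrightarrow> \<gamma> \<in> Q n k \<Longrightarrow>
    norm (x n k \<gamma>) \<le> K * h n powi r" using uboundE[OF assms(1)] by blast
  show ?thesis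
  proof (rule uboundI)
    fix n k \<gamma> assume a: "h n \<le> \<delta>" "h n \<le> 1" "k \<in> elems (Ms n)"
    have "card (Q n k) \<le> card (fac n k)"
      using assms(2)[OF a(3)] by (intro card_mono sat.finite_facets)
    also have "\<dots> \<le> card {0, 1, 2::nat}" unfolding facets_def by (rule card_image_le) simp
    finally have c: "card (Q n k) \<le> 3" by simp
    have "norm (\<Sum>\<gamma>\<in>Q n k. x n k \<gamma>) \<le> (\<Sum>\<gamma>\<in>Q n k. K * h n powi r)"
      by (intro sum_norm_le K(2) a)
    also have "\<dots> = card (Q n k) * (K * h n powi r)" by simp
    also have "\<dots> \<le> 3 * (K * h n powi r)"
      using c K(1) h_pos[of n] by (intro mult_right_mono) auto
    finally show "norm (\<Sum>\<gamma>\<in>Q n k. x n k \<gamma>) \<le> (3 * K) * h n powi r" by simp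
  qed
qed

section \<open>Orders of the mesh operators and SAT coefficients\<close>

lemma ubound_R: "ubound fac 0 (\<lambda>n k \<gamma>. Rmat (Ms n) \<gamma> k)"
  using regular by (intro ubound_matI[of _ _ C]) auto

lemma ubound_D: "ubound fac (-1) (\<lambda>n k \<gamma>. Dmat (Ms n) a k)"
  using regular by (intro ubound_matI[of _ _ C]) (auto simp: power_int_minus divide_inverse)

lemma ubound_Hinv: "ubound fac (-2) (\<lambda>n k \<gamma>. matrix_inv (Hmat (Ms n) k))"
proof (rule ubound_cong)
  show "ubound fac (-2) (\<lambda>n k \<gamma>. diag (\<chi> j. 1 / H_weights (Ms n) k $ j))"
  proof (rule ubound_diag)
    fix n k \<gamma> and j :: 'n assume k: "k \<in> elems (Ms n)"
    have "(h n)\<^sup>2 \<le> C * H_weights (Ms n) k $ j" using regular k by simp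
    then show "\<bar>(\<chi> j. 1 / H_weights (Ms n) k $ j) $ j\<bar> \<le> C * h n powi (-2)"
      using sat.H_pos[OF k, of j] h_pos[of n] by (simp add: power_int_minus field_simps)
  qed (use C_pos in simp)
qed (simp add: sat.matrix_inv_Hmat)

lemma ubound_N: "ubound fac 0 (\<lambda>n k \<gamma>. Nmat (Ms n) a \<gamma> k)"
  unfolding Nmat_def
proof (rule ubound_diag)
  fix n k \<gamma> and m :: 'f assume "k \<in> elems (Ms n)" "\<gamma> \<in> fac n k"
  then have "outward_unit_normal (elem p (Ms n) k) (facet_node E (Ms n) \<gamma> m) (normal (Ms n) \<gamma> k $ m)"
    using sat.M[of n] unfolding discretization_def by blast
  then show "\<bar>(\<chi> m. normal (Ms n) \<gamma> k $ m $ a) $ m\<bar> \<le> 1 * h n powi 0"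
    using component_le_norm_cart[of "normal (Ms n) \<gamma> k $ m" a] by (simp add: outward_unit_normal_def)
qed simp

lemma ubound_B: "ubound fac 1 (\<lambda>n k \<gamma>. Bmat E (Ms n) \<gamma>)"
proof -
  let ?K = "4 * (real (p + 2) * (real (p + 2) * C)) * real (p + 1)"
  let ?G = "\<Sum>m\<in>UNIV. \<bar>gl_weights E $ m\<bar>"
  show ?thesis
    unfolding Bmat_def
  proof (rule ubound_diag)
    fix n k \<gamma> and m :: 'f assume a: "h n \<le> 1" "k \<in> elems (Ms n)" "\<gamma> \<in> fac n k"
    have "\<bar>gl_weights E $ m\<bar> \<le> ?G" by (rule member_le_sum) auto
    moreover have "norm (vector_derivative (param (Ms n) \<gamma>) (at (gl_nodes E $ m))) \<le> ?K * h n"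
      using sat.Bmat_bound[OF coef_bound _ a] C_pos by simp
    ultimately have "\<bar>gl_weights E $ m\<bar> * norm (vector_derivative (param (Ms n) \<gamma>) (at (gl_nodes E $ m)))
        \<le> ?G * (?K * h n)" by (intro mult_mono) (auto intro: sum_nonneg)
    then show "\<bar>(\<chi> m. gl_weights E $ m * norm (vector_derivative (param (Ms n) \<gamma>) (at (gl_nodes E $ m)))) $ m\<bar>
        \<le> (?G * ?K) * h n powi 1" by (simp add: abs_mult mult.assoc)
  qed (use C_pos in \<open>auto intro!: mult_nonneg_nonneg sum_nonneg\<close>)
qed

lemma ubound_inverse_alpha: "ubound fac 0 (\<lambda>n k \<gamma>. 1 / alpha (Ms n) \<gamma> k)"
proof (rule uboundI)
  fix n k \<gamma> assume a: "k \<in> elems (Ms n)" "\<gamma> \<in> fac n k"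
  then have "1 \<le> C * alpha (Ms n) \<gamma> k" "0 < alpha (Ms n) \<gamma> k"
    using regular sat.M[of n] unfolding discretization_def by blast+
  then show "norm (1 / alpha (Ms n) \<gamma> k) \<le> C * h n powi 0" by (simp add: field_simps)
qed

definition flux :: "(real^2 \<Rightarrow> real) \<Rightarrow> 2 \<Rightarrow> real^2 \<Rightarrow> real" where
  "flux U a x = (\<Sum>b\<in>UNIV. lam P x $ a $ b * pd b U x)"

lemma flux_nth: "(lam P x *v grad U x) $ a = flux U a x"
  by (simp add: flux_def matrix_vector_mult_def grad_def)

lemma ubound_R_accuracy:
  assumes "C_open m S f" "0 < m" "m \<le> p + 1"
  shows "ubound fac (int m) (\<lambda>n k \<gamma>. Rmat (Ms n) \<gamma> k *v nodal p E (Ms n) f k - facet_values E (Ms n) f \<gamma> k)"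
proof -
  obtain B where "\<forall>n k. k \<in> elems (Ms n) \<and> h n \<le> \<delta> \<and> h n \<le> 1 \<longrightarrow> (\<forall>\<gamma>\<in>facets p (Ms n) k. \<forall>\<mu>.
    \<bar>(Rmat (Ms n) \<gamma> k *v nodal p E (Ms n) f k) $ \<mu> - f (facet_node E (Ms n) \<gamma> \<mu>)\<bar> \<le> B * h n ^ m)"
    using R_accuracy[OF assms] by blast
  then show ?thesis
    by (intro ubound_vecI[of _ _ B]) (auto simp: facet_values_def)
qed

lemma ubound_D_accuracy:
  assumes "C_open m S f" "2 \<le> m" "m \<le> p + 1"
  shows "ubound fac (int m - 1) (\<lambda>n k \<gamma>. Dmat (Ms n) a k *v nodal p E (Ms n) f k - nodal p E (Ms n) (pd a f) k)"
proof -
  have m: "int m - 1 = int (m - 1)" using assms by simp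
  obtain B where "\<forall>n k. k \<in> elems (Ms n) \<and> h n \<le> \<delta> \<and> h n \<le> 1 \<longrightarrow> (\<forall>i j.
    \<bar>(Dmat (Ms n) i k *v nodal p E (Ms n) f k) $ j - pd i f (vol_node p E (Ms n) k j)\<bar> \<le> B * h n ^ (m - 1))"
    using D_accuracy[OF assms] by blast
  then show ?thesis
    unfolding m by (intro ubound_vecI[of _ _ B]) (auto simp: nodal_def)
qed

context
  assumes lam: "\<And>a b. C_open p S (\<lambda>x. lam P x $ a $ b)" and p: "2 \<le> p"
begin

lemma ubound_L: "ubound fac 0 (\<lambda>n k \<gamma>. Lmat P p E (Ms n) a b k)"
proof -
  have "C_open 0 S (\<lambda>x. lam P x $ a $ b)" by (rule C_open_le[OF _ lam]) simp
  from dsum_bound[OF this Omega_compact Omega_subset]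
  obtain K where K: "0 \<le> K" "\<And>x. x \<in> Omega P \<Longrightarrow> \<bar>lam P x $ a $ b\<bar> \<le> K" by auto
  show ?thesis
    unfolding Lmat_def
    using K(2)[OF subsetD[OF sat.elem_subset sat.vol_node_in]]
    by (intro ubound_diag[OF _ K(1)]) auto
qed

lemma ubound_Dgam: "ubound fac (-1) (\<lambda>n k \<gamma>. Dgam P p E (Ms n) \<gamma> k)"
  unfolding Dgam_def
  by (intro ubound_sum ubound_mm[OF ubound_mm[OF ubound_mm[OF ubound_transpose[OF ubound_N] ubound_R refl]
      ubound_L refl] ubound_D]) simp_all

lemma ubound_Ups: "ubound fac (-2) (\<lambda>n k \<gamma>. Ups P p E (Ms n) \<gamma> k)"
  unfolding Ups_def
  by (intro ubound_sum ubound_mm[OF ubound_mm[OF ubound_mm[OF ubound_mm[OF ubound_mm[OF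
      ubound_transpose[OF ubound_N] ubound_R refl] ubound_Hinv refl] ubound_L refl]
      ubound_transpose[OF ubound_R] refl] ubound_N]) simp_all

text \<open>The order -2 that H^(-1) brings into \<open>Ups\<close> is balanced by the two factors B
  of order 1; \<alpha> is bounded below uniformly.\<close>

lemma ubound_TD: "ubound fac 0 (\<lambda>n k \<gamma>. TD (cdg_sat P p E (Ms n)) \<gamma> k)"
  unfolding cdg_sat_def sat.select_convs
  by (intro ubound_scaleR[OF ubound_inverse_alpha] ubound_mm[OF ubound_mm[OF ubound_B ubound_Ups refl] ubound_B])
    simp_all

lemma beta_cases:
  assumes "k \<in> elems (Ms n)" "\<gamma> \<in> facI n k"
  shows "\<bar>beta (Ms n) \<gamma> k - beta (Ms n) \<gamma> (neighbour p (Ms n) k \<gamma>)\<bar> = 1"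
proof -
  have "beta (Ms n) \<gamma> k \<in> {0, 1}" "beta (Ms n) \<gamma> k + beta (Ms n) \<gamma> (neighbour p (Ms n) k \<gamma>) = 1"
    using sat.M[of n] assms unfolding discretization_def by blast+
  then show ?thesis by auto
qed

lemma ubound_switch:
  "ubound facI 0 (\<lambda>n k \<gamma>. beta (Ms n) \<gamma> k - beta (Ms n) \<gamma> (neighbour p (Ms n) k \<gamma>) + c)"
  "ubound facI 0 (\<lambda>n k \<gamma>. beta (Ms n) \<gamma> (neighbour p (Ms n) k \<gamma>) - beta (Ms n) \<gamma> k + c)"
  by (rule uboundI[of _ _ "1 + \<bar>c\<bar>"], use beta_cases in fastforce)+

lemma ubound_T1: "ubound facI 0 (\<lambda>n k \<gamma>. T1 (cdg_sat P p E (Ms n)) \<gamma> k)"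
proof -
  have quotient: "ubound facI 0 (\<lambda>n k \<gamma>. x n k \<gamma> / y n k \<gamma>)"
    if "ubound facI 0 x" "ubound facI 0 (\<lambda>n k \<gamma>. 1 / y n k \<gamma>)" for x y :: "nat \<Rightarrow> nat \<Rightarrow> (real^2) set \<Rightarrow> real"
    using ubound_scaleR[OF that, of 0] by simp
  have half: "ubound facI 0 (\<lambda>n k \<gamma>. 1 / 2 :: real)"
    by (rule uboundI[of _ _ 1]) simp
  note k = ubound_scaleR[OF quotient[OF ubound_switch(1) ubound_facI[OF ubound_inverse_alpha]]
      ubound_facI[OF ubound_Ups] refl]
    and v = ubound_scaleR[OF quotient[OF ubound_switch(2) ubound_neighbour[OF ubound_inverse_alpha]]
      ubound_neighbour[OF ubound_Ups] refl]
  show ?thesis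
    unfolding cdg_sat_def sat.select_convs Let_def
    by (rule ubound_scaleR[OF half ubound_mm[OF ubound_mm[OF ubound_facI[OF ubound_B] ubound_add[OF k v] refl]
        ubound_facI[OF ubound_B] refl]]) simp
qed

lemma ubound_T2_T3:
  "ubound facI 1 (\<lambda>n k \<gamma>. T2 (cdg_sat P p E (Ms n)) \<gamma> k)"
  "ubound facI 1 (\<lambda>n k \<gamma>. T3 (cdg_sat P p E (Ms n)) \<gamma> k)"
proof -
  have half: "ubound facI 0 (\<lambda>n k \<gamma>. x n k \<gamma> / 2)"
    if "ubound facI 0 x" for x :: "nat \<Rightarrow> nat \<Rightarrow> (real^2) set \<Rightarrow> real"
    using that ubound_scaleR[of facI 0 "\<lambda>_ _ _. 1 / 2" 0 x 0] uboundI[of facI "\<lambda>_ _ _. 1 / 2 :: real" 1 0]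
    by simp
  show "ubound facI 1 (\<lambda>n k \<gamma>. T2 (cdg_sat P p E (Ms n)) \<gamma> k)"
    "ubound facI 1 (\<lambda>n k \<gamma>. T3 (cdg_sat P p E (Ms n)) \<gamma> k)"
    unfolding cdg_sat_def sat.select_convs Let_def
    using half[OF ubound_switch(2)[of "-1"]] half[OF ubound_switch(2)[of 1]]
    by (auto intro!: ubound_scaleR[OF _ ubound_facI[OF ubound_B], of 0])
qed

section \<open>Truncation errors at the exact solution\<close>

context
  fixes U F gD gN
  assumes U: "C_open (p + 1) S U" and sol: "steady_solution P F gD gN U"
begin

lemma C_open_pd: "C_open p S (pd a U)"
  using U by simp

lemma C_open_flux: "C_open p S (flux U a)"
proof -
  have "C_open p S (\<lambda>x. lam P x $ a $ 1 * pd 1 U x + lam P x $ a $ 2 * pd 2 U x)"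
    by (intro C_open_add C_open_mult S lam C_open_pd)
  then show ?thesis by (simp add: flux_def[abs_def] sum_2)
qed

lemma source_eq: "x \<in> Omega P \<Longrightarrow> F x = - (\<Sum>a\<in>UNIV. pd a (flux U a) x)"
proof -
  have "(\<lambda>y. (lam P y *v grad U y) $ a) = flux U a" for a by (rule ext) (rule flux_nth)
  moreover assume "x \<in> Omega P"
  ultimately show ?thesis using sol unfolding steady_solution_def divergence_def by simp
qed

definition discrete_flux :: "nat \<Rightarrow> 2 \<Rightarrow> nat \<Rightarrow> real^'n" where
  "discrete_flux n a k = (\<Sum>b\<in>UNIV. Lmat P p E (Ms n) a b k *v (Dmat (Ms n) b k *v nodal p E (Ms n) U k))"

lemma ubound_discrete_flux:
  "ubound fac (int p) (\<lambda>n k \<gamma>. discrete_flux n a k - nodal p E (Ms n) (flux U a) k)"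
proof -
  have eq: "discrete_flux n a k - nodal p E (Ms n) (flux U a) k = (\<Sum>b\<in>UNIV. Lmat P p E (Ms n) a b k *v
     (Dmat (Ms n) b k *v nodal p E (Ms n) U k - nodal p E (Ms n) (pd b U) k))" for n k
    by (simp add: discrete_flux_def matrix_vector_mult_diff_distrib sum_subtractf vec_eq_iff
        Lmat_def nodal_def flux_def)
  have "ubound fac (int p) (\<lambda>n k \<gamma>. Dmat (Ms n) b k *v nodal p E (Ms n) U k - nodal p E (Ms n) (pd b U) k)" for b
    using ubound_D_accuracy[OF U, of b] p by simp
  then show ?thesis
    unfolding eq by (intro ubound_sum ubound_mv[OF ubound_L]) simp_all
qed

text \<open>Two errors of the same size: the order p error of the discrete flux loses one power
  under the outer differentiation, and that differentiation is itself accurate to order p - 1 only,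
  because the flux is merely C^p.\<close>

lemma ubound_D2:
  "ubound fac (int p - 1) (\<lambda>n k \<gamma>. D2 P p E (Ms n) k *v nodal p E (Ms n) U k + nodal p E (Ms n) F k)"
proof (rule ubound_cong)
  show "ubound fac (int p - 1) (\<lambda>n k \<gamma>. \<Sum>a\<in>UNIV.
     Dmat (Ms n) a k *v (discrete_flux n a k - nodal p E (Ms n) (flux U a) k) +
     (Dmat (Ms n) a k *v nodal p E (Ms n) (flux U a) k - nodal p E (Ms n) (pd a (flux U a)) k))"
    using p by (intro ubound_sum ubound_add ubound_mv[OF ubound_D ubound_discrete_flux]
        ubound_D_accuracy[OF C_open_flux]) simp_all
  fix n k \<gamma> assume k: "k \<in> elems (Ms n)"
  have F: "nodal p E (Ms n) F k = - (\<Sum>a\<in>UNIV. nodal p E (Ms n) (pd a (flux U a)) k)"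
    using source_eq[OF subsetD[OF sat.elem_subset[OF k] sat.vol_node_in[OF k]]]
    by (simp add: nodal_def vec_eq_iff)
  have D2: "D2 P p E (Ms n) k *v nodal p E (Ms n) U k = (\<Sum>a\<in>UNIV. Dmat (Ms n) a k *v discrete_flux n a k)"
    by (simp add: D2_def discrete_flux_def sum_matrix_vector_mult sum_matrix_mult flip: matrix_vector_mul_assoc)
  show "D2 P p E (Ms n) k *v nodal p E (Ms n) U k + nodal p E (Ms n) F k = (\<Sum>a\<in>UNIV.
     Dmat (Ms n) a k *v (discrete_flux n a k - nodal p E (Ms n) (flux U a) k) +
     (Dmat (Ms n) a k *v nodal p E (Ms n) (flux U a) k - nodal p E (Ms n) (pd a (flux U a)) k))"
    unfolding F D2 by (simp add: matrix_vector_mult_diff_distrib sum_subtractf)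
qed

text \<open>The discrete flux is accurate to order p, and extrapolating the exact flux also gives p
  and not p + 1, since the flux is only C^p.\<close>

lemma ubound_Dgam_accuracy:
  "ubound fac (int p) (\<lambda>n k \<gamma>. Dgam P p E (Ms n) \<gamma> k *v nodal p E (Ms n) U k - facet_fluxes P E (Ms n) U \<gamma> k)"
proof -
  have eq: "Dgam P p E (Ms n) \<gamma> k *v nodal p E (Ms n) U k - facet_fluxes P E (Ms n) U \<gamma> k =
    (\<Sum>a\<in>UNIV. Nmat (Ms n) a \<gamma> k *v (Rmat (Ms n) \<gamma> k *v (discrete_flux n a k - nodal p E (Ms n) (flux U a) k) +
      (Rmat (Ms n) \<gamma> k *v nodal p E (Ms n) (flux U a) k - facet_values E (Ms n) (flux U a) \<gamma> k)))" for n k \<gamma>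
  proof -
    have "facet_fluxes P E (Ms n) U \<gamma> k = (\<Sum>a\<in>UNIV. Nmat (Ms n) a \<gamma> k *v facet_values E (Ms n) (flux U a) \<gamma> k)"
      by (simp add: facet_fluxes_def facet_values_def Nmat_def vec_eq_iff inner_vec_def flux_nth)
    moreover have "Dgam P p E (Ms n) \<gamma> k *v nodal p E (Ms n) U k =
        (\<Sum>a\<in>UNIV. Nmat (Ms n) a \<gamma> k *v (Rmat (Ms n) \<gamma> k *v discrete_flux n a k))"
      unfolding sat.Dgam_mult discrete_flux_def by (simp add: sum_matrix_mult)
    ultimately show ?thesis by (simp add: matrix_vector_mult_diff_distrib sum_subtractf)
  qed
  show ?thesis
    unfolding eq using p
    by (intro ubound_sum ubound_mv[OF ubound_N, where s = "int p"] ubound_add ubound_mv[OF ubound_R ubound_discrete_flux]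
        ubound_R_accuracy[OF C_open_flux]) simp_all
qed

lemma ubound_R_exact:
  "ubound fac (int p + 1) (\<lambda>n k \<gamma>. Rmat (Ms n) \<gamma> k *v nodal p E (Ms n) U k - facet_values E (Ms n) U \<gamma> k)"
  using ubound_R_accuracy[OF U] by (simp add: add.commute)

text \<open>Both sides approximate the same nodal values on the facet, which cancel in the
  difference.\<close>

lemma ubound_jump:
  "ubound facI (int p + 1) (\<lambda>n k \<gamma>. Rmat (Ms n) \<gamma> k *v nodal p E (Ms n) U k -
     Rmat (Ms n) \<gamma> (neighbour p (Ms n) k \<gamma>) *v nodal p E (Ms n) U (neighbour p (Ms n) k \<gamma>))"
  by (rule ubound_cong[OF ubound_diff[OF ubound_facI[OF ubound_R_exact] ubound_neighbour[OF ubound_R_exact]]])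
    (simp add: facet_values_def)

text \<open>The exact fluxes of the two sides are opposite because the normals are, and cancel in
  the sum.\<close>

lemma ubound_flux_jump:
  "ubound facI (int p) (\<lambda>n k \<gamma>. Dgam P p E (Ms n) \<gamma> k *v nodal p E (Ms n) U k +
     Dgam P p E (Ms n) \<gamma> (neighbour p (Ms n) k \<gamma>) *v nodal p E (Ms n) U (neighbour p (Ms n) k \<gamma>))"
proof (rule ubound_cong[OF ubound_add[OF ubound_facI[OF ubound_Dgam_accuracy] ubound_neighbour[OF ubound_Dgam_accuracy]]])
  fix n k \<gamma> assume "k \<in> elems (Ms n)" "\<gamma> \<in> facI n k"
  from sat.normal_opposite[OF this]
  have "facet_fluxes P E (Ms n) U \<gamma> (neighbour p (Ms n) k \<gamma>) = - facet_fluxes P E (Ms n) U \<gamma> k"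
    unfolding facet_fluxes_def by (intro vec_eq_iff[THEN iffD2] allI) simp
  then show "Dgam P p E (Ms n) \<gamma> k *v nodal p E (Ms n) U k +
     Dgam P p E (Ms n) \<gamma> (neighbour p (Ms n) k \<gamma>) *v nodal p E (Ms n) U (neighbour p (Ms n) k \<gamma>) =
     Dgam P p E (Ms n) \<gamma> k *v nodal p E (Ms n) U k - facet_fluxes P E (Ms n) U \<gamma> k +
     (Dgam P p E (Ms n) \<gamma> (neighbour p (Ms n) k \<gamma>) *v nodal p E (Ms n) U (neighbour p (Ms n) k \<gamma>) -
      facet_fluxes P E (Ms n) U \<gamma> (neighbour p (Ms n) k \<gamma>))" by simp
qed

text \<open>All contributions meet at p + 1: \<open>T1\<close> acts at order 0 on a jump of order p
  + 1, \<open>T3\<close> at order 1 on a flux jump of order p, and the order 1 of \<open>T2\<close>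
  compensates the -1 of \<open>Dgam\<close>.\<close>

lemma ubound_s_I:
  "ubound fac (int p + 1) (\<lambda>n k \<gamma>. s_I P p E (Ms n) (cdg_sat P p E (Ms n)) (nodal p E (Ms n) U) k)"
  unfolding s_I_def Let_def
proof (rule ubound_facet_sum)
  \<comment> \<open>A zero coefficient has every order; 2 matches the \<open>T2\<close> summand next
    to it.\<close>
  have T4: "ubound facI 2 (\<lambda>n k \<gamma>. T4 (cdg_sat P p E (Ms n)) \<gamma> k)"
    by (simp add: cdg_sat_def ubound_zero)
  show "ubound facI (int p + 1) (\<lambda>n k \<gamma>.
    transpose (Rmat (Ms n) \<gamma> k) *v
      (T1 (cdg_sat P p E (Ms n)) \<gamma> k *v (Rmat (Ms n) \<gamma> k *v nodal p E (Ms n) U k -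
         Rmat (Ms n) \<gamma> (neighbour p (Ms n) k \<gamma>) *v nodal p E (Ms n) U (neighbour p (Ms n) k \<gamma>)) +
       T3 (cdg_sat P p E (Ms n)) \<gamma> k *v (Dgam P p E (Ms n) \<gamma> k *v nodal p E (Ms n) U k +
         Dgam P p E (Ms n) \<gamma> (neighbour p (Ms n) k \<gamma>) *v nodal p E (Ms n) U (neighbour p (Ms n) k \<gamma>))) +
    transpose (Dgam P p E (Ms n) \<gamma> k) *v
      (T2 (cdg_sat P p E (Ms n)) \<gamma> k *v (Rmat (Ms n) \<gamma> k *v nodal p E (Ms n) U k -
         Rmat (Ms n) \<gamma> (neighbour p (Ms n) k \<gamma>) *v nodal p E (Ms n) U (neighbour p (Ms n) k \<gamma>)) +
       T4 (cdg_sat P p E (Ms n)) \<gamma> k *v (Dgam P p E (Ms n) \<gamma> k *v nodal p E (Ms n) U k +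
         Dgam P p E (Ms n) \<gamma> (neighbour p (Ms n) k \<gamma>) *v nodal p E (Ms n) U (neighbour p (Ms n) k \<gamma>))))"
    by (intro ubound_add
        ubound_mv[OF ubound_transpose[OF ubound_facI[OF ubound_R]], of "int p + 1"]
        ubound_mv[OF ubound_transpose[OF ubound_facI[OF ubound_Dgam]], of "int p + 2"]
        ubound_mv[OF ubound_T1 ubound_jump] ubound_mv[OF ubound_T2_T3(1) ubound_jump]
        ubound_mv[OF ubound_T2_T3(2) ubound_flux_jump] ubound_mv[OF T4 ubound_flux_jump])
      simp_all
qed (rule sat.facets_I_subset)

lemma ubound_s_B:
  "ubound fac (int p + 1) (\<lambda>n k \<gamma>. s_B P p E (Ms n) (cdg_sat P p E (Ms n)) (nodal p E (Ms n) U)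
     (facet_values E (Ms n) U) (facet_fluxes P E (Ms n) U) k)"
  unfolding s_B_def Let_def
proof (rule ubound_add; rule ubound_facet_sum)
  show "ubound facD (int p + 1) (\<lambda>n k \<gamma>.
    transpose (Rmat (Ms n) \<gamma> k) *v (TD (cdg_sat P p E (Ms n)) \<gamma> k *v
      (Rmat (Ms n) \<gamma> k *v nodal p E (Ms n) U k - facet_values E (Ms n) U \<gamma> k)) +
    transpose (Dgam P p E (Ms n) \<gamma> k) *v (- Bmat E (Ms n) \<gamma> *v
      (Rmat (Ms n) \<gamma> k *v nodal p E (Ms n) U k - facet_values E (Ms n) U \<gamma> k)))"
    by (intro ubound_facD ubound_add
        ubound_mv[OF ubound_transpose[OF ubound_R], of "int p + 1"]
        ubound_mv[OF ubound_transpose[OF ubound_Dgam], of "int p + 2"]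
        ubound_mv[OF ubound_TD ubound_R_exact] ubound_mv[OF ubound_minus[OF ubound_B] ubound_R_exact]) simp_all
  show "ubound facN (int p + 1) (\<lambda>n k \<gamma>. transpose (Rmat (Ms n) \<gamma> k) *v (Bmat E (Ms n) \<gamma> *v
      (Dgam P p E (Ms n) \<gamma> k *v nodal p E (Ms n) U k - facet_fluxes P E (Ms n) U \<gamma> k)))"
    by (intro ubound_facN ubound_mv[OF ubound_transpose[OF ubound_R], of "int p + 1"]
        ubound_mv[OF ubound_B ubound_Dgam_accuracy]) simp_all
qed (rule sat.facets_D_subset sat.facets_N_subset)+

text \<open>H^(-1) takes two powers from the order p + 1 of the SATs, which brings them level with
  the volume term.\<close>

lemma ubound_residual:
  "ubound fac (int p - 1) (\<lambda>n k \<gamma>. Lh P p E (Ms n) (cdg_sat P p E (Ms n)) (facet_values E (Ms n) U)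
     (facet_fluxes P E (Ms n) U) (nodal p E (Ms n) U) k - nodal p E (Ms n) F k)"
proof (rule ubound_cong)
  show "ubound fac (int p - 1) (\<lambda>n k \<gamma>.
    - (D2 P p E (Ms n) k *v nodal p E (Ms n) U k + nodal p E (Ms n) F k) +
    matrix_inv (Hmat (Ms n) k) *v s_I P p E (Ms n) (cdg_sat P p E (Ms n)) (nodal p E (Ms n) U) k +
    matrix_inv (Hmat (Ms n) k) *v s_B P p E (Ms n) (cdg_sat P p E (Ms n)) (nodal p E (Ms n) U)
     (facet_values E (Ms n) U) (facet_fluxes P E (Ms n) U) k)"
    by (intro ubound_add ubound_minus ubound_D2 ubound_mv[OF ubound_Hinv ubound_s_I]
        ubound_mv[OF ubound_Hinv ubound_s_B]) simp_all
qed (simp add: Lh_def)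

section \<open>From nodal residuals to the sum of element norms\<close>

lemma inner_H_sum: "v \<bullet> (Hmat (Ms n) k *v v) = (\<Sum>j\<in>UNIV. H_weights (Ms n) k $ j * (v $ j)\<^sup>2)"
  by (simp add: inner_vec_def Hmat_def power2_eq_square mult_ac)

lemma H_norm_bound:
  assumes "k \<in> elems (Ms n)"
  shows "H_norm (Hmat (Ms n) k) v \<le> sqrt C * h n * norm v"
proof -
  have norm2: "(norm v)\<^sup>2 = (\<Sum>j\<in>UNIV. (v $ j)\<^sup>2)"
    unfolding power2_norm_eq_inner by (simp add: inner_vec_def power2_eq_square)
  have "v \<bullet> (Hmat (Ms n) k *v v) \<le> (\<Sum>j\<in>UNIV. C * (h n)\<^sup>2 * (v $ j)\<^sup>2)"
    unfolding inner_H_sum using regular assms by (intro sum_mono mult_right_mono) auto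
  also have "\<dots> = C * (h n)\<^sup>2 * (norm v)\<^sup>2"
    by (simp add: norm2 sum_distrib_left)
  finally have "H_norm (Hmat (Ms n) k) v \<le> sqrt (C * (h n)\<^sup>2 * (norm v)\<^sup>2)"
    unfolding H_norm_def by (rule real_sqrt_le_mono)
  also have "\<dots> = sqrt C * h n * norm v"
    using h_pos[of n] by (simp add: real_sqrt_mult)
  finally show ?thesis .
qed

lemma H_norm_nonneg: "k \<in> elems (Ms n) \<Longrightarrow> 0 \<le> H_norm (Hmat (Ms n) k) v"
  unfolding H_norm_def inner_H_sum
  by (auto intro!: real_sqrt_ge_zero sum_nonneg simp: less_imp_le sat.H_pos)

text \<open>Each element contributes h * h^(p-1) = h^2 * h^(p-2), and the h^2 is consumed by the
  number of elements. What remains is h^(p-2), which vanishes in the limit by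
  \<open>3 \<le> p\<close>.\<close>

lemma residual_tendsto_zero:
  assumes "3 \<le> p"
  shows "(\<lambda>n. \<Sum>k\<in>elems (Ms n). H_norm (Hmat (Ms n) k)
    (Lh P p E (Ms n) (cdg_sat P p E (Ms n)) (facet_values E (Ms n) U) (facet_fluxes P E (Ms n) U)
       (nodal p E (Ms n) U) k - nodal p E (Ms n) F k)) \<longlonglongrightarrow> 0"
proof -
  let ?v = "\<lambda>n k. Lh P p E (Ms n) (cdg_sat P p E (Ms n)) (facet_values E (Ms n) U)
    (facet_fluxes P E (Ms n) U) (nodal p E (Ms n) U) k - nodal p E (Ms n) F k"
  obtain K where K: "0 \<le> K" "\<And>n k \<gamma>. h n \<le> \<delta> \<Longrightarrow> h n \<le> 1 \<Longrightarrow> k \<in> elems (Ms n) \<Longrightarrow> \<gamma> \<in> fac n k \<Longrightarrow>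
      norm (?v n k) \<le> K * h n powi (int p - 1)"
    using uboundE[OF ubound_residual] by blast
  define K' where "K' = 4 * C * measure lebesgue (Omega P) * (sqrt C * K)"
  have h0: "h \<longlonglongrightarrow> 0" using family by (simp add: mesh_family_def)
  have bound: "norm (\<Sum>k\<in>elems (Ms n). H_norm (Hmat (Ms n) k) (?v n k)) \<le> K' * h n ^ (p - 2)"
    if small: "h n \<le> \<delta>" "h n \<le> 1" for n
  proof -
    have p': "h n * h n powi (int p - 1) = (h n)\<^sup>2 * h n ^ (p - 2)"
    proof -
      have "h n powi (int p - 1) = h n ^ (p - 1)"
        using assms by (subst power_int_of_nat[symmetric]) (simp add: of_nat_diff)
      also have "h n * \<dots> = h n ^ p" using assms by (simp add: power_eq_if)
      also have "\<dots> = (h n)\<^sup>2 * h n ^ (p - 2)" 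
      proof -
        have "2 + (p - 2) = p" using assms by simp
        with power_add[of "h n" 2 "p - 2"] show ?thesis by (simp only:)
      qed
      finally show ?thesis .
    qed
    have "H_norm (Hmat (Ms n) k) (?v n k) \<le> sqrt C * K * ((h n)\<^sup>2 * h n ^ (p - 2))"
      if k: "k \<in> elems (Ms n)" for k
    proof -
      \<comment> \<open>The residual bound is formulated per facet although it does not involve one;
        any facet of the element instantiates it.\<close>
      obtain \<gamma> where "\<gamma> \<in> fac n k" by (auto simp: facets_def)
      then have "norm (?v n k) \<le> K * h n powi (int p - 1)" by (rule K(2)[OF small k])
      then have "sqrt C * h n * norm (?v n k) \<le> sqrt C * h n * (K * h n powi (int p - 1))"
        using C_pos h_pos[of n] by (intro mult_left_mono) auto
      also have "\<dots> = sqrt C * K * (h n * h n powi (int p - 1))" by simp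
      finally have "sqrt C * h n * norm (?v n k) \<le> sqrt C * K * ((h n)\<^sup>2 * h n ^ (p - 2))"
        unfolding p' .
      with H_norm_bound[OF k] show ?thesis by (rule order_trans)
    qed
    then have "(\<Sum>k\<in>elems (Ms n). H_norm (Hmat (Ms n) k) (?v n k)) \<le>
        real (card (elems (Ms n))) * (sqrt C * K * ((h n)\<^sup>2 * h n ^ (p - 2)))"
      by (rule sum_bounded_above)
    also have "\<dots> = (real (card (elems (Ms n))) * (h n)\<^sup>2) * (sqrt C * K * h n ^ (p - 2))" by simp
    also have "\<dots> \<le> (4 * C * measure lebesgue (Omega P)) * (sqrt C * K * h n ^ (p - 2))"
      using regular C_pos K(1) h_pos[of n]
      by (intro mult_right_mono sat.card_elems_bound) auto
    finally show ?thesis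
      using H_norm_nonneg by (simp add: K'_def sum_nonneg mult_ac)
  qed
  have "\<forall>\<^sub>F n in sequentially. h n < min \<delta> 1"
    using order_tendstoD(2)[OF h0, of "min \<delta> 1"] \<delta> by simp
  then have "\<forall>\<^sub>F n in sequentially. norm (\<Sum>k\<in>elems (Ms n). H_norm (Hmat (Ms n) k) (?v n k)) \<le> K' * h n ^ (p - 2)"
    by eventually_elim (rule bound; simp)
  moreover have "(\<lambda>n. K' * h n ^ (p - 2)) \<longlonglongrightarrow> 0"
    using tendsto_mult[OF tendsto_const tendsto_power[OF h0, of "p - 2"], of K'] assms by (simp add: power_0_left)
  ultimately show ?thesis by (rule Lim_null_comparison)
qed

end

end

end

lemma consistent_cdg:
  fixes E :: "('n::finite, 'f::finite) reference_element"
  assumes P: "valid_problem P" and E: "valid_reference_element p E" and p: "3 \<le> p"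
    and lam: "\<forall>i j. C_class p (Omega P) (\<lambda>x. lam P x $ i $ j)"
  shows "consistent P p E (cdg_sat P p E)"
  unfolding consistent_def
proof (intro allI impI, elim conjE)
  fix Ms :: "nat \<Rightarrow> ('n, 'f) disc" and F gD gN U
  assume fam: "mesh_family P p E Ms" and sol: "steady_solution P F gD gN U"
    and "C_class (p + 1) (Omega P) U"
  then obtain S0 where S0: "open S0" "Omega P \<subseteq> S0" "C_open (p + 1) S0 U"
    unfolding C_class_def by blast
  have "\<forall>i j. \<exists>T. open T \<and> Omega P \<subseteq> T \<and> C_open p T (\<lambda>x. lam P x $ i $ j)"
    using lam unfolding C_class_def by blast
  then obtain T where T: "\<And>i j. open (T i j)" "\<And>i j. Omega P \<subseteq> T i j"
    "\<And>i j. C_open p (T i j) (\<lambda>x. lam P x $ i $ j)" by metis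
  \<comment> \<open>One open neighbourhood on which the solution and all four entries of
    \<open>lam\<close> are smooth; the intersection is finite, hence open.\<close>
  define S where "S = S0 \<inter> (\<Inter>i. \<Inter>j. T i j)"
  have S: "open S" unfolding S_def by (intro open_Int open_INT S0 T ballI finite_UNIV finite)
  have "Omega P \<subseteq> S" unfolding S_def using S0(2) T(2) by blast
  have "compact (Omega P)" using P by (simp add: valid_problem_def)
  then obtain L \<delta> where L: "compact L" "L \<subseteq> S" "0 < \<delta>" "\<And>x. x \<in> Omega P \<Longrightarrow> cball x \<delta> \<subseteq> L"
    by (rule compact_neighbourhood[OF _ S \<open>Omega P \<subseteq> S\<close>]) blast
  from fam obtain C where C: "0 < C" "\<forall>n. \<forall>k\<in>elems (Ms n).
        (\<forall>i a b. 1 \<le> a + b \<and> a + b \<le> p + 1 \<longrightarrow>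
           \<bar>map_coef (Ms n) k i a b\<bar> \<le> C * mesh_size p (Ms n) ^ (a + b)) \<and>
        (\<forall>x\<in>ref_triangle.
           (mesh_size p (Ms n))\<^sup>2 \<le> C * \<bar>det (jacobian (elem_map p (Ms n) k) (at x))\<bar>) \<and>
        (\<forall>j. (mesh_size p (Ms n))\<^sup>2 \<le> C * H_weights (Ms n) k $ j \<and>
             H_weights (Ms n) k $ j \<le> C * (mesh_size p (Ms n))\<^sup>2) \<and>
        (\<forall>a i j. \<bar>Dmat (Ms n) a k $ i $ j\<bar> \<le> C / mesh_size p (Ms n)) \<and>
        (\<forall>\<gamma>\<in>facets p (Ms n) k.
           1 \<le> C * alpha (Ms n) \<gamma> k \<and> (\<forall>m j. \<bar>Rmat (Ms n) \<gamma> k $ m $ j\<bar> \<le> C))"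
    unfolding mesh_family_def by (elim conjE exE) blast
  interpret sbp_refinement P p E Ms C S L \<delta>
    by (unfold_locales; fact)
  have "C_open p S (\<lambda>x. lam P x $ i $ j)" for i j
    by (rule C_open_subset[OF _ T(3)]) (auto simp: S_def)
  moreover have "C_open (p + 1) S U"
    by (rule C_open_subset[OF _ S0(3)]) (auto simp: S_def)
  ultimately show "(\<lambda>n. \<Sum>k\<in>elems (Ms n). H_norm (Hmat (Ms n) k)
        (Lh P p E (Ms n) (cdg_sat P p E (Ms n)) (facet_values E (Ms n) U) (facet_fluxes P E (Ms n) U)
           (nodal p E (Ms n) U) k - nodal p E (Ms n) F k)) \<longlonglongrightarrow> 0"
    using p sol by (intro residual_tendsto_zero) auto
qed

lemma adjoint_consistent_cdg:
  fixes E :: "('n::finite, 'f::finite) reference_element"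
  assumes P: "valid_problem P" and E: "valid_reference_element p E" and p: "3 \<le> p"
    and lam: "\<forall>i j. C_class p (Omega P) (\<lambda>x. lam P x $ i $ j)"
  shows "adjoint_consistent P p E (cdg_sat P p E)"
  unfolding adjoint_consistent_def
proof (intro allI impI)
  fix Ms :: "nat \<Rightarrow> ('n, 'f) disc" and G psiD psiN psi
  assume a: "mesh_family P p E Ms \<and> steady_solution P G psiD psiN psi \<and> C_class (p + 1) (Omega P) psi"
  have eq: "Lh_adj P p E (Ms n) (cdg_sat P p E (Ms n)) zB wB z k = Lh P p E (Ms n) (cdg_sat P p E (Ms n)) zB wB z k"
    if "k \<in> elems (Ms n)" for n zB wB z k
  proof -
    interpret sbp_sat P p E "Ms n"
      using P E a by unfold_locales (simp_all add: mesh_family_def)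
    show ?thesis by (simp add: Lh_adj_def Lh_def s_I_adj_eq[OF that])
  qed
  have "(\<lambda>n. \<Sum>k\<in>elems (Ms n). H_norm (Hmat (Ms n) k)
        (Lh P p E (Ms n) (cdg_sat P p E (Ms n)) (facet_values E (Ms n) psi) (facet_fluxes P E (Ms n) psi)
           (nodal p E (Ms n) psi) k - nodal p E (Ms n) G k)) \<longlonglongrightarrow> 0"
    using consistent_cdg[OF assms] a unfolding consistent_def by blast
  then show "(\<lambda>n. \<Sum>k\<in>elems (Ms n). H_norm (Hmat (Ms n) k)
        (Lh_adj P p E (Ms n) (cdg_sat P p E (Ms n)) (facet_values E (Ms n) psi) (facet_fluxes P E (Ms n) psi)
           (nodal p E (Ms n) psi) k - nodal p E (Ms n) G k)) \<longlonglongrightarrow> 0"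
    by (simp add: eq cong: sum.cong)
qed

theorem proposition4:
  fixes P :: diffusion_problem and p :: nat
    and E :: "('n::finite, 'f::finite) reference_element"
  assumes "valid_problem P" and "valid_reference_element p E"
  shows "energy_stable P p E (cdg_sat P p E) \<and>
    conservative P p E (cdg_sat P p E) \<and>
    (3 \<le> p \<and> (\<forall>i j. C_class p (Omega P) (\<lambda>x. lam P x $ i $ j)) \<longrightarrow>
       consistent P p E (cdg_sat P p E) \<and>
       adjoint_consistent P p E (cdg_sat P p E))"
  using energy_stable_cdg conservative_cdg consistent_cdg adjoint_consistent_cdg assms by blast

end
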